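(* Let $n\ge 2$, let $g\in \mathrm{PGL}(n+1,\mathbb{C})$ be an element of infinite order, let $G=\langle g\rangle$ be the cyclic group it generates, and let $S\subset\mathbb{CP}^n$ be a one-dimensional algebraic set invariant under $g$. For every irreducible component $S_0\subset S$, one of the following holds: (1) After a coordinate change (i.e. after applying some element of $\mathrm{PGL}(n+1,\mathbb{C})$), $S_0$ is parametrized by a monomial curve, i.e. it coincides with the image of $$\xi_{\mathbf{k}}\colon \mathbb{CP}^1\to\mathbb{CP}^n,\quad [z:w]\mapsto\left[z^{k_1}: z^{k_2}w^{k_1-k_2}:\cdots: z^{k_m}w^{k_1-k_m}: w^{k_1}:\mathbf{0}\right],$$ where $1<m\le n$, the exponents are integers satisfying $1\le k_m<\cdots<k_2<k_1$, $\gcd(k_1,\ldots,k_m)=1$, and $\mathbf{0}$ stands for $n-m$ zero coordinates; or (2) There exists a finite-index subgroup $H\subset G$ preserving $S_0$ such that $H$ acts trivially on the minimal projective subspace spanned by $S_0$.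
   Context: $\mathrm{PGL}(n+1,\mathbb{C})=\mathrm{GL}(n+1,\mathbb{C})/\mathbb{C}^*$ acts on $\mathbb{CP}^n$ by projective transformations. A set $S$ is invariant under $g$ if $g(S)=S$. The minimal projective subspace spanned by a set $K\subset\mathbb{CP}^n$ is the smallest projective (linear) subspace of $\mathbb{CP}^n$ containing $K$.
   Formalization: The range 1<m≤n is replaced by 1≤m≤n, so S_0 may be a projective line (m=1, k_1=1); as printed the claim fails for g=[diag(1,2,3)] and the invariant line x_2=0 in CP^2, which satisfies neither (1) nor (2). *)

theory Defs
  imports
    "HOL-Algebra.Coset"
    "HOL-Algebra.Generated_Groups"
    "HOL-Algebra.Multiplicative_Group"
    "HOL-Library.Poly_Mapping"
    "HOL-Library.Extended_Nat"
    "Jordan_Normal_Form.Matrix"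
    "Jordan_Normal_Form.VS_Connect"
begin

section \<open>Complex projective space\<close>

text \<open>A point of projective space is represented by the set of all its homogeneous
  coordinate vectors, i.e. by a line through the origin with the origin removed. Coordinates of
  vectors in \<open>CP n\<close> are indexed by \<open>0, \<dots>, n\<close>.\<close>

definition proj_point :: "complex vec \<Rightarrow> complex vec set" where
  "proj_point v = {c \<cdot>\<^sub>v v | c. c \<noteq> 0}"

definition CP :: "nat \<Rightarrow> complex vec set set" where
  "CP n = proj_point ` (carrier_vec (Suc n) - {0\<^sub>v (Suc n)})"

section \<open>The projective linear group and its action\<close>

text \<open>\<open>PGL n\<close> and \<open>GL n\<close> consist of (classes of) matrices of size \<open>n + 1\<close>.\<close>

definition GL :: "nat \<Rightarrow> complex mat monoid" where
  "GL n = units_of (ring_mat TYPE(complex) (Suc n) ())"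

definition scalar_mats :: "nat \<Rightarrow> complex mat set" where
  "scalar_mats n = {c \<cdot>\<^sub>m 1\<^sub>m (Suc n) | c. c \<noteq> 0}"

definition PGL :: "nat \<Rightarrow> complex mat set monoid" where
  "PGL n = GL n Mod scalar_mats n"

text \<open>Elements of \<open>PGL n\<close> are cosets of matrices, so the class of \<open>A\<close> sends the point with
  coordinates \<open>v\<close> to the set of all products of representatives, which is the point with
  coordinates \<open>A *\<^sub>v v\<close>.\<close>

definition proj_act :: "complex mat set \<Rightarrow> complex vec set \<Rightarrow> complex vec set" where
  "proj_act g p = {A *\<^sub>v v | A v. A \<in> g \<and> v \<in> p}"

section \<open>Projective subspaces\<close>

definition proj_subspace :: "nat \<Rightarrow> complex vec set set \<Rightarrow> bool" where
  "proj_subspace n L \<longleftrightarrow>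
     (\<exists>W. VectorSpace.subspace class_ring W (module_vec TYPE(complex) (Suc n)) \<and>
          L = {p \<in> CP n. p \<subseteq> W})"

definition proj_span :: "nat \<Rightarrow> complex vec set set \<Rightarrow> complex vec set set" where
  "proj_span n K = \<Inter> {L. proj_subspace n L \<and> K \<subseteq> L}"

section \<open>Projective algebraic sets\<close>

text \<open>Polynomials in the variables \<open>x\<^sub>0, x\<^sub>1, \<dots>\<close> are finitely supported maps from monomials to
  coefficients, a monomial being the finitely supported map of its exponents.\<close>

type_synonym mpoly_complex = "(nat \<Rightarrow>\<^sub>0 nat) \<Rightarrow>\<^sub>0 complex"

definition mpoly_eval :: "mpoly_complex \<Rightarrow> complex vec \<Rightarrow> complex" where
  "mpoly_eval f v =
     (\<Sum>m\<in>Poly_Mapping.keys f. Poly_Mapping.lookup f m *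
        (\<Prod>i\<in>Poly_Mapping.keys m. (v $ i) ^ Poly_Mapping.lookup m i))"

definition homogeneous_mpoly :: "nat \<Rightarrow> mpoly_complex \<Rightarrow> bool" where
  "homogeneous_mpoly n f \<longleftrightarrow>
     (\<exists>d. \<forall>m\<in>Poly_Mapping.keys f. Poly_Mapping.keys m \<subseteq> {..n} \<and>
            (\<Sum>i\<in>Poly_Mapping.keys m. Poly_Mapping.lookup m i) = d)"

definition algebraic_set :: "nat \<Rightarrow> complex vec set set \<Rightarrow> bool" where
  "algebraic_set n X \<longleftrightarrow>
     (\<exists>F. (\<forall>f\<in>F. homogeneous_mpoly n f) \<and>
          X = {p \<in> CP n. \<forall>f\<in>F. \<forall>v\<in>p. mpoly_eval f v = 0})"

definition irreducible_algebraic_set :: "nat \<Rightarrow> complex vec set set \<Rightarrow> bool" where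
  "irreducible_algebraic_set n X \<longleftrightarrow>
     algebraic_set n X \<and> X \<noteq> {} \<and>
     (\<forall>A B. algebraic_set n A \<and> algebraic_set n B \<and> X = A \<union> B \<longrightarrow> X = A \<or> X = B)"

definition irreducible_component ::
    "nat \<Rightarrow> complex vec set set \<Rightarrow> complex vec set set \<Rightarrow> bool" where
  "irreducible_component n S X \<longleftrightarrow>
     irreducible_algebraic_set n X \<and> X \<subseteq> S \<and>
     (\<forall>Y. irreducible_algebraic_set n Y \<and> X \<subseteq> Y \<and> Y \<subseteq> S \<longrightarrow> Y = X)"

text \<open>The dimension is the supremum of the lengths of strictly increasing chains of irreducible
  algebraic subsets. With \<open>enat\<close> as its range, the empty set has dimension \<open>0\<close> here.\<close>

definition algebraic_dim :: "nat \<Rightarrow> complex vec set set \<Rightarrow> enat" where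
  "algebraic_dim n S =
     Sup {enat d | d. \<exists>Z :: nat \<Rightarrow> complex vec set set.
            (\<forall>i\<le>d. irreducible_algebraic_set n (Z i) \<and> Z i \<subseteq> S) \<and>
            (\<forall>i<d. Z i \<subset> Z (Suc i))}"

section \<open>Monomial curves\<close>

definition monomial_vec :: "nat \<Rightarrow> nat \<Rightarrow> (nat \<Rightarrow> nat) \<Rightarrow> complex \<Rightarrow> complex \<Rightarrow> complex vec" where
  "monomial_vec n m k z w =
     vec (Suc n) (\<lambda>j. if j < m then z ^ k (Suc j) * w ^ (k 1 - k (Suc j))
                      else if j = m then w ^ k 1
                      else 0)"

text \<open>The union runs over all representatives of the point \<open>p\<close> of \<open>CP 1\<close>; by homogeneity each
  of them yields the same point of \<open>CP n\<close>, provided \<open>k 1\<close> is the largest exponent.\<close>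

definition monomial_map ::
    "nat \<Rightarrow> nat \<Rightarrow> (nat \<Rightarrow> nat) \<Rightarrow> complex vec set \<Rightarrow> complex vec set" where
  "monomial_map n m k p = (\<Union>v\<in>p. proj_point (monomial_vec n m k (v $ 0) (v $ 1)))"

text \<open>The case \<open>m = 1\<close> (then \<open>k 1 = 1\<close> and the image is a projective line) has to be allowed
  here. With \<open>1 < m\<close>, the invariant line \<open>x\<^sub>2 = 0\<close> of the projective transformation
  \<open>diag(1, 2, 3)\<close> of the plane would satisfy neither alternative of the classification: all
  curves with \<open>1 < m\<close> span a subspace of dimension \<open>m\<close>, so none of them is a line, and no
  nontrivial power of that transformation fixes the line pointwise. For components other than
  lines \<open>m = 1\<close> cannot occur.\<close>

definition monomial_exponents :: "nat \<Rightarrow> nat \<Rightarrow> (nat \<Rightarrow> nat) \<Rightarrow> bool" where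
  "monomial_exponents n m k \<longleftrightarrow>
     1 \<le> m \<and> m \<le> n \<and> 1 \<le> k m \<and> (\<forall>i\<in>{1..<m}. k (Suc i) < k i) \<and> Gcd (k ` {1..m}) = 1"

end

theory Submission
  imports
    Defs
    "HOL-Computational_Algebra.Polynomial"
    "Jordan_Normal_Form.Jordan_Normal_Form_Existence"
begin

text \<open>
  Let \<open>A\<close> represent \<open>g\<close> and let \<open>X\<close> be an irreducible component of \<open>S\<close>. The cyclic group generated by
  \<open>A\<close> is too small to move points along curves, but its Zariski closure is not, and \<open>S\<close> is
  preserved by that closure. The part of the closure that matters can be written down explicitly.
  In a Jordan basis, \<open>A\<close> is \<open>D (1 + Q)\<close> with \<open>D = diag(d\<^sub>0, \<dots>, d\<^sub>n)\<close> and \<open>Q\<close> nilpotent and commuting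
  with \<open>D\<close>, so the coordinates of \<open>A\<^sup>k x\<close> are \<open>d\<^sub>i\<^sup>k r\<^sub>i(k)\<close> with polynomials \<open>r\<^sub>i\<close>. A form that vanishes
  on \<open>A\<^sup>k x\<close> for all \<open>k\<close> is therefore an exponential polynomial in \<open>k\<close> that vanishes identically,
  and since the functions \<open>k \<mapsto> c\<^sup>k\<close> are linearly independent over the polynomials
  (\<open>exponential_polynomial_eq_0\<close>), its coefficient at every base \<open>c\<close> is zero. Hence the form also
  vanishes at the points with coordinates \<open>s\<^bsup>w i\<^esup> r\<^sub>i(t)\<close>, for all numbers \<open>s\<close> and \<open>t\<close>, as soon as the
  weights \<open>w\<close> respect all multiplicative relations between the \<open>d\<^sub>i\<close>
  (\<open>hform_vanishes_on_weighted_orbit\<close>). This yields a unipotent flow, \<open>t \<mapsto> (1 + Q)\<^sup>t\<close>, and for each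
  system of weights a torus \<open>s \<mapsto> diag(s\<^bsup>w 0\<^esup>, \<dots>, s\<^bsup>w n\<^esup>)\<close>, and all of them preserve \<open>S\<close>.

  They preserve each component \<open>X\<close> too: the closure of the union of the translates of \<open>X\<close> under such
  a flow is irreducible, lies in \<open>S\<close> and contains \<open>X\<close>, so it is \<open>X\<close> by maximality
  (\<open>component_invariant\<close>).

  If one of the flows moves some point of \<open>X\<close>, then the closure of the orbit of that point is an
  irreducible curve inside \<open>X\<close>; as \<open>S\<close> has dimension one, it is all of \<open>X\<close>. Both kinds of orbits have
  the form \<open>s \<mapsto> \<Sum>\<^sub>j s\<^bsup>e j\<^esup> u\<^sub>j\<close> with linearly independent vectors \<open>u\<^sub>j\<close> and strictly decreasing
  exponents (for a unipotent flow one expands in powers of \<open>t\<close>, for a torus one sorts the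
  coordinates by weight). Taking the \<open>u\<^sub>j\<close> as the first basis vectors turns the orbit closure into a
  monomial curve (\<open>curve_in_indep_directions_is_monomial\<close>). What has to be checked is that
  monomial curves are closed: they are cut out by binomials, thanks to Bezout's identity for the
  exponents (\<open>binomials_cut_out_monomial_curve\<close>).

  If no flow moves any point of \<open>X\<close>, then \<open>Q\<close> kills the vectors of \<open>X\<close>, and any two eigenvalues
  that are both involved in one such vector differ by a root of unity, because otherwise some
  system of weights separates them (\<open>exists_separating_weighting\<close>). So a fixed power \<open>A\<^sup>M\<close> maps
  each vector of \<open>X\<close> to a multiple of itself; as \<open>X\<close> is irreducible, it lies in one eigenspace of
  \<open>A\<^sup>M\<close>, and so does its span. The elements of \<open>G\<close> that fix the span pointwise then form a subgroup
  of finite index, because it contains \<open>g\<^sup>M\<close>.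
\<close>

section \<open>Homogeneous forms\<close>

lemma mpoly_eval_superset:
  assumes "finite K" "Poly_Mapping.keys f \<subseteq> K"
  shows "mpoly_eval f v = (\<Sum>m\<in>K. Poly_Mapping.lookup f m *
        (\<Prod>i\<in>Poly_Mapping.keys m. (v $ i) ^ Poly_Mapping.lookup m i))"
  unfolding mpoly_eval_def using assms
  by (intro sum.mono_neutral_left) (auto simp: in_keys_iff)

lemma mpoly_eval_add: "mpoly_eval (f + g) v = mpoly_eval f v + mpoly_eval g v"
proof -
  let ?K = "Poly_Mapping.keys f \<union> Poly_Mapping.keys g"
  have "finite ?K" "Poly_Mapping.keys f \<subseteq> ?K" "Poly_Mapping.keys g \<subseteq> ?K"
    "Poly_Mapping.keys (f + g) \<subseteq> ?K"
    by (auto simp: keys_add)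
  then show ?thesis
    by (simp add: mpoly_eval_superset[of ?K] lookup_add distrib_right sum.distrib)
qed

lemma mpoly_eval_single:
  "mpoly_eval (Poly_Mapping.single m c) v =
     c * (\<Prod>i\<in>Poly_Mapping.keys m. (v $ i) ^ Poly_Mapping.lookup m i)"
  by (subst mpoly_eval_superset[of "{m}"]) auto

text \<open>A homogeneous form of degree \<open>d\<close>, seen as a function on coordinate vectors and given by a list of
  coefficients with exponents. Polynomial mappings would identify equal monomials; lists are not
  normalised, which makes sums, products and linear substitutions direct to form.\<close>

definition monomial_list ::
    "nat \<Rightarrow> nat \<Rightarrow> (complex vec \<Rightarrow> complex) \<Rightarrow> (complex \<times> (nat \<Rightarrow> nat)) list \<Rightarrow> bool" where
  "monomial_list n d \<phi> xs \<longleftrightarrow> (\<forall>x\<in>set xs. (\<Sum>i\<le>n. snd x i) = d) \<and>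
     (\<forall>v\<in>carrier_vec (Suc n). \<phi> v = (\<Sum>x\<leftarrow>xs. fst x * (\<Prod>i\<le>n. (v $ i) ^ snd x i)))"

definition hform :: "nat \<Rightarrow> nat \<Rightarrow> (complex vec \<Rightarrow> complex) \<Rightarrow> bool" where
  "hform n d \<phi> \<longleftrightarrow> (\<exists>xs. monomial_list n d \<phi> xs)"

lemma monomial_listD:
  assumes "monomial_list n d \<phi> xs"
  shows "x \<in> set xs \<Longrightarrow> (\<Sum>i\<le>n. snd x i) = d"
    "v \<in> carrier_vec (Suc n) \<Longrightarrow> \<phi> v = (\<Sum>x\<leftarrow>xs. fst x * (\<Prod>i\<le>n. (v $ i) ^ snd x i))"
  using assms unfolding monomial_list_def by blast+

lemma hform_cong:
  assumes "hform n d \<phi>" "\<And>v. v \<in> carrier_vec (Suc n) \<Longrightarrow> \<psi> v = \<phi> v"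
  shows "hform n d \<psi>"
  using assms unfolding hform_def monomial_list_def by fastforce

lemma hform_monomial: "(\<Sum>i\<le>n. e i) = d \<Longrightarrow> hform n d (\<lambda>v. c * (\<Prod>i\<le>n. (v $ i) ^ e i))"
  unfolding hform_def monomial_list_def by (intro exI[of _ "[(c, e)]"]) auto

lemma hform_zero: "hform n d (\<lambda>v. 0)"
  unfolding hform_def monomial_list_def by (intro exI[of _ "[]"]) auto

lemma hform_add:
  assumes "hform n d \<phi>" "hform n d \<psi>"
  shows "hform n d (\<lambda>v. \<phi> v + \<psi> v)"
proof -
  obtain xs where "monomial_list n d \<phi> xs" using assms(1) unfolding hform_def by blast
  note xs = monomial_listD[OF this]
  obtain ys where "monomial_list n d \<psi> ys" using assms(2) unfolding hform_def by blast
  note ys = monomial_listD[OF this]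
  show ?thesis unfolding hform_def monomial_list_def
    by (intro exI[of _ "xs @ ys"]) (use xs ys in auto)
qed

lemma hform_sum_list:
  "(\<And>x. x \<in> set xs \<Longrightarrow> hform n d (\<phi> x)) \<Longrightarrow> hform n d (\<lambda>v. \<Sum>x\<leftarrow>xs. \<phi> x v)"
  by (induction xs) (auto intro: hform_zero hform_add)

lemma hform_sum:
  "finite I \<Longrightarrow> (\<And>x. x \<in> I \<Longrightarrow> hform n d (\<phi> x)) \<Longrightarrow> hform n d (\<lambda>v. \<Sum>x\<in>I. \<phi> x v)"
  by (induction I rule: finite_induct) (auto intro: hform_zero hform_add)

lemma hform_monomial_mult:
  assumes "(\<Sum>i\<le>n. e i) = d'" "hform n d \<psi>"
  shows "hform n (d' + d) (\<lambda>v. c * (\<Prod>i\<le>n. (v $ i) ^ e i) * \<psi> v)"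
proof -
  obtain ys where "monomial_list n d \<psi> ys" using assms(2) unfolding hform_def by blast
  note * = monomial_listD[OF this]
  have "hform n (d' + d) (\<lambda>v. \<Sum>x\<leftarrow>ys. (c * fst x) * (\<Prod>i\<le>n. (v $ i) ^ (e i + snd x i)))"
    by (intro hform_sum_list hform_monomial) (use assms * in \<open>auto simp: sum.distrib\<close>)
  then show ?thesis
    by (rule hform_cong)
      (auto simp: * sum_list_const_mult[symmetric] power_add prod.distrib mult_ac)
qed

lemma hform_mult:
  assumes "hform n d \<phi>" "hform n d' \<psi>"
  shows "hform n (d + d') (\<lambda>v. \<phi> v * \<psi> v)"
proof -
  obtain xs where "monomial_list n d \<phi> xs" using assms(1) unfolding hform_def by blast
  note * = monomial_listD[OF this]
  have "hform n (d + d') (\<lambda>v. \<Sum>x\<leftarrow>xs. fst x * (\<Prod>i\<le>n. (v $ i) ^ snd x i) * \<psi> v)"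
    by (intro hform_sum_list hform_monomial_mult) (use assms * in auto)
  then show ?thesis
    by (rule hform_cong) (auto simp: * sum_list_mult_const)
qed

lemma hform_const: "hform n 0 (\<lambda>v. c)"
  using hform_monomial[of "\<lambda>_. 0" n 0 c] by simp

lemma hform_power: "hform n d \<phi> \<Longrightarrow> hform n (k * d) (\<lambda>v. \<phi> v ^ k)"
  by (induction k) (auto intro: hform_const hform_mult)

lemma hform_prod:
  "finite I \<Longrightarrow> (\<And>x. x \<in> I \<Longrightarrow> hform n (d x) (\<phi> x)) \<Longrightarrow>
     hform n (\<Sum>x\<in>I. d x) (\<lambda>v. \<Prod>x\<in>I. \<phi> x v)"
  by (induction I rule: finite_induct) (auto intro: hform_const hform_mult)

lemma hform_coord: "i \<le> n \<Longrightarrow> hform n 1 (\<lambda>v. v $ i)"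
  using hform_monomial[of "\<lambda>j. if j = i then 1 else 0" n 1 1]
  by (simp add: if_distrib[of "\<lambda>x. _ ^ x"] cong: if_cong)

lemma hform_linear: "hform n 1 (\<lambda>v. \<Sum>j\<le>n. a j * v $ j)"
  using hform_mult[OF hform_const hform_coord] by (intro hform_sum) auto

lemma hform_diff: "hform n d \<phi> \<Longrightarrow> hform n d \<psi> \<Longrightarrow> hform n d (\<lambda>v. \<phi> v - \<psi> v)"
  using hform_add[of n d \<phi> "\<lambda>v. -1 * \<psi> v"] hform_mult[OF hform_const, of n d \<psi> "-1"] by simp

lemma mult_mat_vec_index:
  "A \<in> carrier_mat N M \<Longrightarrow> v \<in> carrier_vec M \<Longrightarrow> i < N \<Longrightarrow> (A *\<^sub>v v) $ i = (\<Sum>j<M. A $$ (i, j) * v $ j)"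
  by (auto simp: scalar_prod_def atLeast0LessThan intro!: sum.cong)

text \<open>A monomial becomes a product of powers of linear forms.\<close>

lemma hform_linear_subst:
  assumes "hform n d \<phi>" "A \<in> carrier_mat (Suc n) (Suc n)"
  shows "hform n d (\<lambda>v. \<phi> (A *\<^sub>v v))"
proof -
  obtain xs where "monomial_list n d \<phi> xs" using assms(1) unfolding hform_def by blast
  note * = monomial_listD[OF this]
  have "hform n d (\<lambda>v. \<Sum>x\<leftarrow>xs. fst x * (\<Prod>i\<le>n. (\<Sum>j\<le>n. A $$ (i, j) * v $ j) ^ snd x i))"
  proof (rule hform_sum_list)
    fix x assume "x \<in> set xs"
    then have d: "d = 0 + (\<Sum>i\<le>n. snd x i * 1)" using * by simp
    show "hform n d (\<lambda>v. fst x * (\<Prod>i\<le>n. (\<Sum>j\<le>n. A $$ (i, j) * v $ j) ^ snd x i))"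
      unfolding d by (intro hform_mult hform_const hform_prod hform_power hform_linear) auto
  qed
  then show ?thesis
    by (rule hform_cong)
      (use assms in \<open>auto simp: * mult_mat_vec_index[where M = "Suc n"] lessThan_Suc_atMost
        simp del: index_mult_mat_vec intro!: arg_cong[of _ _ sum_list] prod.cong\<close>)
qed

lemma hform_scale:
  assumes "hform n d \<phi>" "v \<in> carrier_vec (Suc n)"
  shows "\<phi> (c \<cdot>\<^sub>v v) = c ^ d * \<phi> v"
proof -
  obtain xs where "monomial_list n d \<phi> xs" using assms(1) unfolding hform_def by blast
  note * = monomial_listD[OF this]
  have "(\<Prod>i\<le>n. ((c \<cdot>\<^sub>v v) $ i) ^ snd x i) = c ^ d * (\<Prod>i\<le>n. (v $ i) ^ snd x i)"
    if "x \<in> set xs" for x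
  proof -
    have "(\<Prod>i\<le>n. ((c \<cdot>\<^sub>v v) $ i) ^ snd x i) = (\<Prod>i\<le>n. c ^ snd x i * (v $ i) ^ snd x i)"
      using assms by (intro prod.cong) (auto simp: power_mult_distrib)
    then show ?thesis using *(1)[OF that] by (simp add: prod.distrib power_sum[symmetric])
  qed
  then have "\<phi> (c \<cdot>\<^sub>v v) = (\<Sum>x\<leftarrow>xs. c ^ d * (fst x * (\<Prod>i\<le>n. (v $ i) ^ snd x i)))"
    using assms by (auto simp: * intro!: arg_cong[of _ _ sum_list])
  also have "\<dots> = c ^ d * \<phi> v" using assms by (simp add: * sum_list_const_mult)
  finally show ?thesis .
qed

text \<open>This lemma and the next one translate between forms and the polynomial mappings in which
  algebraic sets are defined, so that what follows can be said about functions.\<close>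

lemma homogeneous_mpoly_hform:
  assumes "homogeneous_mpoly n f"
  shows "\<exists>d. hform n d (mpoly_eval f)"
proof -
  obtain d where d: "\<And>m. m \<in> Poly_Mapping.keys f \<Longrightarrow> Poly_Mapping.keys m \<subseteq> {..n} \<and>
            (\<Sum>i\<in>Poly_Mapping.keys m. Poly_Mapping.lookup m i) = d"
    using assms unfolding homogeneous_mpoly_def by auto
  have "hform n d (\<lambda>v. \<Sum>m\<in>Poly_Mapping.keys f. Poly_Mapping.lookup f m *
        (\<Prod>i\<le>n. (v $ i) ^ Poly_Mapping.lookup m i))"
  proof (intro hform_sum hform_monomial)
    fix m assume m: "m \<in> Poly_Mapping.keys f"
    have "(\<Sum>i\<in>Poly_Mapping.keys m. Poly_Mapping.lookup m i) = (\<Sum>i\<le>n. Poly_Mapping.lookup m i)"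
      using d[OF m] by (intro sum.mono_neutral_left) (auto simp: in_keys_iff)
    then show "(\<Sum>i\<le>n. Poly_Mapping.lookup m i) = d" using d[OF m] by simp
  qed auto
  moreover have "(\<Prod>i\<in>Poly_Mapping.keys m. (v $ i) ^ Poly_Mapping.lookup m i) =
      (\<Prod>i\<le>n. (v $ i) ^ Poly_Mapping.lookup m i)" if "m \<in> Poly_Mapping.keys f"
    for m and v :: "complex vec"
    using d[OF that] by (intro prod.mono_neutral_left) (auto simp: in_keys_iff)
  ultimately show ?thesis
    by (intro exI[of _ d], elim hform_cong) (simp add: mpoly_eval_def cong: sum.cong)
qed

lemma hform_homogeneous_mpoly:
  assumes "hform n d \<phi>"
  shows "\<exists>f. homogeneous_mpoly n f \<and> (\<forall>v\<in>carrier_vec (Suc n). \<phi> v = mpoly_eval f v)"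
proof -
  obtain xs where "monomial_list n d \<phi> xs" using assms(1) unfolding hform_def by blast
  note * = monomial_listD[OF this]
  define E :: "(nat \<Rightarrow> nat) \<Rightarrow> (nat \<Rightarrow>\<^sub>0 nat)" where
    "E e = Poly_Mapping.Abs_poly_mapping (\<lambda>i. if i \<le> n then e i else 0)" for e
  have "{i. (if i \<le> n then e i else 0) \<noteq> 0} \<subseteq> {..n}" for e :: "nat \<Rightarrow> nat"
    by auto
  then have lE: "Poly_Mapping.lookup (E e) = (\<lambda>i. if i \<le> n then e i else 0)" for e
    unfolding E_def by (intro lookup_Abs_poly_mapping) (meson finite_subset finite_atMost)
  have kE: "Poly_Mapping.keys (E e) \<subseteq> {..n}" for e
    by (auto simp: in_keys_iff lE split: if_splits)
  have sE: "(\<Sum>i\<in>Poly_Mapping.keys (E e). Poly_Mapping.lookup (E e) i) = (\<Sum>i\<le>n. e i)" for e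
    by (subst sum.mono_neutral_left[OF _ kE]) (auto simp: in_keys_iff lE)
  have pE: "(\<Prod>i\<in>Poly_Mapping.keys (E e). (v $ i) ^ Poly_Mapping.lookup (E e) i) =
      (\<Prod>i\<le>n. (v $ i) ^ e i)" for e and v :: "complex vec"
    by (subst prod.mono_neutral_left[OF _ kE]) (auto simp: in_keys_iff lE)
  define f where "f = (\<Sum>x\<leftarrow>xs. Poly_Mapping.single (E (snd x)) (fst x))"
  have k: "Poly_Mapping.keys (\<Sum>x\<leftarrow>ys. Poly_Mapping.single (E (snd x)) (fst x)) \<subseteq> E ` snd ` set ys"
    for ys :: "(complex \<times> (nat \<Rightarrow> nat)) list"
  proof (induction ys)
    case (Cons y ys)
    then show ?case
      using Poly_Mapping.keys_add[of "Poly_Mapping.single (E (snd y)) (fst y)"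
          "\<Sum>x\<leftarrow>ys. Poly_Mapping.single (E (snd x)) (fst x)"]
      by (auto split: if_splits)
  qed auto
  have "mpoly_eval (\<Sum>x\<leftarrow>ys. Poly_Mapping.single (E (snd x)) (fst x)) v =
      (\<Sum>x\<leftarrow>ys. fst x * (\<Prod>i\<le>n. (v $ i) ^ snd x i))"
    for ys :: "(complex \<times> (nat \<Rightarrow> nat)) list" and v
    by (induction ys) (auto simp: mpoly_eval_add mpoly_eval_single pE, simp add: mpoly_eval_def)
  moreover have "homogeneous_mpoly n f"
    unfolding homogeneous_mpoly_def
  proof (intro exI[of _ d] ballI)
    fix m assume "m \<in> Poly_Mapping.keys f"
    then obtain x where "x \<in> set xs" "m = E (snd x)" using k[of xs] unfolding f_def by auto
    then show "Poly_Mapping.keys m \<subseteq> {..n} \<and>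
        (\<Sum>i\<in>Poly_Mapping.keys m. Poly_Mapping.lookup m i) = d"
      using kE sE * by simp
  qed
  ultimately show ?thesis using * unfolding f_def by (intro exI[of _ f]) (auto simp: f_def)
qed

section \<open>Zero sets and irreducibility\<close>

lemma mem_proj_point: "x \<in> proj_point v \<longleftrightarrow> (\<exists>c. c \<noteq> 0 \<and> x = c \<cdot>\<^sub>v v)"
  by (auto simp: proj_point_def)

lemma self_mem_proj_point: "v \<in> proj_point v"
  unfolding mem_proj_point by (intro exI[of _ 1]) auto

lemma proj_point_smult: "c \<noteq> 0 \<Longrightarrow> proj_point (c \<cdot>\<^sub>v v) = proj_point v"
proof -
  assume c: "c \<noteq> 0"
  have "b \<cdot>\<^sub>v v = (b / c) \<cdot>\<^sub>v (c \<cdot>\<^sub>v v)" for b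
    using c by (simp add: smult_smult_assoc)
  moreover have "b / c \<noteq> 0" "b * c \<noteq> 0" if "b \<noteq> 0" for b using c that by auto
  ultimately show ?thesis
    unfolding proj_point_def using smult_smult_assoc[of _ c v] by blast
qed

lemma proj_point_mem: "x \<in> proj_point v \<Longrightarrow> proj_point x = proj_point v"
  by (auto simp: mem_proj_point proj_point_smult)

definition coord_vecs :: "nat \<Rightarrow> complex vec set" where
  "coord_vecs n = carrier_vec (Suc n) - {0\<^sub>v (Suc n)}"

lemma smult_coord_vecs: "x \<in> coord_vecs n \<Longrightarrow> c \<noteq> 0 \<Longrightarrow> c \<cdot>\<^sub>v x \<in> coord_vecs n"
  unfolding coord_vecs_def
  by (auto simp: vec_eq_iff)

lemma coord_vecs_nonzero_coord:
  assumes "x \<in> coord_vecs n"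
  shows "\<exists>l\<le>n. x $ l \<noteq> 0"
proof (rule ccontr)
  assume "\<not> (\<exists>l\<le>n. x $ l \<noteq> 0)"
  then have "x = 0\<^sub>v (Suc n)" using assms by (intro eq_vecI) (auto simp: coord_vecs_def less_Suc_eq_le)
  then show False using assms by (simp add: coord_vecs_def)
qed

lemma CP_iff: "p \<in> CP n \<longleftrightarrow> (\<exists>x\<in>coord_vecs n. p = proj_point x)"
  by (auto simp: CP_def coord_vecs_def)

lemma proj_point_CP: "x \<in> coord_vecs n \<Longrightarrow> proj_point x \<in> CP n"
  by (auto simp: CP_iff)

lemma mem_CP_eq:
  assumes "p \<in> CP n" "x \<in> p"
  shows "x \<in> coord_vecs n" "p = proj_point x"
proof -
  obtain y where y: "y \<in> coord_vecs n" "p = proj_point y" using assms by (auto simp: CP_iff)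
  then show "x \<in> coord_vecs n" using assms(2) by (auto simp: mem_proj_point smult_coord_vecs)
  show "p = proj_point x" using proj_point_mem[of x y] assms(2) y by simp
qed

lemma Union_iff_proj_point:
  assumes "X \<subseteq> CP n"
  shows "x \<in> \<Union>X \<longleftrightarrow> x \<in> coord_vecs n \<and> proj_point x \<in> X"
  using assms mem_CP_eq self_mem_proj_point by blast

lemma subset_CP_eqI:
  assumes "X \<subseteq> CP n" "Y \<subseteq> CP n" "\<And>x. x \<in> coord_vecs n \<Longrightarrow> proj_point x \<in> X \<longleftrightarrow> proj_point x \<in> Y"
  shows "X = Y"
  using assms by (auto simp: CP_iff subset_iff)

definition forms :: "nat \<Rightarrow> (complex vec \<Rightarrow> complex) set" where
  "forms n = {\<phi>. \<exists>d. hform n d \<phi>}"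

definition zeros :: "nat \<Rightarrow> (complex vec \<Rightarrow> complex) set \<Rightarrow> complex vec set set" where
  "zeros n \<Phi> = {p \<in> CP n. \<forall>\<phi>\<in>\<Phi>. \<forall>v\<in>p. \<phi> v = 0}"

lemma zeros_subset_CP: "zeros n \<Phi> \<subseteq> CP n"
  by (auto simp: zeros_def)

text \<open>By homogeneity, the vanishing of a form at a point can be tested on any one of its coordinate
  vectors.\<close>

lemma proj_point_zeros:
  assumes "\<Phi> \<subseteq> forms n" "x \<in> coord_vecs n"
  shows "proj_point x \<in> zeros n \<Phi> \<longleftrightarrow> (\<forall>\<phi>\<in>\<Phi>. \<phi> x = 0)"
proof -
  have "\<phi> v = 0" if \<phi>: "\<phi> \<in> \<Phi>" "\<phi> x = 0" "v \<in> proj_point x" for \<phi> v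
  proof -
    obtain d where "hform n d \<phi>" using assms \<phi> by (auto simp: forms_def)
    then show ?thesis using hform_scale[of n d \<phi> x] assms \<phi>
      by (auto simp: mem_proj_point coord_vecs_def)
  qed
  then show ?thesis using assms self_mem_proj_point[of x]
    by (auto simp: zeros_def proj_point_CP)
qed

lemma algebraic_set_iff_zeros: "algebraic_set n X \<longleftrightarrow> (\<exists>\<Phi>\<subseteq>forms n. X = zeros n \<Phi>)"
proof
  assume "algebraic_set n X"
  then obtain F where F: "\<forall>f\<in>F. homogeneous_mpoly n f" "X = {p \<in> CP n. \<forall>f\<in>F. \<forall>v\<in>p. mpoly_eval f v = 0}"
    unfolding algebraic_set_def by blast
  show "\<exists>\<Phi>\<subseteq>forms n. X = zeros n \<Phi>"
    by (intro exI[of _ "mpoly_eval ` F"])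
      (use F homogeneous_mpoly_hform in \<open>auto simp: forms_def zeros_def\<close>)
next
  assume "\<exists>\<Phi>\<subseteq>forms n. X = zeros n \<Phi>"
  then obtain \<Phi> where \<Phi>: "\<Phi> \<subseteq> forms n" "X = zeros n \<Phi>" by blast
  then have "\<forall>\<phi>\<in>\<Phi>. \<exists>f. homogeneous_mpoly n f \<and> (\<forall>v\<in>carrier_vec (Suc n). \<phi> v = mpoly_eval f v)"
    using hform_homogeneous_mpoly by (auto simp: forms_def subset_iff)
  then obtain P where P: "\<And>\<phi>. \<phi> \<in> \<Phi> \<Longrightarrow> homogeneous_mpoly n (P \<phi>)"
    "\<And>\<phi> v. \<phi> \<in> \<Phi> \<Longrightarrow> v \<in> carrier_vec (Suc n) \<Longrightarrow> \<phi> v = mpoly_eval (P \<phi>) v"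
    by metis
  have "v \<in> carrier_vec (Suc n)" if "p \<in> CP n" "v \<in> p" for p v
    using mem_CP_eq[OF that] by (auto simp: coord_vecs_def)
  then have "X = {p \<in> CP n. \<forall>f\<in>P ` \<Phi>. \<forall>v\<in>p. mpoly_eval f v = 0}"
    unfolding \<Phi>(2) zeros_def using P(2) by auto
  then show "algebraic_set n X" unfolding algebraic_set_def using P(1) by blast
qed

lemma algebraic_zeros: "\<Phi> \<subseteq> forms n \<Longrightarrow> algebraic_set n (zeros n \<Phi>)"
  by (auto simp: algebraic_set_iff_zeros)

lemma algebraic_set_subset_CP: "algebraic_set n X \<Longrightarrow> X \<subseteq> CP n"
  by (auto simp: algebraic_set_def)

lemma zeros_Int: "zeros n \<Phi> \<inter> zeros n \<Psi> = zeros n (\<Phi> \<union> \<Psi>)"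
  by (auto simp: zeros_def)

lemma algebraic_set_Int:
  assumes "algebraic_set n X" "algebraic_set n Y"
  shows "algebraic_set n (X \<inter> Y)"
proof -
  obtain \<Phi> \<Psi> where "\<Phi> \<subseteq> forms n" "X = zeros n \<Phi>" "\<Psi> \<subseteq> forms n" "Y = zeros n \<Psi>"
    using assms by (auto simp: algebraic_set_iff_zeros)
  then show ?thesis by (auto simp: zeros_Int intro!: algebraic_zeros)
qed

lemma algebraic_set_Un:
  assumes "algebraic_set n X" "algebraic_set n Y"
  shows "algebraic_set n (X \<union> Y)"
proof -
  obtain \<Phi> \<Psi> where *: "\<Phi> \<subseteq> forms n" "X = zeros n \<Phi>" "\<Psi> \<subseteq> forms n" "Y = zeros n \<Psi>"
    using assms by (auto simp: algebraic_set_iff_zeros)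
  define \<Theta> where "\<Theta> = (\<lambda>(\<phi>, \<psi>) v. \<phi> v * \<psi> v) ` (\<Phi> \<times> \<Psi>)"
  have \<Theta>: "\<Theta> \<subseteq> forms n"
  proof
    fix \<theta> assume "\<theta> \<in> \<Theta>"
    then obtain \<phi> \<psi> where \<theta>: "\<phi> \<in> \<Phi>" "\<psi> \<in> \<Psi>" "\<theta> = (\<lambda>v. \<phi> v * \<psi> v)"
      unfolding \<Theta>_def by auto
    then obtain d d' where "hform n d \<phi>" "hform n d' \<psi>"
      using *(1,3) unfolding forms_def by blast
    from hform_mult[OF this] show "\<theta> \<in> forms n" unfolding \<theta>(3) forms_def by blast
  qed
  have "X \<union> Y = zeros n \<Theta>"
  proof (rule subset_CP_eqI)
    fix x assume x: "x \<in> coord_vecs n"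
    have "(\<forall>\<theta>\<in>\<Theta>. \<theta> x = 0) \<longleftrightarrow> (\<forall>\<phi>\<in>\<Phi>. \<forall>\<psi>\<in>\<Psi>. \<phi> x * \<psi> x = 0)"
      by (simp add: \<Theta>_def split_paired_Ball_Sigma)
    then show "proj_point x \<in> X \<union> Y \<longleftrightarrow> proj_point x \<in> zeros n \<Theta>"
      using * \<Theta> x by (auto simp: proj_point_zeros)
  qed (use * zeros_subset_CP in auto)
  then show ?thesis using \<Theta> by (simp add: algebraic_zeros)
qed

lemma algebraic_set_empty: "algebraic_set n {}"
proof -
  have "(\<lambda>v. 1) \<in> forms n" using hform_const by (auto simp: forms_def)
  moreover have "zeros n {\<lambda>v. 1} = {}"
    using self_mem_proj_point by (auto simp: zeros_def CP_iff)
  ultimately show ?thesis using algebraic_zeros[of "{\<lambda>v. 1}" n] by simp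
qed

lemma irreducible_subset_Un:
  assumes "irreducible_algebraic_set n X" "algebraic_set n A" "algebraic_set n B" "X \<subseteq> A \<union> B"
  shows "X \<subseteq> A \<or> X \<subseteq> B"
proof -
  have "algebraic_set n (X \<inter> A)" "algebraic_set n (X \<inter> B)" "X = (X \<inter> A) \<union> (X \<inter> B)"
    using assms algebraic_set_Int unfolding irreducible_algebraic_set_def by auto
  then have "X = X \<inter> A \<or> X = X \<inter> B"
    using assms(1) unfolding irreducible_algebraic_set_def by blast
  then show ?thesis by blast
qed

text \<open>Irreducibility is a statement about two closed sets; the extension to finitely many rests on
  closed sets being closed under finite unions, for which products of forms are used.\<close>

lemma irreducible_subset_UN:
  assumes "finite I" "irreducible_algebraic_set n X" "\<And>i. i \<in> I \<Longrightarrow> algebraic_set n (A i)"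
    "X \<subseteq> (\<Union>i\<in>I. A i)"
  shows "\<exists>i\<in>I. X \<subseteq> A i"
  using assms(1,3,4)
proof (induction I rule: finite_induct)
  case empty
  then show ?case using assms(2) by (auto simp: irreducible_algebraic_set_def)
next
  case (insert j I)
  have "finite I \<Longrightarrow> (\<And>i. i \<in> I \<Longrightarrow> algebraic_set n (A i)) \<Longrightarrow> algebraic_set n (\<Union>i\<in>I. A i)" for I
    by (induction I rule: finite_induct) (auto intro: algebraic_set_empty algebraic_set_Un)
  then have "X \<subseteq> A j \<or> X \<subseteq> (\<Union>i\<in>I. A i)"
    using insert by (intro irreducible_subset_Un[OF assms(2)]) auto
  then show ?case using insert by auto
qed

text \<open>A point is cut out by the minors expressing proportionality to a coordinate vector \<open>x\<close>; it
  suffices to compare with one coordinate \<open>x\<^sub>l \<noteq> 0\<close>.\<close>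

lemma algebraic_singleton:
  assumes "p \<in> CP n"
  shows "algebraic_set n {p}"
proof -
  obtain x where x: "x \<in> coord_vecs n" "p = proj_point x" using assms unfolding CP_iff by blast
  obtain l where l: "l \<le> n" "x $ l \<noteq> 0" using coord_vecs_nonzero_coord[OF x(1)] by blast
  define \<Phi> where "\<Phi> = (\<lambda>i v. x $ l * v $ i - x $ i * v $ l) ` {..n}"
  have "hform n 1 (\<lambda>v. x $ l * v $ i - x $ i * v $ l)" if "i \<le> n" for i
    using hform_mult[OF hform_const hform_coord[OF that], of "x $ l"]
      hform_mult[OF hform_const hform_coord[OF l(1)], of "x $ i"]
    by (intro hform_diff) auto
  then have \<Phi>: "\<Phi> \<subseteq> forms n" unfolding \<Phi>_def forms_def by blast
  have "{p} = zeros n \<Phi>"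
  proof (rule subset_CP_eqI)
    fix y assume y: "y \<in> coord_vecs n"
    show "proj_point y \<in> {p} \<longleftrightarrow> proj_point y \<in> zeros n \<Phi>"
    proof
      assume "proj_point y \<in> {p}"
      then obtain c where "x = c \<cdot>\<^sub>v y" "c \<noteq> 0"
        using x(2) self_mem_proj_point[of x] unfolding singleton_iff by (metis mem_proj_point)
      then show "proj_point y \<in> zeros n \<Phi>"
        unfolding proj_point_zeros[OF \<Phi> y] unfolding \<Phi>_def using y l by (auto simp: coord_vecs_def)
    next
      assume "proj_point y \<in> zeros n \<Phi>"
      then have *: "x $ l * y $ i = x $ i * y $ l" if "i \<le> n" for i
        using that unfolding proj_point_zeros[OF \<Phi> y] unfolding \<Phi>_def by simp
      have yx: "y = (y $ l / x $ l) \<cdot>\<^sub>v x"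
        using x y * l by (intro eq_vecI) (auto simp: coord_vecs_def field_simps less_Suc_eq_le)
      moreover have "y $ l \<noteq> 0"
      proof
        assume "y $ l = 0"
        moreover have "0 \<cdot>\<^sub>v x = 0\<^sub>v (Suc n)"
          using x by (intro eq_vecI) (auto simp: coord_vecs_def)
        ultimately have "y = 0\<^sub>v (Suc n)" using yx by (metis div_0)
        then show False using y by (simp add: coord_vecs_def)
      qed
      ultimately have "proj_point y = proj_point x"
        using l proj_point_smult[of "y $ l / x $ l" x] by simp
      then show "proj_point y \<in> {p}" using x by simp
    qed
  qed (use assms zeros_subset_CP in auto)
  then show ?thesis using \<Phi> by (simp add: algebraic_zeros)
qed

lemma irreducible_singleton: "p \<in> CP n \<Longrightarrow> irreducible_algebraic_set n {p}"
  unfolding irreducible_algebraic_set_def using algebraic_singleton by (auto simp: singleton_Un_iff)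

text \<open>In dimension one, an irreducible closed set with two different points is not contained properly
  in another one: together with a singleton below it, the two would form a chain of length two.\<close>

lemma no_chain_of_length_2:
  assumes "algebraic_dim n S = 1" "irreducible_algebraic_set n X" "irreducible_algebraic_set n Y"
    "Y \<subseteq> X" "X \<subseteq> S" "p \<in> Y" "q \<in> Y" "p \<noteq> q"
  shows "Y = X"
proof (rule ccontr)
  assume "Y \<noteq> X"
  define Z where "Z i = (if i = 0 then {p} else if i = 1 then Y else X)" for i :: nat
  have "algebraic_set n Y" using assms(3) by (simp add: irreducible_algebraic_set_def)
  then have "p \<in> CP n" using algebraic_set_subset_CP assms(6) by blast
  then have "irreducible_algebraic_set n {p}" by (rule irreducible_singleton)
  moreover have "{p} \<subset> Y" "Y \<subset> X" using assms(4,6,7,8) \<open>Y \<noteq> X\<close> by auto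
  ultimately have "\<forall>i\<le>2. irreducible_algebraic_set n (Z i) \<and> Z i \<subseteq> S" "\<forall>i<2. Z i \<subset> Z (Suc i)"
    using assms(2-6) by (auto simp: Z_def less_2_cases_iff)
  then have "enat 2 \<le> algebraic_dim n S"
    unfolding algebraic_dim_def by (intro Sup_upper) blast
  then show False using assms(1) by (simp add: one_enat_def)
qed

definition poly_curve :: "nat \<Rightarrow> (complex \<Rightarrow> complex vec) \<Rightarrow> bool" where
  "poly_curve n c \<longleftrightarrow> (\<forall>t. c t \<in> carrier_vec (Suc n)) \<and> (\<forall>i\<le>n. \<exists>q. \<forall>t. c t $ i = poly q t)"

lemma form_on_poly_curve:
  assumes "\<phi> \<in> forms n" "poly_curve n c"
  shows "\<exists>p. \<forall>t. \<phi> (c t) = poly p t"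
proof -
  obtain d where "hform n d \<phi>" using assms(1) by (auto simp: forms_def)
  then obtain xs where "monomial_list n d \<phi> xs" unfolding hform_def by blast
  note xs = monomial_listD[OF this]
  obtain q where q: "\<And>i t. i \<le> n \<Longrightarrow> c t $ i = poly (q i) t"
    using assms(2) unfolding poly_curve_def by metis
  define p where "p = (\<Sum>x\<leftarrow>xs. smult (fst x) (\<Prod>i\<le>n. q i ^ snd x i))"
  have "poly (\<Sum>x\<leftarrow>ys. smult (fst x) (\<Prod>i\<le>n. q i ^ snd x i)) t =
      (\<Sum>x\<leftarrow>ys. fst x * (\<Prod>i\<le>n. (c t $ i) ^ snd x i))" for ys t
    by (induction ys) (auto simp: poly_prod q)
  then show ?thesis using xs(2) assms(2) by (intro exI[of _ p]) (auto simp: p_def poly_curve_def)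
qed

text \<open>Along a polynomial curve, a form is a polynomial in one variable, so infinitely many zeros
  force it to vanish on the whole curve. All closures of flows and orbits are handled by
  this lemma.\<close>

lemma form_zero_on_poly_curve:
  assumes "\<phi> \<in> forms n" "poly_curve n c" "infinite T" "\<And>t. t \<in> T \<Longrightarrow> \<phi> (c t) = 0"
  shows "\<phi> (c t) = 0"
proof -
  obtain p where p: "\<And>t. \<phi> (c t) = poly p t" using form_on_poly_curve[OF assms(1,2)] by blast
  then have "T \<subseteq> {t. poly p t = 0}" using assms(4) by auto
  then have "p = 0" using poly_roots_finite assms(3) infinite_super by blast
  then show ?thesis using p by simp
qed

text \<open>By the pigeonhole principle, one of the two closed sets contains infinitely many points of the
  curve, and hence the whole curve, including the points with \<open>t\<close> outside of \<open>T\<close>. In other words,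
  polynomial curves are irreducible.\<close>

lemma poly_curve_in_one:
  assumes "\<Phi> \<subseteq> forms n" "\<Psi> \<subseteq> forms n" "poly_curve n c" "infinite T"
    "\<And>t. t \<in> T \<Longrightarrow> (\<forall>\<phi>\<in>\<Phi>. \<phi> (c t) = 0) \<or> (\<forall>\<psi>\<in>\<Psi>. \<psi> (c t) = 0)"
  shows "(\<forall>t. \<forall>\<phi>\<in>\<Phi>. \<phi> (c t) = 0) \<or> (\<forall>t. \<forall>\<psi>\<in>\<Psi>. \<psi> (c t) = 0)"
proof -
  define A B where "A = {t\<in>T. \<forall>\<phi>\<in>\<Phi>. \<phi> (c t) = 0}" and "B = {t\<in>T. \<forall>\<psi>\<in>\<Psi>. \<psi> (c t) = 0}"
  have "T \<subseteq> A \<union> B" using assms(5) unfolding A_def B_def by blast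
  then have "infinite (A \<union> B)" using assms(4) by (rule infinite_super)
  then have "infinite A \<or> infinite B" by simp
  then show ?thesis
  proof
    assume "infinite A"
    then have "\<phi> (c t) = 0" if "\<phi> \<in> \<Phi>" for \<phi> t
      by (rule form_zero_on_poly_curve[rotated 2]) (use assms that in \<open>auto simp: A_def\<close>)
    then show ?thesis by blast
  next
    assume "infinite B"
    then have "\<psi> (c t) = 0" if "\<psi> \<in> \<Psi>" for \<psi> t
      by (rule form_zero_on_poly_curve[rotated 2]) (use assms that in \<open>auto simp: B_def\<close>)
    then show ?thesis by blast
  qed
qed

definition poly_family :: "nat \<Rightarrow> (complex \<Rightarrow> complex mat) \<Rightarrow> bool" where
  "poly_family n C \<longleftrightarrow> (\<forall>t. C t \<in> carrier_mat (Suc n) (Suc n)) \<and>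
     (\<forall>i\<le>n. \<forall>j\<le>n. \<exists>q. \<forall>t. C t $$ (i, j) = poly q t)"

lemma poly_family_curve:
  assumes "poly_family n C" "x \<in> carrier_vec (Suc n)"
  shows "poly_curve n (\<lambda>t. C t *\<^sub>v x)"
proof -
  obtain q where q: "\<And>i j t. i \<le> n \<Longrightarrow> j \<le> n \<Longrightarrow> C t $$ (i, j) = poly (q i j) t"
    using assms(1) unfolding poly_family_def by metis
  have C: "C t \<in> carrier_mat (Suc n) (Suc n)" for t
    using assms(1) by (auto simp: poly_family_def)
  have "(C t *\<^sub>v x) $ i = poly (\<Sum>j\<le>n. smult (x $ j) (q i j)) t" if "i \<le> n" for i t
    using that mult_mat_vec_index[OF C assms(2), of i t]
    by (simp add: lessThan_Suc_atMost q poly_sum mult.commute del: index_mult_mat_vec)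
  moreover have "C t *\<^sub>v x \<in> carrier_vec (Suc n)" for t
    using C assms(2) by (rule mult_mat_vec_carrier)
  ultimately show ?thesis unfolding poly_curve_def by blast
qed

text \<open>Let \<open>Z\<close> be the closure of the union of the translates \<open>C(t) X\<close>. If \<open>Z\<close> is the union of two closed
  sets, then for each point of \<open>X\<close> its whole orbit lies in one of them (\<open>poly_curve_in_one\<close>), and the
  points whose orbit lies in a given closed set form a closed set. So \<open>X\<close> is covered by two closed
  sets, one of them contains \<open>X\<close>, and the corresponding part of the decomposition contains \<open>Z\<close>. Thus
  \<open>Z\<close> is irreducible. It contains \<open>X\<close>, because the family passes through the identity, and lies in
  \<open>S\<close>; so maximality of \<open>X\<close> gives \<open>Z = X\<close>.\<close>

lemma component_invariant:
  assumes S: "algebraic_set n S" and X: "irreducible_component n S X"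
    and C: "poly_family n C" and T: "infinite T" and t0: "t0 \<in> T"
    and id: "\<And>x. x \<in> carrier_vec (Suc n) \<Longrightarrow> C t0 *\<^sub>v x = x"
    and nz: "\<And>t x. t \<in> T \<Longrightarrow> x \<in> coord_vecs n \<Longrightarrow> C t *\<^sub>v x \<in> coord_vecs n"
    and inS: "\<And>t x. t \<in> T \<Longrightarrow> x \<in> \<Union>X \<Longrightarrow> C t *\<^sub>v x \<in> \<Union>S"
    and "t \<in> T" "x \<in> \<Union>X"
  shows "C t *\<^sub>v x \<in> \<Union>X"
proof -
  have irrX: "irreducible_algebraic_set n X" and XS: "X \<subseteq> S"
    and max: "\<And>Y. irreducible_algebraic_set n Y \<Longrightarrow> X \<subseteq> Y \<Longrightarrow> Y \<subseteq> S \<Longrightarrow> Y = X"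
    using X by (auto simp: irreducible_component_def)
  have XCP: "X \<subseteq> CP n" and SCP: "S \<subseteq> CP n"
    using irrX S algebraic_set_subset_CP by (auto simp: irreducible_algebraic_set_def)
  note memX = Union_iff_proj_point[OF XCP] and memS = Union_iff_proj_point[OF SCP]
  define \<Omega> where "\<Omega> = {\<phi> \<in> forms n. \<forall>t\<in>T. \<forall>x\<in>\<Union>X. \<phi> (C t *\<^sub>v x) = 0}"
  define Z where "Z = zeros n \<Omega>"
  have \<Omega>: "\<Omega> \<subseteq> forms n" by (auto simp: \<Omega>_def)
  have orbit: "proj_point (C t *\<^sub>v x) \<in> Z" if "t \<in> T" "x \<in> \<Union>X" for t x
  proof -
    have "x \<in> coord_vecs n" using that(2) memX by blast
    then have "C t *\<^sub>v x \<in> coord_vecs n" by (rule nz[OF that(1)])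
    moreover have "\<forall>\<phi>\<in>\<Omega>. \<phi> (C t *\<^sub>v x) = 0" using that unfolding \<Omega>_def by blast
    ultimately show ?thesis unfolding Z_def using proj_point_zeros[OF \<Omega>] by simp
  qed
  have XZ: "X \<subseteq> Z"
  proof
    fix p assume p: "p \<in> X"
    then obtain x where x: "x \<in> coord_vecs n" "p = proj_point x" using XCP CP_iff by blast
    then have "x \<in> \<Union>X" using p memX[of x] by simp
    from orbit[OF t0 this] show "p \<in> Z" using x id by (simp add: coord_vecs_def)
  qed
  have sub: "Z \<subseteq> zeros n \<Phi>" if "\<Phi> \<subseteq> forms n" "\<And>t x \<phi>. t \<in> T \<Longrightarrow> x \<in> \<Union>X \<Longrightarrow> \<phi> \<in> \<Phi> \<Longrightarrow> \<phi> (C t *\<^sub>v x) = 0" for \<Phi>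
  proof -
    have "\<Phi> \<subseteq> \<Omega>" using that unfolding \<Omega>_def by blast
    then show ?thesis unfolding Z_def zeros_def by blast
  qed
  obtain \<Sigma> where \<Sigma>: "\<Sigma> \<subseteq> forms n" "S = zeros n \<Sigma>" using S by (auto simp: algebraic_set_iff_zeros)
  have ZS: "Z \<subseteq> S"
    unfolding \<Sigma>(2)
  proof (rule sub[OF \<Sigma>(1)])
    fix t x \<phi> assume "t \<in> T" "x \<in> \<Union>X" "\<phi> \<in> \<Sigma>"
    then have "C t *\<^sub>v x \<in> coord_vecs n" "proj_point (C t *\<^sub>v x) \<in> S"
      using inS[of t x] memS by auto
    then show "\<phi> (C t *\<^sub>v x) = 0"
      unfolding \<Sigma>(2) using proj_point_zeros[OF \<Sigma>(1)] \<open>\<phi> \<in> \<Sigma>\<close> by simp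
  qed
  have "irreducible_algebraic_set n Z"
    unfolding irreducible_algebraic_set_def
  proof (intro conjI allI impI, goal_cases)
    case 1
    then show ?case using \<Omega> by (simp add: Z_def algebraic_zeros)
  next
    case 2
    then show ?case using XZ irrX by (auto simp: irreducible_algebraic_set_def)
  next
    case (3 A B)
    then obtain \<Phi> \<Psi> where AB: "\<Phi> \<subseteq> forms n" "A = zeros n \<Phi>" "\<Psi> \<subseteq> forms n" "B = zeros n \<Psi>" "Z = A \<union> B"
      by (auto simp: algebraic_set_iff_zeros)
    \<comment> \<open>\<open>pull \<Phi>\<close> cuts out the points whose whole orbit lies in the zero set of \<open>\<Phi>\<close>\<close>
    define pull where "pull \<Phi> = (\<lambda>(\<phi>, t) v. \<phi> (C t *\<^sub>v v)) ` (\<Phi> \<times> UNIV)" for \<Phi> :: "(complex vec \<Rightarrow> complex) set"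
    have Ct: "C t \<in> carrier_mat (Suc n) (Suc n)" for t using C by (auto simp: poly_family_def)
    have pull: "pull \<Phi> \<subseteq> forms n" if \<Phi>: "\<Phi> \<subseteq> forms n" for \<Phi>
    proof
      fix \<theta> assume "\<theta> \<in> pull \<Phi>"
      then obtain \<phi> t where \<theta>: "\<phi> \<in> \<Phi>" "\<theta> = (\<lambda>v. \<phi> (C t *\<^sub>v v))"
        unfolding pull_def by auto
      then obtain d where "hform n d \<phi>" using \<Phi> unfolding forms_def by blast
      from hform_linear_subst[OF this Ct] show "\<theta> \<in> forms n" unfolding \<theta>(2) forms_def by blast
    qed
    have mem_pull: "proj_point x \<in> zeros n (pull \<Phi>) \<longleftrightarrow> (\<forall>t. \<forall>\<phi>\<in>\<Phi>. \<phi> (C t *\<^sub>v x) = 0)"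
      if "\<Phi> \<subseteq> forms n" "x \<in> coord_vecs n" for x \<Phi>
      unfolding proj_point_zeros[OF pull[OF that(1)] that(2)] unfolding pull_def
      by (simp add: split_paired_Ball_Sigma) blast
    have "X \<subseteq> zeros n (pull \<Phi>) \<union> zeros n (pull \<Psi>)"
    proof
      fix p assume p: "p \<in> X"
      then obtain x where x: "x \<in> coord_vecs n" "p = proj_point x" using XCP CP_iff by blast
      then have xX: "x \<in> \<Union>X" using p memX[of x] by simp
      have "(\<forall>\<phi>\<in>\<Phi>. \<phi> (C t *\<^sub>v x) = 0) \<or> (\<forall>\<psi>\<in>\<Psi>. \<psi> (C t *\<^sub>v x) = 0)" if "t \<in> T" for t
      proof -
        have "proj_point (C t *\<^sub>v x) \<in> A \<union> B" using orbit[OF that xX] AB(5) by simp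
        then show ?thesis
          unfolding AB(2,4) using proj_point_zeros[OF AB(1) nz[OF that x(1)]]
            proj_point_zeros[OF AB(3) nz[OF that x(1)]] by blast
      qed
      then have "(\<forall>t. \<forall>\<phi>\<in>\<Phi>. \<phi> (C t *\<^sub>v x) = 0) \<or> (\<forall>t. \<forall>\<psi>\<in>\<Psi>. \<psi> (C t *\<^sub>v x) = 0)"
        using x by (intro poly_curve_in_one[OF AB(1,3) poly_family_curve[OF C] T]) (auto simp: coord_vecs_def)
      then show "p \<in> zeros n (pull \<Phi>) \<union> zeros n (pull \<Psi>)"
        unfolding x(2) using mem_pull[OF AB(1) x(1)] mem_pull[OF AB(3) x(1)] by blast
    qed
    then have "X \<subseteq> zeros n (pull \<Phi>) \<or> X \<subseteq> zeros n (pull \<Psi>)"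
      using AB pull by (intro irreducible_subset_Un[OF irrX] algebraic_zeros) auto
    moreover have "Z \<subseteq> zeros n \<Phi>" if "X \<subseteq> zeros n (pull \<Phi>)" "\<Phi> \<subseteq> forms n" for \<Phi>
    proof (rule sub[OF that(2)])
      fix t x \<phi> assume *: "t \<in> T" "x \<in> \<Union>X" "\<phi> \<in> \<Phi>"
      then have "x \<in> coord_vecs n" "proj_point x \<in> zeros n (pull \<Phi>)" using memX that(1) by auto
      then show "\<phi> (C t *\<^sub>v x) = 0" using mem_pull[OF that(2), of x] *(3) by blast
    qed
    ultimately have "Z \<subseteq> A \<or> Z \<subseteq> B" using AB by blast
    then show ?case using AB(5) by blast
  qed
  then have "Z = X" using XZ ZS by (rule max)
  then show ?thesis using orbit[OF \<open>t \<in> T\<close> \<open>x \<in> \<Union>X\<close>] memX nz[OF \<open>t \<in> T\<close>] \<open>x \<in> \<Union>X\<close> by simp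
qed

section \<open>Linear independence and powers of a matrix\<close>

text \<open>Independence of \<open>u\<^sub>0, \<dots>, u\<^bsub>M-1\<^esub>\<close> as a family, so that repeated members are dependent. Relations
  are written coordinatewise, the form in which they occur in all arguments below.\<close>

definition indep_family :: "nat \<Rightarrow> nat \<Rightarrow> (nat \<Rightarrow> complex vec) \<Rightarrow> bool" where
  "indep_family N M u \<longleftrightarrow> (\<forall>j<M. u j \<in> carrier_vec N) \<and>
     (\<forall>c. (\<forall>i<N. (\<Sum>j<M. c j * u j $ i) = 0) \<longrightarrow> (\<forall>j<M. c j = 0))"

lemma indep_familyD:
  "indep_family N M u \<Longrightarrow> (\<And>i. i < N \<Longrightarrow> (\<Sum>j<M. c j * u j $ i) = 0) \<Longrightarrow> j < M \<Longrightarrow> c j = 0"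
  unfolding indep_family_def by blast

text \<open>A square matrix with a zero row is singular. Padding a system that has fewer equations than
  unknowns with zero rows, one obtains the dimension arguments below.\<close>

lemma zero_row_kernel:
  fixes B :: "complex mat"
  assumes B: "B \<in> carrier_mat N N" and r: "r < N" "\<And>j. j < N \<Longrightarrow> B $$ (r, j) = 0"
  shows "\<exists>v\<in>carrier_vec N. v \<noteq> 0\<^sub>v N \<and> B *\<^sub>v v = 0\<^sub>v N"
proof -
  have "transpose_mat B *\<^sub>v unit_vec N r = 0\<^sub>v N"
    using B r by (intro eq_vecI) auto
  moreover have "unit_vec N r \<noteq> (0\<^sub>v N :: complex vec)" using r by simp
  ultimately have "det (transpose_mat B) = 0"
    using B by (subst det_0_iff_vec_prod_zero[of _ N]) (auto intro!: exI[of _ "unit_vec N r"])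
  then have "det B = 0" using det_transpose[OF B] by simp
  then show ?thesis using det_0_iff_vec_prod_zero[OF B] by blast
qed

lemma indep_family_le:
  assumes "indep_family N M u"
  shows "M \<le> N"
proof (rule ccontr)
  assume "\<not> M \<le> N"
  then have NM: "N < M" by simp
  define B where "B = mat M M (\<lambda>(i, j). if i < N then u j $ i else 0)"
  obtain v where v: "v \<in> carrier_vec M" "v \<noteq> 0\<^sub>v M" "B *\<^sub>v v = 0\<^sub>v M"
    using zero_row_kernel[of B M N] NM by (auto simp: B_def)
  have "(\<Sum>j<M. v $ j * u j $ i) = 0" if "i < N" for i
  proof -
    have "(\<Sum>j<M. v $ j * u j $ i) = (B *\<^sub>v v) $ i"
      using that NM v by (subst mult_mat_vec_index[where M = M and N = M])
        (auto simp: B_def mult.commute)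
    then show ?thesis using v that NM by simp
  qed
  then have "\<forall>j<M. v $ j = 0" using indep_familyD[OF assms, of "\<lambda>j. v $ j"] by blast
  then have "v = 0\<^sub>v M" using v by (intro eq_vecI) auto
  then show False using v by simp
qed

text \<open>The new vector is the complex conjugate of a nonzero solution of the equations \<open>u\<^sub>j \<cdot> v = 0\<close>:
  pairing a linear relation with \<open>v\<close> isolates its coefficient, since \<open>v \<cdot> cnj v \<noteq> 0\<close>.\<close>

lemma indep_family_extend1:
  assumes u: "indep_family N M u" and "M < N"
  shows "\<exists>w. indep_family N (Suc M) (u(M := w))"
proof -
  define B where "B = mat N N (\<lambda>(j, i). if j < M then u j $ i else 0)"
  obtain v where v: "v \<in> carrier_vec N" "v \<noteq> 0\<^sub>v N" "B *\<^sub>v v = 0\<^sub>v N"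
    using zero_row_kernel[of B N M] assms by (auto simp: B_def)
  have orth: "(\<Sum>i<N. u j $ i * v $ i) = 0" if "j < M" for j
  proof -
    have "(\<Sum>i<N. u j $ i * v $ i) = (B *\<^sub>v v) $ j"
      using that assms v by (subst mult_mat_vec_index[where M = N and N = N])
        (auto simp: B_def)
    then show ?thesis using v that assms by simp
  qed
  define w where "w = vec N (\<lambda>i. cnj (v $ i))"
  have "(\<Sum>i<N. w $ i * v $ i) \<noteq> 0"
  proof
    assume "(\<Sum>i<N. w $ i * v $ i) = 0"
    moreover have "(\<Sum>i<N. w $ i * v $ i) = of_real (\<Sum>i<N. (cmod (v $ i))\<^sup>2)"
      by (simp add: w_def complex_norm_square[symmetric] mult.commute[of "cnj _"] del: of_real_power)
    ultimately have "(\<Sum>i<N. (cmod (v $ i))\<^sup>2) = 0" using of_real_eq_0_iff by metis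
    then have "\<forall>i<N. v $ i = 0" by (simp add: sum_nonneg_eq_0_iff)
    then have "v = 0\<^sub>v N" using v by (intro eq_vecI) auto
    then show False using v by simp
  qed
  note ww = this
  have "indep_family N (Suc M) (u(M := w))"
    unfolding indep_family_def
  proof (intro conjI allI impI)
    fix j assume "j < Suc M"
    then show "(u(M := w)) j \<in> carrier_vec N" using u by (auto simp: indep_family_def w_def)
  next
    fix c j assume c: "\<forall>i<N. (\<Sum>j<Suc M. c j * (u(M := w)) j $ i) = 0" and j: "j < Suc M"
    have c': "(\<Sum>j<M. c j * u j $ i) + c M * w $ i = 0" if "i < N" for i
      using c[rule_format, OF that] by simp
    have "(\<Sum>i<N. ((\<Sum>j<M. c j * u j $ i) + c M * w $ i) * v $ i) =
        (\<Sum>j<M. c j * (\<Sum>i<N. u j $ i * v $ i)) + c M * (\<Sum>i<N. w $ i * v $ i)"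
    proof -
      have "(\<Sum>i<N. (\<Sum>j<M. c j * u j $ i) * v $ i) = (\<Sum>j<M. c j * (\<Sum>i<N. u j $ i * v $ i))"
        unfolding sum_distrib_left sum_distrib_right by (subst sum.swap) (simp add: mult.assoc)
      moreover have "(\<Sum>i<N. c M * w $ i * v $ i) = c M * (\<Sum>i<N. w $ i * v $ i)"
        by (simp add: sum_distrib_left mult.assoc)
      ultimately show ?thesis by (simp add: distrib_right sum.distrib)
    qed
    then have "c M * (\<Sum>i<N. w $ i * v $ i) = 0" using c' orth by simp
    then have cM: "c M = 0" using ww by simp
    have "(\<Sum>j<M. c j * u j $ i) = 0" if "i < N" for i
      using c'[OF that] unfolding cM by simp
    then have "\<forall>j<M. c j = 0" using indep_familyD[OF u, of c] by blast
    then show "c j = 0" using cM j less_Suc_eq by auto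
  qed
  then show ?thesis by blast
qed

lemma indep_family_extend:
  assumes "indep_family N M u" "M \<le> K" "K \<le> N"
  shows "\<exists>u'. indep_family N K u' \<and> (\<forall>j<M. u' j = u j)"
  using assms(2,3)
proof (induction K rule: dec_induct)
  case base
  then show ?case using assms(1) by auto
next
  case (step K)
  then obtain u' where u': "indep_family N K u'" "\<forall>j<M. u' j = u j" by auto
  obtain w where w: "indep_family N (Suc K) (u'(K := w))"
    using indep_family_extend1[OF u'(1)] step by auto
  have "\<forall>j<M. (u'(K := w)) j = u j" using u'(2) step by simp
  with w show ?case by blast
qed

text \<open>Extend the family to a basis; the inverse of the matrix with these columns changes the
  coordinates as required.\<close>

lemma indep_family_coordinates:
  assumes "indep_family N M u"
  shows "\<exists>T\<in>carrier_mat N N. \<exists>T'\<in>carrier_mat N N. T * T' = 1\<^sub>m N \<and> T' * T = 1\<^sub>m N \<and>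
    (\<forall>j<M. T *\<^sub>v u j = unit_vec N j)"
proof -
  obtain u' where u': "indep_family N N u'" "\<forall>j<M. u' j = u j"
    using indep_family_extend[OF assms indep_family_le[OF assms] order_refl] by blast
  define U where "U = mat N N (\<lambda>(i, j). u' j $ i)"
  have U: "U \<in> carrier_mat N N" by (simp add: U_def)
  have "det U \<noteq> 0"
  proof
    assume "det U = 0"
    then obtain v where v: "v \<in> carrier_vec N" "v \<noteq> 0\<^sub>v N" "U *\<^sub>v v = 0\<^sub>v N"
      using det_0_iff_vec_prod_zero[OF U] by blast
    have "(\<Sum>j<N. v $ j * u' j $ i) = 0" if "i < N" for i
    proof -
      have "(\<Sum>j<N. v $ j * u' j $ i) = (U *\<^sub>v v) $ i"
        using that by (subst mult_mat_vec_index[OF U v(1)]) (auto simp: U_def mult.commute)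
      then show ?thesis using v that by simp
    qed
    then have "\<forall>j<N. v $ j = 0" using indep_familyD[OF u'(1), of "\<lambda>j. v $ j"] by blast
    then have "v = 0\<^sub>v N" using v by (intro eq_vecI) auto
    then show False using v by simp
  qed
  from det_non_zero_imp_unit[OF U this, of "()"]
  obtain T where T: "T \<in> carrier_mat N N" "T * U = 1\<^sub>m N" "U * T = 1\<^sub>m N"
    unfolding Units_def ring_mat_def by auto
  have "T *\<^sub>v u j = unit_vec N j" if "j < M" for j
  proof -
    have jN: "j < N" using that indep_family_le[OF assms] by simp
    have "u j = u' j" "u' j \<in> carrier_vec N" using u' that jN by (auto simp: indep_family_def)
    then have "u j = U *\<^sub>v unit_vec N j"
      using U jN by (intro eq_vecI) (auto simp: U_def)
    then have "T *\<^sub>v u j = (T * U) *\<^sub>v unit_vec N j"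
      using assoc_mult_mat_vec[OF T(1) U, of "unit_vec N j"] by simp
    then show ?thesis using T by simp
  qed
  then show ?thesis using T U by blast
qed

lemma mult_mat_vec_sum:
  fixes Q :: "complex mat"
  assumes "Q \<in> carrier_mat N N" "finite J" "\<And>j. j \<in> J \<Longrightarrow> w j \<in> carrier_vec N"
  shows "Q *\<^sub>v vec N (\<lambda>i. \<Sum>j\<in>J. c j * w j $ i) = vec N (\<lambda>i. \<Sum>j\<in>J. c j * (Q *\<^sub>v w j) $ i)"
proof (rule eq_vecI)
  fix i assume "i < dim_vec (vec N (\<lambda>i. \<Sum>j\<in>J. c j * (Q *\<^sub>v w j) $ i))"
  then have i: "i < N" by simp
  have "(\<Sum>j\<in>J. c j * (Q *\<^sub>v w j) $ i) = (\<Sum>j\<in>J. c j * (\<Sum>k<N. Q $$ (i, k) * w j $ k))"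
    using i assms(3) by (intro sum.cong refl) (simp add: mult_mat_vec_index[OF assms(1)] del: index_mult_mat_vec)
  also have "\<dots> = (\<Sum>k<N. Q $$ (i, k) * (\<Sum>j\<in>J. c j * w j $ k))"
    by (simp add: sum_distrib_left sum.swap[of _ J] mult_ac)
  also have "\<dots> = (Q *\<^sub>v vec N (\<lambda>i. \<Sum>j\<in>J. c j * w j $ i)) $ i"
    using i by (subst mult_mat_vec_index[OF assms(1)]) auto
  finally show "(Q *\<^sub>v vec N (\<lambda>i. \<Sum>j\<in>J. c j * w j $ i)) $ i =
      vec N (\<lambda>i. \<Sum>j\<in>J. c j * (Q *\<^sub>v w j) $ i) $ i"
    using i by simp
qed (use assms in simp)

lemma pow_mat_add_vec:
  fixes Q :: "complex mat"
  assumes "Q \<in> carrier_mat N N" "y \<in> carrier_vec N"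
  shows "Q ^\<^sub>m (k + l) *\<^sub>v y = Q ^\<^sub>m k *\<^sub>v (Q ^\<^sub>m l *\<^sub>v y)"
  using assms(2)
proof (induction l arbitrary: y)
  case (Suc l)
  have [simp]: "Q ^\<^sub>m i \<in> carrier_mat N N" for i using assms by simp
  have "Q ^\<^sub>m (k + Suc l) *\<^sub>v y = Q ^\<^sub>m (k + l) *\<^sub>v (Q *\<^sub>v y)"
    using Suc.prems assms by (simp add: assoc_mult_mat_vec[of _ N N _ N])
  also have "\<dots> = Q ^\<^sub>m k *\<^sub>v (Q ^\<^sub>m l *\<^sub>v (Q *\<^sub>v y))" using Suc assms by simp
  also have "Q ^\<^sub>m l *\<^sub>v (Q *\<^sub>v y) = Q ^\<^sub>m Suc l *\<^sub>v y"
    using Suc.prems assms by (simp add: assoc_mult_mat_vec[of _ N N _ N])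
  finally show ?case .
qed (use assms in simp)

lemma pow_mat_Suc_vec:
  fixes Q :: "complex mat"
  assumes "Q \<in> carrier_mat N N" "y \<in> carrier_vec N"
  shows "Q ^\<^sub>m Suc l *\<^sub>v y = Q *\<^sub>v (Q ^\<^sub>m l *\<^sub>v y)"
  using pow_mat_add_vec[OF assms, of 1 l] assms by simp

text \<open>The last clause is what makes the diagonal part commute with the superdiagonal part.\<close>

lemma jordan_matrix_entries:
  "\<exists>d e. (\<forall>i<sum_list (map fst xs). \<forall>j<sum_list (map fst xs). jordan_matrix xs $$ (i, j) =
      (if i = j then d i else if j = Suc i then e i else 0)) \<and>
    (\<forall>i. Suc i < sum_list (map fst xs) \<longrightarrow> e i \<noteq> 0 \<longrightarrow> d (Suc i) = (d i :: complex))"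
proof (induction xs)
  case (Cons x xs)
  obtain n a where x: "x = (n, a)" by (cases x)
  let ?s = "sum_list (map fst xs)"
  obtain d e where de: "\<And>i j. i < ?s \<Longrightarrow> j < ?s \<Longrightarrow> jordan_matrix xs $$ (i, j) =
      (if i = j then d i else if j = Suc i then e i else 0)"
    "\<And>i. Suc i < ?s \<Longrightarrow> e i \<noteq> 0 \<Longrightarrow> d (Suc i) = d i" using Cons by blast
  define d' where "d' i = (if i < n then a else d (i - n))" for i
  define e' where "e' i = (if Suc i < n then 1 else if i < n then 0 else e (i - n))" for i
  show ?case unfolding x jordan_matrix_Cons
  proof (rule exI[of _ d'], rule exI[of _ e'], intro conjI allI impI)
    fix i j assume ij: "i < sum_list (map fst ((n, a) # xs))" "j < sum_list (map fst ((n, a) # xs))"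
    show "four_block_mat (jordan_block n a) (0\<^sub>m n ?s) (0\<^sub>m ?s n) (jordan_matrix xs) $$ (i, j) =
      (if i = j then d' i else if j = Suc i then e' i else 0)"
      using ij by (auto simp: index_mat_four_block de d'_def e'_def)
  next
    fix i assume "Suc i < sum_list (map fst ((n, a) # xs))" "e' i \<noteq> 0"
    then show "d' (Suc i) = d' i"
      using de(2)[of "i - n"] by (auto simp: d'_def e'_def Suc_diff_le split: if_splits)
  qed
qed simp

lemma mult_mat_vec_inverse:
  fixes P P' :: "complex mat"
  assumes "P \<in> carrier_mat N N" "P' \<in> carrier_mat N N" "P' * P = 1\<^sub>m N" "y \<in> carrier_vec N"
  shows "P' *\<^sub>v (P *\<^sub>v y) = y"
  using assoc_mult_mat_vec[OF assms(2,1,4)] assms by simp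

lemma vec_eta: "y \<in> carrier_vec N \<Longrightarrow> vec N (($) y) = y"
  by (intro eq_vecI) auto

text \<open>The Jordan matrix is written as \<open>D (1 + Q)\<close> instead of \<open>D + Q\<close>; as \<open>Q\<close> only joins coordinates with
  equal diagonal entries, it commutes with \<open>D\<close>, and the binomial theorem gives the powers
  \<open>D\<^sup>k \<Sum>\<^sub>l (k choose l) Q\<^sup>l\<close>. Generalised binomial coefficients are used since the same expression is
  later read as a polynomial in \<open>k\<close>.\<close>

lemma matrix_powers_jordan:
  fixes A :: "complex mat"
  assumes A: "A \<in> carrier_mat N N" and detA: "det A \<noteq> 0"
  obtains P P' Q d where "P \<in> carrier_mat N N" "P' \<in> carrier_mat N N" "P * P' = 1\<^sub>m N" "P' * P = 1\<^sub>m N"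
    "Q \<in> carrier_mat N N" "\<And>i. i < N \<Longrightarrow> d i \<noteq> 0"
    "\<And>y. y \<in> carrier_vec N \<Longrightarrow> Q ^\<^sub>m N *\<^sub>v y = 0\<^sub>v N"
    "\<And>k y. y \<in> carrier_vec N \<Longrightarrow> A ^\<^sub>m k *\<^sub>v (P *\<^sub>v y) =
       P *\<^sub>v vec N (\<lambda>i. d i ^ k * (\<Sum>l\<le>N. (of_nat k gchoose l) * (Q ^\<^sub>m l *\<^sub>v y) $ i))"
proof -
  obtain as where "char_poly A = (\<Prod>a\<leftarrow>as. [:- a, 1:])" using char_poly_factorized[OF A] by blast
  then obtain xs where "jordan_nf A xs" using jordan_nf_exists[OF A] by blast
  then have sim: "similar_mat A (jordan_matrix xs)" by (simp add: jordan_nf_def)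
  define J where "J = jordan_matrix xs"
  obtain P P' where wit: "similar_mat_wit A J P P'" using sim unfolding similar_mat_def J_def by blast
  note PP = similar_mat_witD2[OF A wit]
  have N: "sum_list (map fst xs) = N" using carrier_matD(1)[OF PP(5)] jordan_matrix_dim(1)[of xs] by (simp add: J_def)
  obtain d e where J: "\<And>i j. i < N \<Longrightarrow> j < N \<Longrightarrow> J $$ (i, j) = (if i = j then d i else if j = Suc i then e i else 0)"
    and de: "\<And>i. Suc i < N \<Longrightarrow> e i \<noteq> 0 \<Longrightarrow> d (Suc i) = d i"
    using jordan_matrix_entries[of xs] unfolding N J_def by blast
  have "upper_triangular J"
    using jordan_matrix_upper_triangular[of _ xs] N by (auto simp: J_def upper_triangular_def)
  then have "det J = prod_list (diag_mat J)" using det_upper_triangular PP(5) by blast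
  moreover have "det J \<noteq> 0" using det_similar[OF sim] detA by (simp add: J_def)
  ultimately have "0 \<notin> set (diag_mat J)" by auto
  then have d0: "d i \<noteq> 0" if "i < N" for i
    using that J[OF that that] PP(5) by (force simp: diag_mat_def)
  define Q where "Q = mat N N (\<lambda>(i, j). if j = Suc i then e i / d i else 0)"
  have Q: "Q \<in> carrier_mat N N" by (simp add: Q_def)
  have Qpow: "Q ^\<^sub>m l \<in> carrier_mat N N" for l using Q by simp
  have Qy: "(Q *\<^sub>v y) $ i = (if Suc i < N then e i / d i * y $ Suc i else 0)"
    if "y \<in> carrier_vec N" "i < N" for y i
  proof -
    have "(Q *\<^sub>v y) $ i = (\<Sum>j<N. if j = Suc i then e i / d i * y $ Suc i else 0)"
      unfolding mult_mat_vec_index[OF Q that] using that by (intro sum.cong refl) (auto simp: Q_def)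
    then show ?thesis by simp
  qed
  have "(Q ^\<^sub>m l *\<^sub>v y) $ i = 0" if y: "y \<in> carrier_vec N" and "i < N" "N \<le> i + l" for l y i
    using that(2,3)
  proof (induction l arbitrary: i)
    case (Suc l)
    show ?case unfolding pow_mat_Suc_vec[OF Q y]
      using Qy[OF mult_mat_vec_carrier[OF Qpow y] Suc.prems(1), of l] Suc.IH[of "Suc i"] Suc.prems
      by (simp del: index_mult_mat_vec)
  qed simp
  then have nil: "Q ^\<^sub>m N *\<^sub>v y = 0\<^sub>v N" if "y \<in> carrier_vec N" for y
    using that Qpow[of N] by (intro eq_vecI) (auto simp del: index_mult_mat_vec)
  have Jy: "(J *\<^sub>v vec N (\<lambda>i. d i ^ k * z $ i)) $ i = d i ^ Suc k * (z $ i + (Q *\<^sub>v z) $ i)"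
    if z: "z \<in> carrier_vec N" and i: "i < N" for z i k
  proof -
    have "(J *\<^sub>v vec N (\<lambda>i. d i ^ k * z $ i)) $ i =
       (\<Sum>j<N. (if j = i then d i ^ Suc k * z $ i else 0) +
            (if j = Suc i then e i * (d (Suc i) ^ k * z $ Suc i) else 0))"
      unfolding mult_mat_vec_index[OF PP(5) vec_carrier i] using i by (intro sum.cong refl) (auto simp: J)
    also have "\<dots> = d i ^ Suc k * z $ i + (if Suc i < N then e i * (d (Suc i) ^ k * z $ Suc i) else 0)"
      using i by (simp add: sum.distrib)
    also have "(if Suc i < N then e i * (d (Suc i) ^ k * z $ Suc i) else 0) = d i ^ Suc k * (Q *\<^sub>v z) $ i"
      using de[of i] d0[OF i] by (cases "e i = 0") (auto simp: Qy[OF z i] simp del: index_mult_mat_vec)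
    finally show ?thesis by (simp add: distrib_left)
  qed
  define U where "U k y = vec N (\<lambda>i. \<Sum>l\<le>N. (of_nat k gchoose l) * (Q ^\<^sub>m l *\<^sub>v y) $ i)" for k :: nat and y
  have U_Suc: "U (Suc k) y $ i = U k y $ i + (Q *\<^sub>v U k y) $ i" if y: "y \<in> carrier_vec N" and i: "i < N" for k y i
  proof -
    let ?W = "\<lambda>l. (Q ^\<^sub>m l *\<^sub>v y) $ i"
    have "(Q *\<^sub>v U k y) $ i = (\<Sum>l\<le>N. (of_nat k gchoose l) * ?W (Suc l))"
      unfolding U_def mult_mat_vec_sum[OF Q finite_atMost mult_mat_vec_carrier[OF Qpow y]]
        pow_mat_Suc_vec[OF Q y] using i by (rule index_vec)
    also have "\<dots> = (\<Sum>l<N. (of_nat k gchoose l) * ?W (Suc l))"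
    proof -
      have "?W (Suc N) = 0"
        unfolding pow_mat_Suc_vec[OF Q y] nil[OF y] using i Q by simp
      then show ?thesis by (simp add: lessThan_Suc_atMost[symmetric] del: index_mult_mat_vec pow_mat.simps)
    qed
    finally have QU: "(Q *\<^sub>v U k y) $ i = (\<Sum>l<N. (of_nat k gchoose l) * ?W (Suc l))" .
    have atMost_shift: "(\<Sum>l\<le>N. f l) = f 0 + (\<Sum>l<N. f (Suc l))" for f :: "nat \<Rightarrow> complex"
      by (rule sum.atMost_shift)
    have pascal: "of_nat (Suc k) gchoose Suc l = (of_nat k gchoose l) + (of_nat k gchoose Suc l :: complex)" for l
      using gbinomial_Suc_Suc[of "of_nat k :: complex" l] by (simp add: add.commute)
    have "U (Suc k) y $ i = ?W 0 + (\<Sum>l<N. (of_nat (Suc k) gchoose Suc l) * ?W (Suc l))"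
      using i by (simp add: U_def atMost_shift del: index_mult_mat_vec pow_mat.simps)
    also have "\<dots> = ?W 0 + (\<Sum>l<N. (of_nat k gchoose Suc l) * ?W (Suc l)) + (\<Sum>l<N. (of_nat k gchoose l) * ?W (Suc l))"
      unfolding pascal distrib_right sum.distrib by (simp only: add_ac)
    also have "\<dots> = U k y $ i + (Q *\<^sub>v U k y) $ i"
      unfolding QU using i by (simp add: U_def atMost_shift del: index_mult_mat_vec pow_mat.simps)
    finally show ?thesis .
  qed
  have Ucarr: "U k y \<in> carrier_vec N" for k y by (simp add: U_def)
  have Jpow: "J ^\<^sub>m k *\<^sub>v y = vec N (\<lambda>i. d i ^ k * U k y $ i)" if y: "y \<in> carrier_vec N" for k y
  proof (induction k)
    case 0
    have "U 0 y $ i = y $ i" if "i < N" for i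
    proof -
      have "U 0 y $ i = (\<Sum>l\<le>N. (0 gchoose l) * (Q ^\<^sub>m l *\<^sub>v y) $ i)"
        using that by (simp add: U_def del: index_mult_mat_vec)
      also have "\<dots> = (\<Sum>l\<le>N. if l = 0 then y $ i else 0)"
        by (intro sum.cong refl) (use y Q in \<open>auto simp: gbinomial_0_left\<close>)
      finally have "U 0 y $ i = (\<Sum>l\<le>N. if l = 0 then y $ i else 0)" .
      then show ?thesis by simp
    qed
    then show ?case using y PP(5) by (intro eq_vecI) auto
  next
    case (Suc k)
    show ?case unfolding pow_mat_Suc_vec[OF PP(5) y] Suc
      using Jy[OF Ucarr] U_Suc[OF y] PP(5) by (intro eq_vecI) (auto simp del: index_mult_mat_vec)
  qed
  show thesis
  proof (rule that[OF PP(6,7,1,2) Q d0 nil])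
    fix k and y :: "complex vec" assume y: "y \<in> carrier_vec N"
    have Jvec: "J ^\<^sub>m k *\<^sub>v y =
        vec N (\<lambda>i. d i ^ k * (\<Sum>l\<le>N. (of_nat k gchoose l) * (Q ^\<^sub>m l *\<^sub>v y) $ i))"
      unfolding Jpow[OF y] U_def by (intro eq_vecI) (auto simp del: index_mult_mat_vec)
    have Jk: "J ^\<^sub>m k \<in> carrier_mat N N" using PP(5) by simp
    have "A ^\<^sub>m k *\<^sub>v (P *\<^sub>v y) = P *\<^sub>v (J ^\<^sub>m k *\<^sub>v (P' *\<^sub>v (P *\<^sub>v y)))"
      unfolding similar_mat_wit_pow_id[OF wit] using PP Jk y
      by (simp add: assoc_mult_mat_vec[of _ N N _ N] mult_carrier_mat[of _ N N _ N])
    then show "A ^\<^sub>m k *\<^sub>v (P *\<^sub>v y) =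
       P *\<^sub>v vec N (\<lambda>i. d i ^ k * (\<Sum>l\<le>N. (of_nat k gchoose l) * (Q ^\<^sub>m l *\<^sub>v y) $ i))"
      by (simp add: Jvec mult_mat_vec_inverse[OF PP(6,7,2) y] del: index_mult_mat_vec)
  qed
qed

section \<open>Exponential polynomials\<close>

text \<open>For a chosen base \<open>c\<close>, the operator \<open>F(k) \<mapsto> F(k + 1) - c F(k)\<close> lowers the degree of the coefficient
  at \<open>c\<close> and keeps the degrees at all other bases. So one argues by induction on the degree at \<open>c\<close>,
  inside an induction on the set of bases.\<close>

lemma exponential_polynomial_eq_0:
  fixes p :: "complex \<Rightarrow> complex poly"
  assumes "finite K" "0 \<notin> K" "\<And>k::nat. (\<Sum>c\<in>K. c ^ k * poly (p c) (of_nat k)) = 0"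
  shows "\<forall>c\<in>K. p c = 0"
  using assms
proof (induction K arbitrary: p rule: finite_induct)
  case (insert c K)
  from insert.prems show ?case
  proof (induction "if p c = 0 then 0 else Suc (degree (p c))" arbitrary: p rule: less_induct)
    case (less p)
    show ?case
    proof (cases "p c = 0")
      case True
      then have "\<And>k::nat. (\<Sum>c\<in>K. c ^ k * poly (p c) (of_nat k)) = 0"
        using less.prems(2) insert.hyps by simp
      then show ?thesis using insert.IH[of p] less.prems True by simp
    next
      case False
      \<comment> \<open>the coefficients of \<open>F(k + 1) - c F(k)\<close>\<close>
      define q where "q b = smult b (pcompose (p b) [:1, 1:]) - smult c (p b)" for b
      have deg: "degree (pcompose (p b) [:1, 1:]) = degree (p b)" for b
        by (simp add: degree_pcompose)
      have lead: "coeff (q b) (degree (p b)) = (b - c) * lead_coeff (p b)" for b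
        using lead_coeff_comp[of "[:1, 1:]" "p b"] by (simp add: q_def deg algebra_simps)
      have "(\<Sum>b\<in>insert c K. b ^ k * poly (q b) (of_nat k)) =
          (\<Sum>b\<in>insert c K. b ^ Suc k * poly (p b) (of_nat (Suc k))) -
          c * (\<Sum>b\<in>insert c K. b ^ k * poly (p b) (of_nat k))" for k
        unfolding sum_distrib_left sum_subtractf[symmetric]
        by (intro sum.cong) (auto simp: q_def poly_pcompose algebra_simps)
      then have sum_q: "(\<Sum>b\<in>insert c K. b ^ k * poly (q b) (of_nat k)) = 0" for k
        unfolding less.prems(2) by simp
      have "degree (q c) \<le> degree (p c)"
        unfolding q_def using deg[of c] degree_smult_le by (metis degree_diff_le)
      then have "degree (q c) < degree (p c) \<or> q c = 0"
        using lead[of c] by (metis le_neq_implies_less leading_coeff_0_iff diff_self mult_zero_left)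
      then have "(if q c = 0 then 0 else Suc (degree (q c))) <
          (if p c = 0 then 0 else Suc (degree (p c)))"
        using False by auto
      from less.hyps[OF this less.prems(1) sum_q] have "\<forall>b\<in>insert c K. q b = 0" .
      then have "p b = 0" if "b \<in> K" for b
        using lead[of b] that insert.hyps by auto
      then have "c ^ k * poly (p c) (of_nat k) = 0" for k
        using less.prems(2)[of k] insert.hyps by simp
      then have "range (of_nat :: nat \<Rightarrow> complex) \<subseteq> {x. poly (p c) x = 0}"
        using less.prems(1) by auto
      moreover have "infinite (range (of_nat :: nat \<Rightarrow> complex))"
        by (simp add: finite_image_iff[OF inj_of_nat])
      ultimately have "infinite {x. poly (p c) x = 0}" by (rule infinite_super)
      then show ?thesis using poly_roots_finite[OF False] by simp
    qed
  qed
qed simp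

text \<open>Weights \<open>w\<close> for which the assignment \<open>d\<^sub>i \<mapsto> s\<^bsup>w i\<^esup>\<close> is well defined on monomials of equal degree:
  two such monomials with the same value at \<open>d\<close> have the same weight. Only equal degrees are
  compared, so that adding a constant to all weights is harmless and natural numbers suffice.\<close>

definition weighting :: "nat \<Rightarrow> (nat \<Rightarrow> complex) \<Rightarrow> (nat \<Rightarrow> nat) \<Rightarrow> bool" where
  "weighting n d w \<longleftrightarrow> (\<forall>e e'. (\<Sum>i\<le>n. e i) = (\<Sum>i\<le>n. e' i) \<and>
     (\<Prod>i\<le>n. d i ^ e i) = (\<Prod>i\<le>n. d i ^ e' i) \<longrightarrow> (\<Sum>i\<le>n. w i * e i) = (\<Sum>i\<le>n. w i * e' i))"

lemma sum_list_group:
  fixes f :: "'a \<Rightarrow> 'b::comm_monoid_add"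
  assumes "finite K" "h ` set xs \<subseteq> K"
  shows "(\<Sum>x\<leftarrow>xs. f x) = (\<Sum>c\<in>K. \<Sum>x\<leftarrow>filter (\<lambda>x. h x = c) xs. f x)"
  using assms(2)
proof (induction xs)
  case (Cons x xs)
  have "(\<Sum>c\<in>K. \<Sum>y\<leftarrow>filter (\<lambda>y. h y = c) (x # xs). f y) =
      (\<Sum>c\<in>K. (if c = h x then f x else 0) + (\<Sum>y\<leftarrow>filter (\<lambda>y. h y = c) xs. f y))"
    by (intro sum.cong) auto
  then show ?case using Cons assms(1) by (simp add: sum.distrib)
qed simp

text \<open>The key step from the discrete orbit to continuous flows. Group the monomials of the form by
  their value \<open>c\<close> at \<open>d\<close>. On the discrete orbit the form equals \<open>\<Sum>\<^sub>c c\<^sup>k p\<^sub>c(k)\<close>, where \<open>p\<^sub>c\<close> collects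
  the monomials of value \<open>c\<close>; hence every polynomial \<open>p\<^sub>c\<close> is zero. At the point with parameters
  \<open>s\<close> and \<open>t\<close> the form equals \<open>\<Sum>\<^sub>c s\<^bsup>W c\<^esup> p\<^sub>c(t)\<close>, where \<open>W c\<close> is the common weight of the monomials of
  value \<open>c\<close>.\<close>

lemma hform_vanishes_on_weighted_orbit:
  assumes "hform n D \<phi>" "\<And>i. i \<le> n \<Longrightarrow> d i \<noteq> 0" "weighting n d w"
    and zero: "\<And>k::nat. \<phi> (vec (Suc n) (\<lambda>i. d i ^ k * poly (r i) (of_nat k))) = 0"
  shows "\<phi> (vec (Suc n) (\<lambda>i. s ^ w i * poly (r i) t)) = 0"
proof -
  obtain xs where "monomial_list n D \<phi> xs" using assms(1) unfolding hform_def by blast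
  note xs = monomial_listD[OF this]
  define h where "h x = (\<Prod>i\<le>n. d i ^ snd x i)" for x :: "complex \<times> (nat \<Rightarrow> nat)"
  define K where "K = h ` set xs"
  define P where "P x = smult (fst x) (\<Prod>i\<le>n. r i ^ snd x i)" for x :: "complex \<times> (nat \<Rightarrow> nat)"
  define p where "p c = (\<Sum>x\<leftarrow>filter (\<lambda>x. h x = c) xs. P x)" for c
  have K: "finite K" "h ` set xs \<subseteq> K" "0 \<notin> K"
    using assms(2) by (auto simp: K_def h_def)
  have poly_p: "poly (p c) t = (\<Sum>x\<leftarrow>filter (\<lambda>x. h x = c) xs. poly (P x) t)" for c t
  proof -
    have "poly (\<Sum>x\<leftarrow>ys. P x) t = (\<Sum>x\<leftarrow>ys. poly (P x) t)" for ys by (induction ys) auto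
    then show ?thesis unfolding p_def by simp
  qed
  have "(\<Sum>c\<in>K. c ^ k * poly (p c) (of_nat k)) = 0" for k
  proof -
    have "\<phi> (vec (Suc n) (\<lambda>i. d i ^ k * poly (r i) (of_nat k))) =
        (\<Sum>x\<leftarrow>xs. h x ^ k * poly (P x) (of_nat k))"
      by (subst xs) (auto simp: h_def P_def poly_prod power_mult_distrib prod.distrib
          prod_power_distrib power_mult[symmetric] mult_ac intro!: arg_cong[of _ _ sum_list])
    also have "\<dots> = (\<Sum>c\<in>K. \<Sum>x\<leftarrow>filter (\<lambda>x. h x = c) xs. h x ^ k * poly (P x) (of_nat k))"
      by (rule sum_list_group[OF K(1,2)])
    also have "\<dots> = (\<Sum>c\<in>K. c ^ k * poly (p c) (of_nat k))"
      unfolding poly_p sum_list_const_mult[symmetric]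
      by (intro sum.cong refl arg_cong[of _ _ sum_list] map_cong) auto
    finally show ?thesis using zero by simp
  qed
  then have p0: "p c = 0" if "c \<in> K" for c
    using exponential_polynomial_eq_0[OF K(1,3)] that by blast
  have "\<phi> (vec (Suc n) (\<lambda>i. s ^ w i * poly (r i) t)) =
      (\<Sum>x\<leftarrow>xs. s ^ (\<Sum>i\<le>n. w i * snd x i) * poly (P x) t)"
    by (subst xs) (auto simp: P_def poly_prod power_mult_distrib prod.distrib power_sum
          power_mult[symmetric] mult_ac intro!: arg_cong[of _ _ sum_list])
  also have "\<dots> = (\<Sum>c\<in>K. \<Sum>x\<leftarrow>filter (\<lambda>x. h x = c) xs. s ^ (\<Sum>i\<le>n. w i * snd x i) * poly (P x) t)"
    by (rule sum_list_group[OF K(1,2)])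
  also have "\<dots> = (\<Sum>c\<in>K. 0)"
  proof (rule sum.cong[OF refl])
    fix c assume c: "c \<in> K"
    then obtain y where y: "y \<in> set xs" "h y = c" by (auto simp: K_def)
    have "(\<Sum>i\<le>n. w i * snd x i) = (\<Sum>i\<le>n. w i * snd y i)" if "x \<in> set xs" "h x = c" for x
      using assms(3)[unfolded weighting_def, rule_format, of "snd x" "snd y"] that y xs(1)[of x] xs(1)[of y]
      by (simp add: h_def)
    then have "(\<Sum>x\<leftarrow>filter (\<lambda>x. h x = c) xs. s ^ (\<Sum>i\<le>n. w i * snd x i) * poly (P x) t) =
        (\<Sum>x\<leftarrow>filter (\<lambda>x. h x = c) xs. s ^ (\<Sum>i\<le>n. w i * snd y i) * poly (P x) t)"
      by (intro arg_cong[of _ _ sum_list] map_cong) auto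
    also have "\<dots> = 0"
      using p0[OF c] poly_p[of c t] by (simp add: sum_list_const_mult)
    finally show "(\<Sum>x\<leftarrow>filter (\<lambda>x. h x = c) xs. s ^ (\<Sum>i\<le>n. w i * snd x i) * poly (P x) t) = 0" .
  qed
  finally show ?thesis by simp
qed

section \<open>Weights that respect multiplicative relations\<close>

lemma common_denominator:
  fixes f :: "nat \<Rightarrow> rat"
  shows "\<exists>D::nat. D > 0 \<and> (\<forall>i\<le>n. \<exists>z::int. of_nat D * f i = of_int z)"
proof (induction n)
  case 0
  obtain a b where "quotient_of (f 0) = (a, b)" by (cases "quotient_of (f 0)")
  then have "b > 0" "f 0 = of_int a / of_int b"
    using quotient_of_denom_pos quotient_of_div by auto
  then show ?case by (intro exI[of _ "nat b"]) (auto intro!: exI[of _ a])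
next
  case (Suc n)
  then obtain D :: nat where D: "D > 0" "\<forall>i\<le>n. \<exists>z::int. of_nat D * f i = of_int z" by auto
  obtain a b where "quotient_of (f (Suc n)) = (a, b)" by (cases "quotient_of (f (Suc n))")
  then have b: "b > 0" "f (Suc n) = of_int a / of_int b"
    using quotient_of_denom_pos quotient_of_div by auto
  have "\<exists>z::int. of_nat (D * nat b) * f i = of_int z" if i: "i \<le> Suc n" for i
  proof (cases "i = Suc n")
    case True
    then show ?thesis using b by (intro exI[of _ "int D * a"]) auto
  next
    case False
    then obtain z :: int where "of_nat D * f i = of_int z" using D i False by (auto simp: le_Suc_eq)
    then have "of_nat (D * nat b) * f i = of_int (z * b)"
      using b by (simp add: mult_ac)
    then show ?thesis by blast
  qed
  then show ?case using D b by (intro exI[of _ "D * nat b"]) auto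
qed

lemma exp_eq_1_imp_multiple:
  assumes "exp z = (1 :: complex)"
  shows "\<exists>k::int. z = of_int k * (2 * of_real pi * \<i>)"
proof -
  have polar: "of_real (exp (Re z)) * cis (Im z) = 1" using assms by (simp add: exp_eq_polar)
  then have "cmod (of_real (exp (Re z)) * cis (Im z)) = 1" by simp
  then have Re: "Re z = 0" by (simp add: norm_mult)
  then have "cos (Im z) = 1" using polar by (simp add: complex_eq_iff)
  then obtain k :: int where "Im z = of_int k * 2 * pi" unfolding cos_one_2pi_int by blast
  then show ?thesis using Re by (intro exI[of _ k]) (simp add: complex_eq_iff)
qed

lemma exp_int_multiple: "exp (of_int k * (2 * of_real pi * \<i>)) = (1 :: complex)"
proof -
  have "of_int k * (2 * of_real pi * \<i>) = Complex 0 (2 * pi * of_int k)" by (simp add: complex_eq_iff)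
  then show ?thesis by (simp add: exp_eq_polar cis_multiple_2pi)
qed

text \<open>Take logarithms \<open>l\<^sub>i\<close> of the \<open>d\<^sub>i\<close>. A multiplicative relation between the \<open>d\<^sub>i\<close> is an integral linear
  relation between the \<open>l\<^sub>i\<close> modulo multiples of \<open>2 \<pi> \<i>\<close>, so every linear functional \<open>f\<close> on the rational vector space
  of complex numbers with \<open>f(2 \<pi> \<i>) = 0\<close> satisfies it exactly. Since \<open>d\<^sub>p / d\<^sub>q\<close> is not a root of
  unity, \<open>l\<^sub>p - l\<^sub>q\<close> is not a rational multiple of \<open>2 \<pi> \<i>\<close>, and there is such an \<open>f\<close> with
  \<open>f(l\<^sub>p) \<noteq> f(l\<^sub>q)\<close>. The rational numbers \<open>f(l\<^sub>i)\<close> become natural numbers after clearing denominators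
  and adding a constant.\<close>

lemma exists_separating_weighting:
  assumes d: "\<And>i. i \<le> n \<Longrightarrow> d i \<noteq> 0" and pq: "p \<le> n" "q \<le> n"
    and non_torsion: "\<And>M::nat. M > 0 \<Longrightarrow> d p ^ M \<noteq> d q ^ M"
  shows "\<exists>w. weighting n d w \<and> w p \<noteq> w q"
proof -
  have ring: "(a * c + b) * x - (a * c + b) * y = a * ((x - y) * c) + b * (x - y)" for a b c x y :: rat
    by (simp add: algebra_simps)
  define l where "l i = Complex (ln (cmod (d i))) (Arg (d i))" for i
  have l: "exp (l i) = d i" if "i \<le> n" for i
    using d[OF that] rcis_cmod_Arg[of "d i"] by (simp add: l_def exp_eq_polar rcis_def)
  define \<omega> :: complex where "\<omega> = 2 * of_real pi * \<i>"
  define scl :: "rat \<Rightarrow> complex \<Rightarrow> complex" where "scl r z = of_rat r * z" for r z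
  interpret V: vector_space scl
    by unfold_locales (auto simp: scl_def algebra_simps of_rat_add of_rat_mult)
  interpret R: vector_space "(*) :: rat \<Rightarrow> rat \<Rightarrow> rat"
    by unfold_locales (auto simp: algebra_simps)
  interpret VR: vector_space_pair scl "(*) :: rat \<Rightarrow> rat \<Rightarrow> rat" ..
  have "l p - l q \<notin> V.span {\<omega>}"
  proof
    assume "l p - l q \<in> V.span {\<omega>}"
    then obtain r where r: "l p - l q = of_rat r * \<omega>" by (auto simp: V.span_singleton scl_def)
    obtain a b where ab: "quotient_of r = (a, b)" by (cases "quotient_of r")
    then have b: "b > 0" "r = of_int a / of_int b"
      using quotient_of_denom_pos quotient_of_div by auto
    have "of_nat (nat b) * (l p - l q) = of_int a * \<omega>"
      using b by (simp add: r of_rat_divide)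
    then have "exp (of_nat (nat b) * (l p - l q)) = 1" unfolding \<omega>_def by (simp add: exp_int_multiple)
    then have "d p ^ nat b = d q ^ nat b"
      using l pq by (simp add: exp_of_nat_mult right_diff_distrib exp_diff)
    then show False using non_torsion[of "nat b"] b by simp
  qed
  then have "V.independent {l p - l q, \<omega>}" and "l p - l q \<noteq> \<omega>"
    using V.span_base[of \<omega> "{\<omega>}"] by (auto simp: V.independent_insert V.dependent_single \<omega>_def)
  from VR.linear_independent_extend[OF this(1), of "\<lambda>z. if z = \<omega> then 0 else 1"] this(2)
  obtain f where lin: "Vector_Spaces.linear scl (*) f" and f: "f (l p - l q) = 1" "f \<omega> = 0"
    by auto
  interpret f: Vector_Spaces.linear scl "(*)" f by (rule lin)
  obtain D :: nat where D: "D > 0" "\<forall>i\<le>n. \<exists>z::int. of_nat D * f (l i) = of_int z"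
    using common_denominator[of n "\<lambda>i. f (l i)"] by blast
  then obtain z :: "nat \<Rightarrow> int" where z: "\<And>i. i \<le> n \<Longrightarrow> of_nat D * f (l i) = of_int (z i)" by metis
  \<comment> \<open>a constant that makes all weights nonnegative\<close>
  define K where "K = (\<Sum>i\<le>n. \<bar>z i\<bar>)"
  have K: "z i + K \<ge> 0" if "i \<le> n" for i
    using member_le_sum[of i "{..n}" "\<lambda>i. \<bar>z i\<bar>"] that unfolding K_def by (auto simp: abs_le_iff)
  define w where "w i = nat (z i + K)" for i
  have rw: "(of_nat (w i) :: rat) = of_nat D * f (l i) + of_int K" if "i \<le> n" for i
    using z[OF that] K[OF that] by (simp add: w_def)
  have "weighting n d w"
    unfolding weighting_def
  proof (intro allI impI, elim conjE)
    fix e e' assume e: "(\<Sum>i\<le>n. e i) = (\<Sum>i\<le>n. e' i)" "(\<Prod>i\<le>n. d i ^ e i) = (\<Prod>i\<le>n. d i ^ e' i)"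
    have exp_l: "exp (\<Sum>i\<le>n. of_nat (e i) * l i) = (\<Prod>i\<le>n. d i ^ e i)" for e
      using l by (simp add: exp_sum exp_of_nat_mult)
    have "exp ((\<Sum>i\<le>n. of_nat (e i) * l i) - (\<Sum>i\<le>n. of_nat (e' i) * l i)) = 1"
      unfolding exp_diff exp_l e(2) using d by simp
    then obtain k :: int where k: "(\<Sum>i\<le>n. of_nat (e i) * l i) - (\<Sum>i\<le>n. of_nat (e' i) * l i) = of_int k * \<omega>"
      using exp_eq_1_imp_multiple unfolding \<omega>_def by blast
    have "(\<Sum>i\<le>n. (of_nat (e i) - of_nat (e' i)) * f (l i)) =
        f (\<Sum>i\<le>n. scl (of_nat (e i) - of_nat (e' i)) (l i))"
      by (simp add: f.sum f.scale)
    also have "(\<Sum>i\<le>n. scl (of_nat (e i) - of_nat (e' i)) (l i)) = scl (of_int k) \<omega>"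
      using k by (simp add: scl_def of_rat_diff left_diff_distrib sum_subtractf)
    finally have "(\<Sum>i\<le>n. (of_nat (e i) - of_nat (e' i)) * f (l i)) = 0" by (simp add: f.scale f(2))
    moreover have "(\<Sum>i\<le>n. of_nat (e i)) = (\<Sum>i\<le>n. (of_nat (e' i) :: rat))"
      using e(1) by (metis of_nat_sum)
    moreover have "of_nat (\<Sum>i\<le>n. w i * e i) - of_nat (\<Sum>i\<le>n. w i * e' i) =
        of_nat D * (\<Sum>i\<le>n. (of_nat (e i) - of_nat (e' i)) * f (l i)) +
        of_int K * ((\<Sum>i\<le>n. of_nat (e i)) - (\<Sum>i\<le>n. (of_nat (e' i) :: rat)))"
      unfolding of_nat_sum sum_subtractf[symmetric] sum_distrib_left sum.distrib[symmetric]
      by (intro sum.cong refl) (simp add: rw ring)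
    ultimately have "of_nat (\<Sum>i\<le>n. w i * e i) = (of_nat (\<Sum>i\<le>n. w i * e' i) :: rat)" by simp
    then show "(\<Sum>i\<le>n. w i * e i) = (\<Sum>i\<le>n. w i * e' i)" unfolding of_nat_eq_iff .
  qed
  moreover have "w p \<noteq> w q"
  proof
    assume "w p = w q"
    then have "(of_nat (w p) :: rat) = of_nat (w q)" by simp
    then have "f (l p) = f (l q)" using rw pq D by simp
    then show False using f(1) by (simp add: f.diff)
  qed
  ultimately show ?thesis by blast
qed

section \<open>Monomial curves\<close>

text \<open>The negative coefficients of Bezout's identity are moved to the right hand side, so that
  everything stays within the natural numbers.\<close>

lemma bezout_Gcd_nat:
  fixes f :: "'a \<Rightarrow> nat"
  assumes "finite I"
  shows "\<exists>p q. (\<Sum>i\<in>I. p i * f i) = (\<Sum>i\<in>I. q i * f i) + Gcd (f ` I)"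
  using assms
proof (induction I rule: finite_induct)
  case (insert i F)
  then obtain p q where pq: "(\<Sum>i\<in>F. p i * f i) = (\<Sum>i\<in>F. q i * f i) + Gcd (f ` F)" by auto
  show ?case
  proof (cases "f i = 0")
    case True
    then show ?thesis using insert pq by (intro exI[of _ p] exI[of _ q]) auto
  next
    case False
    then obtain x y where xy: "f i * x = Gcd (f ` F) * y + gcd (f i) (Gcd (f ` F))"
      using bezout_nat by blast
    define p' where "p' j = (if j = i then x else y * q j)" for j
    define q' where "q' j = (if j = i then 0 else y * p j)" for j
    have "(\<Sum>j\<in>F. p' j * f j) = y * (\<Sum>j\<in>F. q j * f j)"
      "(\<Sum>j\<in>F. q' j * f j) = y * (\<Sum>j\<in>F. p j * f j)"
      unfolding sum_distrib_left using insert by (auto simp: p'_def q'_def intro!: sum.cong)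
    then have "(\<Sum>j\<in>insert i F. p' j * f j) = (\<Sum>j\<in>insert i F. q' j * f j) + Gcd (f ` insert i F)"
      using insert xy pq by (simp add: p'_def q'_def algebra_simps)
    then show ?thesis by blast
  qed
qed simp

text \<open>The exponents of \<open>z\<close> in the coordinates \<open>0, \<dots>, m\<close> of the monomial curve, including the
  exponent \<open>0\<close> of the last one; this allows treating all \<open>m + 1\<close> coordinates uniformly.\<close>

definition exponent :: "nat \<Rightarrow> (nat \<Rightarrow> nat) \<Rightarrow> nat \<Rightarrow> nat" where
  "exponent m k j = (if j < m then k (Suc j) else 0)"

lemma exponent_strict:
  assumes k: "monomial_exponents n m k" and "i < j" "j \<le> m"
  shows "exponent m k j < exponent m k i"
proof -
  have step: "exponent m k (Suc i) < exponent m k i" if "Suc i \<le> m" for i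
    using k that by (cases "Suc i = m") (auto simp: exponent_def monomial_exponents_def)
  show ?thesis using assms(2,3)
  proof (induction j)
    case (Suc j)
    then show ?case using step[of j] by (cases "i = j") (auto intro: less_trans)
  qed simp
qed

lemma exponent_le: "monomial_exponents n m k \<Longrightarrow> j \<le> m \<Longrightarrow> exponent m k j \<le> k 1"
  using exponent_strict[of n m k 0 j] by (cases "j = 0") (auto simp: exponent_def monomial_exponents_def)

lemma exponent_m: "exponent m k m = 0"
  by (simp add: exponent_def)

lemma exponent_0: "monomial_exponents n m k \<Longrightarrow> exponent m k 0 = k 1"
  by (simp add: exponent_def monomial_exponents_def)

lemma monomial_vec_index:
  assumes "monomial_exponents n m k" "j \<le> n"
  shows "monomial_vec n m k z w $ j =
    (if j \<le> m then z ^ exponent m k j * w ^ (k 1 - exponent m k j) else 0)"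
  using assms by (auto simp: monomial_vec_def exponent_def)

lemma monomial_vec_carrier: "monomial_vec n m k z w \<in> carrier_vec (Suc n)"
  by (simp add: monomial_vec_def)

lemma monomial_vec_scale:
  assumes k: "monomial_exponents n m k"
  shows "monomial_vec n m k (c * z) (c * w) = c ^ k 1 \<cdot>\<^sub>v monomial_vec n m k z w"
proof (rule eq_vecI)
  fix i assume "i < dim_vec (c ^ k 1 \<cdot>\<^sub>v monomial_vec n m k z w)"
  then have i: "i \<le> n" by (simp add: monomial_vec_def)
  have "c ^ exponent m k i * c ^ (k 1 - exponent m k i) = c ^ k 1" if "i \<le> m"
    using exponent_le[OF k that] by (simp add: power_add[symmetric])
  then show "monomial_vec n m k (c * z) (c * w) $ i = (c ^ k 1 \<cdot>\<^sub>v monomial_vec n m k z w) $ i"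
    using i monomial_vec_carrier[of n m k z w]
    by (auto simp: monomial_vec_index[OF k] power_mult_distrib mult_ac)
qed (simp add: monomial_vec_def)

lemma monomial_vec_nonzero:
  assumes k: "monomial_exponents n m k" and zw: "z \<noteq> 0 \<or> w \<noteq> 0"
  shows "monomial_vec n m k z w \<in> coord_vecs n"
proof -
  have m: "m \<le> n" using k by (simp add: monomial_exponents_def)
  have "monomial_vec n m k z w $ 0 \<noteq> 0 \<or> monomial_vec n m k z w $ m \<noteq> 0"
    using zw m by (auto simp: monomial_vec_index[OF k] exponent_m exponent_0[OF k])
  then have "monomial_vec n m k z w \<noteq> 0\<^sub>v (Suc n)" using m by (metis index_zero_vec(1) le_imp_less_Suc zero_le)
  then show ?thesis by (simp add: coord_vecs_def monomial_vec_carrier)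
qed

lemma CP_1_iff: "p \<in> CP 1 \<longleftrightarrow> (\<exists>z w. (z \<noteq> 0 \<or> w \<noteq> 0) \<and> p = proj_point (vec_of_list [z, w]))"
proof
  assume "p \<in> CP 1"
  then obtain x where x: "x \<in> coord_vecs 1" "p = proj_point x" by (auto simp: CP_iff)
  have "x = vec_of_list [x $ 0, x $ 1]"
    using x by (intro eq_vecI) (auto simp: coord_vecs_def less_Suc_eq numeral_2_eq_2)
  moreover obtain l where "l \<le> 1" "x $ l \<noteq> 0" using coord_vecs_nonzero_coord[OF x(1)] by blast
  then have "x $ 0 \<noteq> 0 \<or> x $ 1 \<noteq> 0" by (cases l) auto
  ultimately show "\<exists>z w. (z \<noteq> 0 \<or> w \<noteq> 0) \<and> p = proj_point (vec_of_list [z, w])"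
    using x by metis
next
  assume "\<exists>z w. (z \<noteq> 0 \<or> w \<noteq> 0) \<and> p = proj_point (vec_of_list [z, w])"
  then obtain z w where zw: "z \<noteq> 0 \<or> w \<noteq> 0" "p = proj_point (vec_of_list [z, w])" by blast
  have "vec_of_list [z, w] $ 0 = z" "vec_of_list [z, w] $ 1 = w" by auto
  moreover have "0\<^sub>v (Suc 1) $ 0 = (0 :: complex)" "0\<^sub>v (Suc 1) $ 1 = (0 :: complex)" by auto
  ultimately have "vec_of_list [z, w] \<noteq> 0\<^sub>v (Suc 1)" using zw(1) by metis
  moreover have "vec_of_list [z, w] \<in> carrier_vec (Suc 1)" by (rule carrier_vecI) simp
  ultimately have "vec_of_list [z, w] \<in> coord_vecs 1" by (simp add: coord_vecs_def)
  then show "p \<in> CP 1" using zw by (auto simp: CP_iff)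
qed

lemma monomial_map_proj_point:
  assumes "monomial_exponents n m k"
  shows "monomial_map n m k (proj_point (vec_of_list [z, w])) = proj_point (monomial_vec n m k z w)"
proof -
  have "proj_point (monomial_vec n m k (v $ 0) (v $ 1)) = proj_point (monomial_vec n m k z w)"
    if v: "v \<in> proj_point (vec_of_list [z, w])" for v
  proof -
    obtain c where c: "c \<noteq> 0" "v = c \<cdot>\<^sub>v vec_of_list [z, w]" using v by (auto simp: mem_proj_point)
    then have "v $ 0 = c * z" "v $ 1 = c * w" by auto
    then show ?thesis using c proj_point_smult by (simp add: monomial_vec_scale[OF assms])
  qed
  then show ?thesis
    unfolding monomial_map_def using self_mem_proj_point[of "vec_of_list [z, w]"] by blast
qed

lemma monomial_map_image:
  assumes "monomial_exponents n m k"
  shows "monomial_map n m k ` CP 1 = {proj_point (monomial_vec n m k z w) | z w. z \<noteq> 0 \<or> w \<noteq> 0}"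
proof -
  have image_Collect2: "h ` {f z w | z w. P z w} = {h (f z w) | z w. P z w}"
    for h :: "'a \<Rightarrow> 'b" and f :: "'c \<Rightarrow> 'd \<Rightarrow> 'a" and P by blast
  have "CP 1 = {proj_point (vec_of_list [z, w]) | z w. z \<noteq> 0 \<or> w \<noteq> 0}"
    using CP_1_iff by blast
  then have "monomial_map n m k ` CP 1 =
      {monomial_map n m k (proj_point (vec_of_list [z, w])) | z w. z \<noteq> 0 \<or> w \<noteq> 0}"
    by (simp only: image_Collect2)
  then show ?thesis unfolding monomial_map_proj_point[OF assms] .
qed

lemma monomial_poly_curve:
  assumes k: "monomial_exponents n m k"
  shows "poly_curve n (\<lambda>t. monomial_vec n m k t 1)" "poly_curve n (\<lambda>t. monomial_vec n m k 1 t)"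
proof -
  have "\<exists>q. \<forall>t. monomial_vec n m k t 1 $ i = poly q t" if "i \<le> n" for i
    using that by (intro exI[of _ "if i \<le> m then monom 1 (exponent m k i) else 0"])
      (auto simp: monomial_vec_index[OF k] poly_monom)
  moreover have "\<exists>q. \<forall>t. monomial_vec n m k 1 t $ i = poly q t" if "i \<le> n" for i
    using that by (intro exI[of _ "if i \<le> m then monom 1 (k 1 - exponent m k i) else 0"])
      (auto simp: monomial_vec_index[OF k] poly_monom)
  ultimately show "poly_curve n (\<lambda>t. monomial_vec n m k t 1)" "poly_curve n (\<lambda>t. monomial_vec n m k 1 t)"
    by (auto simp: poly_curve_def monomial_vec_carrier)
qed

text \<open>The affine part \<open>w = 1\<close> is a polynomial curve, which accounts by homogeneity for all points with
  \<open>w \<noteq> 0\<close>; the remaining point lies on the polynomial curve \<open>z = 1\<close>.\<close>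

lemma form_zero_on_monomial_curve:
  assumes k: "monomial_exponents n m k" and \<phi>: "\<phi> \<in> forms n"
    and T: "infinite T" "\<And>t. t \<in> T \<Longrightarrow> \<phi> (monomial_vec n m k t 1) = 0" and zw: "z \<noteq> 0 \<or> w \<noteq> 0"
  shows "\<phi> (monomial_vec n m k z w) = 0"
proof -
  obtain d where d: "hform n d \<phi>" using \<phi> by (auto simp: forms_def)
  have 1: "\<phi> (monomial_vec n m k t 1) = 0" for t
    by (rule form_zero_on_poly_curve[OF \<phi> monomial_poly_curve(1)[OF k] T])
  have 2: "\<phi> (monomial_vec n m k (c * z) (c * w)) = (c ^ k 1) ^ d * \<phi> (monomial_vec n m k z w)" for c z w
    unfolding monomial_vec_scale[OF k] by (simp add: hform_scale[OF d monomial_vec_carrier])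
  have 3: "\<phi> (monomial_vec n m k z w) = 0" if "w \<noteq> 0" for z w
    using 2[of w "z / w" 1] 1 that by simp
  have "infinite (UNIV - {0 :: complex})" by (simp add: infinite_UNIV_char_0)
  then have "\<phi> (monomial_vec n m k 1 0) = 0"
    by (rule form_zero_on_poly_curve[OF \<phi> monomial_poly_curve(2)[OF k]]) (use 3 in auto)
  then show ?thesis using 3 2[of z 1 0] zw by (cases "w = 0") auto
qed

lemma monomial_curve_satisfies_binomials:
  assumes k: "monomial_exponents n m k"
    and ab: "(\<Sum>i\<le>m. a i) = (\<Sum>i\<le>m. b i)"
      "(\<Sum>i\<le>m. exponent m k i * a i) = (\<Sum>i\<le>m. exponent m k i * b i)"
  shows "(\<Prod>i\<le>m. monomial_vec n m k z w $ i ^ a i) = (\<Prod>i\<le>m. monomial_vec n m k z w $ i ^ b i)"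
proof -
  have m: "m \<le> n" using k by (simp add: monomial_exponents_def)
  let ?K = "exponent m k"
  have eq: "(\<Prod>i\<le>m. monomial_vec n m k z w $ i ^ a i) =
      z ^ (\<Sum>i\<le>m. ?K i * a i) * w ^ (\<Sum>i\<le>m. (k 1 - ?K i) * a i)" for a
  proof -
    have "(\<Prod>i\<le>m. monomial_vec n m k z w $ i ^ a i) =
        (\<Prod>i\<le>m. z ^ (?K i * a i) * w ^ ((k 1 - ?K i) * a i))"
      using m by (intro prod.cong refl)
        (auto simp: monomial_vec_index[OF k] power_mult_distrib power_mult)
    then show ?thesis by (simp add: prod.distrib power_sum)
  qed
  have sum: "(\<Sum>i\<le>m. (k 1 - ?K i) * a i) + (\<Sum>i\<le>m. ?K i * a i) = k 1 * (\<Sum>i\<le>m. a i)" for a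
    unfolding sum.distrib[symmetric] sum_distrib_left
    using exponent_le[OF k] by (intro sum.cong refl) (auto simp: distrib_right[symmetric])
  have "(\<Sum>i\<le>m. (k 1 - ?K i) * a i) = (\<Sum>i\<le>m. (k 1 - ?K i) * b i)"
    using sum[of a] sum[of b] ab by simp
  then show ?thesis unfolding eq by (simp only: ab)
qed

text \<open>Write \<open>K j\<close> for the exponents. The relations \<open>x\<^sub>j\<^bsup>K 0\<^esup> = x\<^sub>0\<^bsup>K j\<^esup> x\<^sub>m\<^bsup>K 0 - K j\<^esup>\<close> show that a solution with \<open>x\<^sub>0 = 0\<close> or \<open>x\<^sub>m = 0\<close> is one of the
  two points \<open>w = 0\<close>, \<open>z = 0\<close>, and that otherwise no \<open>x\<^sub>j\<close> with \<open>j \<le> m\<close> is zero. In the latter case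
  Bezout's identity \<open>\<Sum> p\<^sub>i K\<^sub>i = \<Sum> q\<^sub>i K\<^sub>i + 1\<close> provides the parameter: the Laurent monomial \<open>t\<close> with
  exponents \<open>p - q\<close>, made homogeneous of degree \<open>0\<close> by a power of \<open>x\<^sub>m\<close>, has weight \<open>1\<close>, so that
  \<open>t\<^bsup>K j\<^esup>\<close> and \<open>x\<^sub>j / x\<^sub>m\<close> agree by one more binomial.\<close>

lemma binomials_cut_out_monomial_curve:
  assumes k: "monomial_exponents n m k" and x: "x \<in> coord_vecs n"
    and outside: "\<And>i. m < i \<Longrightarrow> i \<le> n \<Longrightarrow> x $ i = 0"
    and binom: "\<And>a b. (\<Sum>i\<le>m. a i) = (\<Sum>i\<le>m. b i) \<Longrightarrow>
      (\<Sum>i\<le>m. exponent m k i * a i) = (\<Sum>i\<le>m. exponent m k i * b i) \<Longrightarrow>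
      (\<Prod>i\<le>m. x $ i ^ a i) = (\<Prod>i\<le>m. x $ i ^ b i)"
  shows "\<exists>c z w. c \<noteq> 0 \<and> (z \<noteq> 0 \<or> w \<noteq> 0) \<and> x = c \<cdot>\<^sub>v monomial_vec n m k z w"
proof -
  have m: "m \<le> n" "1 \<le> m" using k by (auto simp: monomial_exponents_def)
  define K where "K = exponent m k"
  have K: "K 0 = k 1" "K m = 0" "\<And>i j. i < j \<Longrightarrow> j \<le> m \<Longrightarrow> K j < K i" "\<And>j. j \<le> m \<Longrightarrow> K j \<le> k 1"
    using exponent_0[OF k] exponent_m exponent_strict[OF k] exponent_le[OF k] by (auto simp: K_def)
  define sg where "sg j c i = (if i = j then c else 0)" for j c i :: nat
  have sum_sg: "(\<Sum>i\<le>m. sg j c i) = c" "(\<Sum>i\<le>m. K i * sg j c i) = K j * c" if "j \<le> m" for j c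
    using that by (auto simp: sg_def if_distrib[of "\<lambda>x. _ * x"] cong: if_cong)
  have prod_sg: "(\<Prod>i\<le>m. x $ i ^ sg j c i) = x $ j ^ c" if "j \<le> m" for j c
    using that by (auto simp: sg_def if_distrib[of "\<lambda>e. _ ^ e"] cong: if_cong)
  \<comment> \<open>\<open>sg j c\<close> is the exponent vector of the monomial \<open>x\<^sub>j\<^sup>c\<close>\<close>
  have two: "x $ j ^ K 0 = x $ 0 ^ K j * x $ m ^ (K 0 - K j)" if j: "j \<le> m" for j
    using binom[of "sg j (K 0)" "\<lambda>i. sg 0 (K j) i + sg m (K 0 - K j) i"] j K(4)[OF j]
    unfolding K_def[symmetric]
    by (simp add: sum.distrib distrib_left sum_sg prod_sg power_add prod.distrib K(1,2))
  have nonzero: "\<exists>j\<le>m. x $ j \<noteq> 0"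
    using coord_vecs_nonzero_coord[OF x] outside by (meson not_le_imp_less)
  have eqI: "x = c \<cdot>\<^sub>v monomial_vec n m k z w"
    if "\<And>j. j \<le> m \<Longrightarrow> x $ j = c * (z ^ K j * w ^ (k 1 - K j))" for c z w
  proof (rule eq_vecI)
    fix i assume "i < dim_vec (c \<cdot>\<^sub>v monomial_vec n m k z w)"
    then have i: "i \<le> n" by (simp add: monomial_vec_def)
    then show "x $ i = (c \<cdot>\<^sub>v monomial_vec n m k z w) $ i"
      using that[of i] outside[of i] monomial_vec_carrier[of n m k z w]
      by (cases "i \<le> m") (auto simp: monomial_vec_index[OF k] K_def)
  qed (use x in \<open>simp add: coord_vecs_def monomial_vec_def\<close>)
  have Kpos: "0 < K j" if "j < m" for j using K(2) K(3)[of j m] that by simp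
  have Kless: "K j < K 0" if "0 < j" "j \<le> m" for j using K(3) that by simp
  consider "x $ m = 0" | "x $ m \<noteq> 0" "x $ 0 = 0" | "x $ m \<noteq> 0" "x $ 0 \<noteq> 0" by blast
  then show ?thesis
  proof cases
    case 1
    have zero: "x $ j = 0" if "0 < j" "j \<le> m" for j
      using two[OF that(2)] 1 Kless[OF that] by (simp add: zero_power)
    then have "x $ 0 \<noteq> 0" using nonzero by (metis not_gr_zero)
    moreover have "x $ j = x $ 0 * (1 ^ K j * 0 ^ (k 1 - K j))" if "j \<le> m" for j
      using zero[OF _ that] Kless[OF _ that] K(1) by (cases "j = 0") auto
    from eqI[OF this] have "x = x $ 0 \<cdot>\<^sub>v monomial_vec n m k 1 0" .
    ultimately show ?thesis by (intro exI[of _ "x $ 0"] exI[of _ 1] exI[of _ 0]) simp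
  next
    case 2
    have zero: "x $ j = 0" if "j < m" for j
      using two[of j] 2 Kpos[OF that] that by (simp add: zero_power)
    have "x $ j = x $ m * (0 ^ K j * 1 ^ (k 1 - K j))" if "j \<le> m" for j
      using zero[of j] Kpos[of j] K(2) that by (cases "j = m") auto
    from eqI[OF this] have "x = x $ m \<cdot>\<^sub>v monomial_vec n m k 0 1" .
    then show ?thesis using 2 by (intro exI[of _ "x $ m"] exI[of _ 0] exI[of _ 1]) simp
  next
    case 3
    have nz: "x $ j \<noteq> 0" if "j \<le> m" for j
      using two[OF that] 3 Kpos[of 0] m by (auto simp: zero_power)
    have "K ` {..<m} = k ` Suc ` {..<m}"
      unfolding image_image by (intro image_cong) (auto simp: K_def exponent_def)
    then have "K ` {..<m} = k ` {1..m}" by (simp add: image_Suc_lessThan)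
    then have "Gcd (K ` {..<m}) = 1" using k by (simp add: monomial_exponents_def)
    then obtain p q where "(\<Sum>i<m. p i * K i) = (\<Sum>i<m. q i * K i) + 1"
      using bezout_Gcd_nat[of "{..<m}" K] by auto
    then have pq: "(\<Sum>i\<le>m. K i * p i) = (\<Sum>i\<le>m. K i * q i) + 1"
      using K(2) by (simp add: lessThan_Suc_atMost[symmetric] mult.commute)
    define P Q where "P = (\<Prod>i\<le>m. x $ i ^ p i)" and "Q = (\<Prod>i\<le>m. x $ i ^ q i)"
    define r s where "r = (\<Sum>i\<le>m. p i)" and "s = (\<Sum>i\<le>m. q i)"
    define t where "t = (P * x $ m ^ s) / (Q * x $ m ^ r)"
    have Q0: "Q \<noteq> 0" using nz by (auto simp: Q_def)
    have "t ^ K j = x $ j / x $ m" if j: "j \<le> m" for j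
    proof -
      have "(\<Prod>i\<le>m. x $ i ^ (K j * p i + sg m (K j * s + 1) i)) =
          (\<Prod>i\<le>m. x $ i ^ (K j * q i + sg m (K j * r) i + sg j 1 i))"
      proof (rule binom, unfold K_def[symmetric])
        show "(\<Sum>i\<le>m. K j * p i + sg m (K j * s + 1) i) = (\<Sum>i\<le>m. K j * q i + sg m (K j * r) i + sg j 1 i)"
          using j by (simp add: sum.distrib sum_sg sum_distrib_left[symmetric] r_def s_def)
        have "(\<Sum>i\<le>m. K i * (K j * p i)) = K j * (\<Sum>i\<le>m. K i * p i)" for p
          by (simp add: sum_distrib_left mult_ac)
        then show "(\<Sum>i\<le>m. K i * (K j * p i + sg m (K j * s + 1) i)) =
            (\<Sum>i\<le>m. K i * (K j * q i + sg m (K j * r) i + sg j 1 i))"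
          using j by (simp add: sum.distrib distrib_left sum_sg K(2) pq)
      qed
      moreover have "(\<Prod>i\<le>m. x $ i ^ (K j * p i)) = (\<Prod>i\<le>m. x $ i ^ p i) ^ K j" for p
        by (simp add: prod_power_distrib power_mult[symmetric] mult.commute)
      ultimately have "P ^ K j * x $ m ^ (K j * s + 1) = Q ^ K j * x $ m ^ (K j * r) * x $ j"
        using j by (simp add: power_add prod.distrib prod_sg P_def Q_def del: power_Suc)
      then have e: "P ^ K j * x $ m ^ (K j * s) * x $ m = Q ^ K j * x $ m ^ (K j * r) * x $ j"
        by (simp add: mult_ac)
      have D: "Q ^ K j * x $ m ^ (K j * r) \<noteq> 0" using 3 Q0 by simp
      have "t ^ K j = (P ^ K j * x $ m ^ (K j * s)) / (Q ^ K j * x $ m ^ (K j * r))"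
        by (simp add: t_def power_divide power_mult_distrib power_mult[symmetric] mult.commute)
      also have "\<dots> = x $ j / x $ m"
        unfolding frac_eq_eq[OF D 3(1)] by (rule trans[OF e mult.commute])
      finally show ?thesis .
    qed
    then have "x $ j = x $ m * (t ^ K j * 1 ^ (k 1 - K j))" if "j \<le> m" for j
      using that 3 by simp
    from eqI[OF this] have "x = x $ m \<cdot>\<^sub>v monomial_vec n m k t 1" .
    then show ?thesis using 3 by (intro exI[of _ "x $ m"] exI[of _ t] exI[of _ 1]) simp
  qed
qed

lemma monomial_curve_algebraic:
  assumes k: "monomial_exponents n m k"
  shows "algebraic_set n (monomial_map n m k ` CP 1)"
proof -
  have m: "m \<le> n" using k by (simp add: monomial_exponents_def)
  define B where "B = {(a, b). (\<Sum>i\<le>m. a i) = (\<Sum>i\<le>m. b i) \<and>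
     (\<Sum>i\<le>m. exponent m k i * a i) = (\<Sum>i\<le>m. exponent m k i * b i)}"
  define \<Phi>1 where "\<Phi>1 = (\<lambda>i (v :: complex vec). v $ i) ` {m<..n}"
  define \<Phi>2 where "\<Phi>2 = (\<lambda>(a, b) (v :: complex vec). (\<Prod>i\<le>m. v $ i ^ a i) - (\<Prod>i\<le>m. v $ i ^ b i)) ` B"
  have mono: "hform n (\<Sum>i\<le>m. a i) (\<lambda>v. \<Prod>i\<le>m. v $ i ^ a i)" for a
    using hform_prod[of "{..m}" n "\<lambda>i. a i * 1" "\<lambda>i v. v $ i ^ a i"] hform_power[OF hform_coord] m by simp
  have \<Phi>1: "\<Phi>1 \<subseteq> forms n"
    unfolding \<Phi>1_def forms_def using hform_coord by fastforce
  have \<Phi>2: "\<Phi>2 \<subseteq> forms n"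
  proof
    fix \<phi> assume "\<phi> \<in> \<Phi>2"
    then obtain a b where ab: "(\<Sum>i\<le>m. a i) = (\<Sum>i\<le>m. b i)"
        "\<phi> = (\<lambda>v. (\<Prod>i\<le>m. v $ i ^ a i) - (\<Prod>i\<le>m. v $ i ^ b i))"
      by (auto simp: \<Phi>2_def B_def)
    from hform_diff[OF mono[of a] mono[of b, folded ab(1)]]
    show "\<phi> \<in> forms n" unfolding ab(2) forms_def by blast
  qed
  have \<Phi>: "\<Phi>1 \<union> \<Phi>2 \<subseteq> forms n" using \<Phi>1 \<Phi>2 by blast
  have "monomial_map n m k ` CP 1 = zeros n (\<Phi>1 \<union> \<Phi>2)"
  proof (rule subset_CP_eqI)
    show "monomial_map n m k ` CP 1 \<subseteq> CP n"
      unfolding monomial_map_image[OF k] using proj_point_CP[OF monomial_vec_nonzero[OF k]] by blast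
    fix x assume x: "x \<in> coord_vecs n"
    show "proj_point x \<in> monomial_map n m k ` CP 1 \<longleftrightarrow> proj_point x \<in> zeros n (\<Phi>1 \<union> \<Phi>2)"
    proof
      assume "proj_point x \<in> monomial_map n m k ` CP 1"
      then obtain z w where zw: "z \<noteq> 0 \<or> w \<noteq> 0" "proj_point x = proj_point (monomial_vec n m k z w)"
        unfolding monomial_map_image[OF k] by blast
      have "\<forall>\<phi>\<in>\<Phi>1. \<phi> (monomial_vec n m k z w) = 0"
        by (auto simp: \<Phi>1_def monomial_vec_index[OF k])
      moreover have "\<forall>\<phi>\<in>\<Phi>2. \<phi> (monomial_vec n m k z w) = 0"
        by (auto simp: \<Phi>2_def B_def dest: monomial_curve_satisfies_binomials[OF k])
      ultimately have "\<forall>\<phi>\<in>\<Phi>1 \<union> \<Phi>2. \<phi> (monomial_vec n m k z w) = 0" by blast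
      then show "proj_point x \<in> zeros n (\<Phi>1 \<union> \<Phi>2)"
        unfolding zw(2) using proj_point_zeros[OF \<Phi> monomial_vec_nonzero[OF k zw(1)]] by simp
    next
      assume "proj_point x \<in> zeros n (\<Phi>1 \<union> \<Phi>2)"
      then have *: "\<forall>\<phi>\<in>\<Phi>1 \<union> \<Phi>2. \<phi> x = 0" using proj_point_zeros[OF \<Phi> x] by simp
      have "\<exists>c z w. c \<noteq> 0 \<and> (z \<noteq> 0 \<or> w \<noteq> 0) \<and> x = c \<cdot>\<^sub>v monomial_vec n m k z w"
      proof (rule binomials_cut_out_monomial_curve[OF k x])
        fix i assume "m < i" "i \<le> n"
        then show "x $ i = 0" using * by (auto simp: \<Phi>1_def)
      next
        fix a b assume "(\<Sum>i\<le>m. a i) = (\<Sum>i\<le>m. b i)"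
          "(\<Sum>i\<le>m. exponent m k i * a i) = (\<Sum>i\<le>m. exponent m k i * b i)"
        then have "(a, b) \<in> B" by (simp add: B_def)
        then have "(\<lambda>v :: complex vec. (\<Prod>i\<le>m. v $ i ^ a i) - (\<Prod>i\<le>m. v $ i ^ b i)) \<in> \<Phi>2"
          unfolding \<Phi>2_def by force
        from bspec[OF *, OF UnI2[OF this]]
        show "(\<Prod>i\<le>m. x $ i ^ a i) = (\<Prod>i\<le>m. x $ i ^ b i)" by simp
      qed
      then show "proj_point x \<in> monomial_map n m k ` CP 1"
        unfolding monomial_map_image[OF k] using proj_point_smult by blast
    qed
  qed (rule zeros_subset_CP)
  then show ?thesis using \<Phi> by (simp add: algebraic_zeros)
qed

lemma monomial_curve_irreducible:
  assumes k: "monomial_exponents n m k"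
  shows "irreducible_algebraic_set n (monomial_map n m k ` CP 1)"
  unfolding irreducible_algebraic_set_def
proof (intro conjI allI impI, goal_cases)
  case 1
  then show ?case by (rule monomial_curve_algebraic[OF k])
next
  case 2
  have "proj_point (monomial_vec n m k 1 1) \<in> monomial_map n m k ` CP 1"
    unfolding monomial_map_image[OF k] by (intro CollectI exI[of _ 1]) simp
  then show ?case by blast
next
  case (3 A B)
  then obtain \<Phi> \<Psi> where AB: "\<Phi> \<subseteq> forms n" "A = zeros n \<Phi>" "\<Psi> \<subseteq> forms n" "B = zeros n \<Psi>"
      "monomial_map n m k ` CP 1 = A \<union> B"
    by (auto simp: algebraic_set_iff_zeros)
  have "(\<forall>\<phi>\<in>\<Phi>. \<phi> (monomial_vec n m k t 1) = 0) \<or> (\<forall>\<psi>\<in>\<Psi>. \<psi> (monomial_vec n m k t 1) = 0)" for t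
  proof -
    have nz: "monomial_vec n m k t 1 \<in> coord_vecs n" using monomial_vec_nonzero[OF k] by simp
    have "proj_point (monomial_vec n m k t 1) \<in> A \<union> B"
      unfolding AB(5)[symmetric] monomial_map_image[OF k]
      by (intro CollectI exI[of _ t] exI[of _ 1]) simp
    then show ?thesis unfolding AB(2,4) using proj_point_zeros[OF AB(1) nz] proj_point_zeros[OF AB(3) nz] by blast
  qed
  then have "(\<forall>t. \<forall>\<phi>\<in>\<Phi>. \<phi> (monomial_vec n m k t 1) = 0) \<or> (\<forall>t. \<forall>\<psi>\<in>\<Psi>. \<psi> (monomial_vec n m k t 1) = 0)"
    by (intro poly_curve_in_one[OF AB(1,3) monomial_poly_curve(1)[OF k] infinite_UNIV_char_0])
  moreover have "monomial_map n m k ` CP 1 \<subseteq> zeros n \<Phi>"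
    if \<Phi>: "\<Phi> \<subseteq> forms n" "\<forall>t. \<forall>\<phi>\<in>\<Phi>. \<phi> (monomial_vec n m k t 1) = 0" for \<Phi>
  proof
    fix y assume "y \<in> monomial_map n m k ` CP 1"
    then obtain z w where zw: "z \<noteq> 0 \<or> w \<noteq> 0" "y = proj_point (monomial_vec n m k z w)"
      unfolding monomial_map_image[OF k] by blast
    have "\<phi> (monomial_vec n m k z w) = 0" if "\<phi> \<in> \<Phi>" for \<phi>
      using form_zero_on_monomial_curve[OF k _ infinite_UNIV_char_0 _ zw(1), of \<phi>] \<Phi> that by auto
    then show "y \<in> zeros n \<Phi>"
      unfolding zw(2) using proj_point_zeros[OF \<Phi>(1) monomial_vec_nonzero[OF k zw(1)]] by blast
  qed
  ultimately have "monomial_map n m k ` CP 1 \<subseteq> A \<or> monomial_map n m k ` CP 1 \<subseteq> B" using AB(1-4) by blast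
  then show ?case using AB(5) by blast
qed

section \<open>Projective changes of coordinates\<close>

definition lin_image :: "nat \<Rightarrow> complex mat \<Rightarrow> complex vec set set \<Rightarrow> complex vec set set" where
  "lin_image n T X = {proj_point (T *\<^sub>v x) | x. x \<in> coord_vecs n \<and> proj_point x \<in> X}"

definition inverse_mats :: "nat \<Rightarrow> complex mat \<Rightarrow> complex mat \<Rightarrow> bool" where
  "inverse_mats n T T' \<longleftrightarrow> T \<in> carrier_mat (Suc n) (Suc n) \<and> T' \<in> carrier_mat (Suc n) (Suc n) \<and>
     T * T' = 1\<^sub>m (Suc n) \<and> T' * T = 1\<^sub>m (Suc n)"

lemma inverse_mats_sym: "inverse_mats n T T' \<Longrightarrow> inverse_mats n T' T"
  by (auto simp: inverse_mats_def)

lemma inverse_mats_cancel: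
  "inverse_mats n T T' \<Longrightarrow> x \<in> carrier_vec (Suc n) \<Longrightarrow> T' *\<^sub>v (T *\<^sub>v x) = x"
  by (auto simp: inverse_mats_def intro: mult_mat_vec_inverse)

lemma inverse_mats_coord_vecs:
  assumes T: "inverse_mats n T T'" and x: "x \<in> coord_vecs n"
  shows "T *\<^sub>v x \<in> coord_vecs n"
proof -
  have xc: "x \<in> carrier_vec (Suc n)" "x \<noteq> 0\<^sub>v (Suc n)" using x by (auto simp: coord_vecs_def)
  have T': "T \<in> carrier_mat (Suc n) (Suc n)" "T' \<in> carrier_mat (Suc n) (Suc n)"
    using T by (auto simp: inverse_mats_def)
  have "T *\<^sub>v x \<noteq> 0\<^sub>v (Suc n)"
  proof
    assume "T *\<^sub>v x = 0\<^sub>v (Suc n)"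
    then have "x = T' *\<^sub>v 0\<^sub>v (Suc n)" using inverse_mats_cancel[OF T xc(1)] by simp
    also have "\<dots> = 0\<^sub>v (Suc n)" using T' by (intro eq_vecI) auto
    finally show False using xc by simp
  qed
  then show ?thesis using T' xc by (simp add: coord_vecs_def)
qed

lemma lin_image_proj_point:
  assumes T: "inverse_mats n T T'" and X: "X \<subseteq> CP n" and y: "y \<in> coord_vecs n"
  shows "proj_point y \<in> lin_image n T X \<longleftrightarrow> proj_point (T' *\<^sub>v y) \<in> X"
proof
  assume "proj_point y \<in> lin_image n T X"
  then obtain x where x: "x \<in> coord_vecs n" "proj_point x \<in> X" "proj_point y = proj_point (T *\<^sub>v x)"
    by (auto simp: lin_image_def)
  then obtain c where c: "c \<noteq> 0" "y = c \<cdot>\<^sub>v (T *\<^sub>v x)"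
    using self_mem_proj_point[of y] by (auto simp: mem_proj_point)
  have T': "T *\<^sub>v x \<in> carrier_vec (Suc n)" "T' \<in> carrier_mat (Suc n) (Suc n)"
    using inverse_mats_coord_vecs[OF T x(1)] T by (auto simp: coord_vecs_def inverse_mats_def)
  have "T' *\<^sub>v y = c \<cdot>\<^sub>v x"
    using c mult_mat_vec[OF T'(2,1)] inverse_mats_cancel[OF T] x(1) by (simp add: coord_vecs_def)
  then show "proj_point (T' *\<^sub>v y) \<in> X" using x c by (simp add: proj_point_smult)
next
  assume *: "proj_point (T' *\<^sub>v y) \<in> X"
  have "T *\<^sub>v (T' *\<^sub>v y) = y"
    using inverse_mats_cancel[OF inverse_mats_sym[OF T]] y by (simp add: coord_vecs_def)
  then show "proj_point y \<in> lin_image n T X"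
    unfolding lin_image_def using * inverse_mats_coord_vecs[OF inverse_mats_sym[OF T] y]
    by (intro CollectI exI[of _ "T' *\<^sub>v y"]) simp
qed

lemma lin_image_subset_CP: "inverse_mats n T T' \<Longrightarrow> lin_image n T X \<subseteq> CP n"
  unfolding lin_image_def using proj_point_CP inverse_mats_coord_vecs by blast

lemma lin_image_inverse:
  assumes T: "inverse_mats n T T'" and X: "X \<subseteq> CP n"
  shows "lin_image n T' (lin_image n T X) = X"
proof (rule subset_CP_eqI)
  note T' = inverse_mats_sym[OF T]
  show "lin_image n T' (lin_image n T X) \<subseteq> CP n" by (rule lin_image_subset_CP[OF T'])
  fix x assume x: "x \<in> coord_vecs n"
  have "T' *\<^sub>v (T *\<^sub>v x) = x" using inverse_mats_cancel[OF T] x by (simp add: coord_vecs_def)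
  then show "proj_point x \<in> lin_image n T' (lin_image n T X) \<longleftrightarrow> proj_point x \<in> X"
    using lin_image_proj_point[OF T' lin_image_subset_CP[OF T] x]
      lin_image_proj_point[OF T X inverse_mats_coord_vecs[OF T x]] by simp
qed (rule X)

lemma lin_image_algebraic:
  assumes T: "inverse_mats n T T'" and X: "algebraic_set n X"
  shows "algebraic_set n (lin_image n T X)"
proof -
  obtain \<Phi> where \<Phi>: "\<Phi> \<subseteq> forms n" "X = zeros n \<Phi>" using X by (auto simp: algebraic_set_iff_zeros)
  have T': "T' \<in> carrier_mat (Suc n) (Suc n)" using T by (simp add: inverse_mats_def)
  define \<Psi> where "\<Psi> = (\<lambda>\<phi> v. \<phi> (T' *\<^sub>v v)) ` \<Phi>"
  have \<Psi>: "\<Psi> \<subseteq> forms n"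
  proof
    fix \<psi> assume "\<psi> \<in> \<Psi>"
    then obtain \<phi> where \<psi>: "\<phi> \<in> \<Phi>" "\<psi> = (\<lambda>v. \<phi> (T' *\<^sub>v v))" unfolding \<Psi>_def by auto
    then obtain d where "hform n d \<phi>" using \<Phi>(1) unfolding forms_def by blast
    from hform_linear_subst[OF this T'] show "\<psi> \<in> forms n" unfolding \<psi>(2) forms_def by blast
  qed
  have "lin_image n T X = zeros n \<Psi>"
  proof (rule subset_CP_eqI)
    fix x assume x: "x \<in> coord_vecs n"
    show "proj_point x \<in> lin_image n T X \<longleftrightarrow> proj_point x \<in> zeros n \<Psi>"
      using lin_image_proj_point[OF T algebraic_set_subset_CP[OF X] x]
        proj_point_zeros[OF \<Psi> x] proj_point_zeros[OF \<Phi>(1) inverse_mats_coord_vecs[OF inverse_mats_sym[OF T] x]]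
      by (simp add: \<Phi>(2)[symmetric]) (simp add: \<Psi>_def)
  qed (use lin_image_subset_CP[OF T] zeros_subset_CP in auto)
  then show ?thesis using \<Psi> by (simp add: algebraic_zeros)
qed

lemma lin_image_Un: "lin_image n T (A \<union> B) = lin_image n T A \<union> lin_image n T B"
  unfolding lin_image_def by blast

lemma lin_image_mono: "A \<subseteq> B \<Longrightarrow> lin_image n T A \<subseteq> lin_image n T B"
  unfolding lin_image_def by blast

lemma lin_image_irreducible:
  assumes T: "inverse_mats n T T'" and X: "irreducible_algebraic_set n X"
  shows "irreducible_algebraic_set n (lin_image n T X)"
  unfolding irreducible_algebraic_set_def
proof (intro conjI allI impI, goal_cases)
  case 1
  then show ?case using X lin_image_algebraic[OF T] by (simp add: irreducible_algebraic_set_def)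
next
  case 2
  have XCP: "X \<subseteq> CP n" and "X \<noteq> {}"
    using X algebraic_set_subset_CP unfolding irreducible_algebraic_set_def by simp_all
  then obtain q where q: "q \<in> X" by blast
  then obtain x where "x \<in> coord_vecs n" "q = proj_point x" using XCP CP_iff by blast
  then have "proj_point (T *\<^sub>v x) \<in> lin_image n T X" using q unfolding lin_image_def by blast
  then show ?case by blast
next
  case (3 A B)
  note T' = inverse_mats_sym[OF T]
  have XCP: "X \<subseteq> CP n"
    using X algebraic_set_subset_CP by (auto simp: irreducible_algebraic_set_def)
  have CP: "A \<subseteq> CP n" "B \<subseteq> CP n" using 3 algebraic_set_subset_CP by auto
  have "X = lin_image n T' A \<union> lin_image n T' B"
    using lin_image_inverse[OF T XCP] 3 by (simp add: lin_image_Un)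
  then have "X = lin_image n T' A \<or> X = lin_image n T' B"
    using X 3 lin_image_algebraic[OF T'] unfolding irreducible_algebraic_set_def by blast
  then show ?case using lin_image_inverse[OF T' CP(1)] lin_image_inverse[OF T' CP(2)] by auto
qed

text \<open>Let \<open>X\<close> contain the curve \<open>s \<mapsto> \<Sum>\<^sub>j s\<^bsup>e j\<^esup> u\<^sub>j\<close>. In coordinates in which the \<open>u\<^sub>j\<close> are unit vectors, and
  after division by \<open>s\<^bsup>e m\<^esup>\<close> and the substitution of \<open>t\<close> for \<open>s\<^sup>g\<close>, where \<open>g\<close> is the greatest common
  divisor of the numbers \<open>e j - e m\<close>, it is the affine part of a monomial curve with coprime
  exponents. The full monomial curve then also lies in (the image of) \<open>X\<close>, is closed and irreducible
  and has more than one point. As the dimension is one, it is the whole image.\<close>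

lemma curve_in_indep_directions_is_monomial:
  fixes u :: "nat \<Rightarrow> complex vec" and e :: "nat \<Rightarrow> nat"
  assumes dim: "algebraic_dim n S = 1" and X: "irreducible_algebraic_set n X" "X \<subseteq> S"
    and u: "indep_family (Suc n) (Suc m) u" and m: "1 \<le> m"
    and e: "\<And>i j. i < j \<Longrightarrow> j \<le> m \<Longrightarrow> e j < e i"
    and curve: "\<And>s. s \<noteq> 0 \<Longrightarrow> vec (Suc n) (\<lambda>i. \<Sum>j\<le>m. s ^ e j * u j $ i) \<in> \<Union>X"
  shows "\<exists>T T' k. inverse_mats n T T' \<and> monomial_exponents n m k \<and>
    lin_image n T X = monomial_map n m k ` CP 1"
proof -
  have mn: "m \<le> n" using indep_family_le[OF u] by simp
  obtain T T' where T: "inverse_mats n T T'" and Tu: "\<And>j. j \<le> m \<Longrightarrow> T *\<^sub>v u j = unit_vec (Suc n) j"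
    using indep_family_coordinates[OF u] unfolding inverse_mats_def less_Suc_eq_le by blast
  have Tc: "T \<in> carrier_mat (Suc n) (Suc n)" "T' \<in> carrier_mat (Suc n) (Suc n)"
    using T by (auto simp: inverse_mats_def)
  have uc: "u j \<in> carrier_vec (Suc n)" if "j \<le> m" for j
    using u that by (auto simp: indep_family_def)
  define g where "g = Gcd ((\<lambda>j. e j - e m) ` {..<m})"
  define k where "k i = (e (i - 1) - e m) div g" for i
  have em: "e m < e j" if "j < m" for j using e that by simp
  have "e 0 - e m \<in> (\<lambda>j. e j - e m) ` {..<m}" using m by auto
  then have "g dvd e 0 - e m" unfolding g_def by (rule Gcd_dvd)
  then have g0: "g > 0" using em[of 0] m by (intro Nat.gr0I) auto
  have kg: "g * k (Suc j) = e j - e m" if "j < m" for j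
    unfolding k_def using that by (auto simp: g_def intro!: Gcd_dvd dvd_mult_div_cancel)
  have "g = Gcd ((*) g ` (\<lambda>j. k (Suc j)) ` {..<m})"
    unfolding image_image g_def[symmetric] using kg
    by (subst g_def) (intro arg_cong[of _ _ Gcd] image_cong, auto)
  also have "\<dots> = g * Gcd ((\<lambda>j. k (Suc j)) ` {..<m})" by (simp add: Gcd_mult)
  finally have "Gcd ((\<lambda>j. k (Suc j)) ` {..<m}) = 1" using g0 by simp
  moreover have "(\<lambda>j. k (Suc j)) ` {..<m} = k ` Suc ` {..<m}" by (simp add: image_image)
  ultimately have gcd1: "Gcd (k ` {1..m}) = 1" by (simp add: image_Suc_lessThan)
  have less_k: "k (Suc j) < k (Suc i)" if "i < j" "j < m" for i j
  proof -
    have "g * k (Suc j) < g * k (Suc i)" using kg that e[of i j] em[of j] by simp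
    then show ?thesis using g0 by simp
  qed
  have k_pos: "1 \<le> k (Suc j)" if "j < m" for j
    using kg[OF that] em[OF that] by (cases "k (Suc j)") auto
  have k: "monomial_exponents n m k"
    unfolding monomial_exponents_def
  proof (intro conjI ballI)
    show "1 \<le> k m" using k_pos[of "m - 1"] m by simp
    fix i assume "i \<in> {1..<m}"
    then show "k (Suc i) < k i" using less_k[of "i - 1" i] by (auto simp: Suc_le_eq)
  qed (use m mn gcd1 in auto)
  have ge: "e j = g * exponent m k j + e m" if "j \<le> m" for j
    using kg[of j] em[of j] that by (cases "j = m") (auto simp: exponent_def)
  have T_curve: "T *\<^sub>v vec (Suc n) (\<lambda>i. \<Sum>j\<le>m. s ^ e j * u j $ i) =
      s ^ e m \<cdot>\<^sub>v monomial_vec n m k (s ^ g) 1" for s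
  proof -
    have "T *\<^sub>v vec (Suc n) (\<lambda>i. \<Sum>j\<le>m. s ^ e j * u j $ i) =
        vec (Suc n) (\<lambda>i. \<Sum>j\<le>m. s ^ e j * unit_vec (Suc n) j $ i)"
      using mult_mat_vec_sum[OF Tc(1), of "{..m}" u "\<lambda>j. s ^ e j"] uc Tu by simp
    also have "\<dots> = s ^ e m \<cdot>\<^sub>v monomial_vec n m k (s ^ g) 1"
    proof (rule eq_vecI)
      fix i assume "i < dim_vec (s ^ e m \<cdot>\<^sub>v monomial_vec n m k (s ^ g) 1)"
      then have i: "i \<le> n" by (simp add: monomial_vec_def)
      have "(\<Sum>j\<le>m. s ^ e j * unit_vec (Suc n) j $ i) = (\<Sum>j\<le>m. if j = i then s ^ e i else 0)"
        using i mn by (intro sum.cong refl) auto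
      also have "\<dots> = (if i \<le> m then s ^ e i else 0)" by simp
      finally show "vec (Suc n) (\<lambda>i. \<Sum>j\<le>m. s ^ e j * unit_vec (Suc n) j $ i) $ i =
          (s ^ e m \<cdot>\<^sub>v monomial_vec n m k (s ^ g) 1) $ i"
        using i monomial_vec_carrier[of n m k "s ^ g" 1] ge[of i]
        by (auto simp: monomial_vec_index[OF k] power_add power_mult)
    qed (simp add: monomial_vec_def)
    finally show ?thesis .
  qed
  have algX: "algebraic_set n X" and XCP: "X \<subseteq> CP n"
    using X algebraic_set_subset_CP by (auto simp: irreducible_algebraic_set_def)
  let ?Y = "lin_image n T X"
  have Yalg: "algebraic_set n ?Y" by (rule lin_image_algebraic[OF T algX])
  then obtain \<Phi> where \<Phi>: "\<Phi> \<subseteq> forms n" "?Y = zeros n \<Phi>" by (auto simp: algebraic_set_iff_zeros)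
  have on_Y: "proj_point (monomial_vec n m k t 1) \<in> ?Y" if "t \<noteq> 0" for t
  proof -
    define s where "s = rcis (root g (cmod t)) (Arg t / g)"
    have s: "s ^ g = t" using g0 by (simp add: s_def DeMoivre2 rcis_cmod_Arg)
    then have "s \<noteq> 0" using that g0 by auto
    let ?v = "vec (Suc n) (\<lambda>i. \<Sum>j\<le>m. s ^ e j * u j $ i)"
    have v: "?v \<in> coord_vecs n" "proj_point ?v \<in> X"
      using curve[OF \<open>s \<noteq> 0\<close>] Union_iff_proj_point[OF XCP] by auto
    then have "proj_point (T *\<^sub>v ?v) \<in> ?Y" unfolding lin_image_def by blast
    then show ?thesis using \<open>s \<noteq> 0\<close> s by (simp add: T_curve proj_point_smult)
  qed
  have "monomial_map n m k ` CP 1 \<subseteq> ?Y"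
  proof
    fix y assume "y \<in> monomial_map n m k ` CP 1"
    then obtain z w where zw: "z \<noteq> 0 \<or> w \<noteq> 0" "y = proj_point (monomial_vec n m k z w)"
      unfolding monomial_map_image[OF k] by blast
    have "\<phi> (monomial_vec n m k z w) = 0" if "\<phi> \<in> \<Phi>" for \<phi>
    proof (rule form_zero_on_monomial_curve[OF k])
      show "\<phi> \<in> forms n" using that \<Phi> by blast
      show "infinite (UNIV - {0 :: complex})" by (simp add: infinite_UNIV_char_0)
      fix t :: complex assume "t \<in> UNIV - {0}"
      then show "\<phi> (monomial_vec n m k t 1) = 0"
        using on_Y[of t] proj_point_zeros[OF \<Phi>(1) monomial_vec_nonzero[OF k, of t 1]] that \<Phi>(2) by auto
    qed (rule zw)
    then show "y \<in> ?Y"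
      unfolding zw(2) \<Phi>(2) using proj_point_zeros[OF \<Phi>(1) monomial_vec_nonzero[OF k zw(1)]] by blast
  qed
  then have sub: "lin_image n T' (monomial_map n m k ` CP 1) \<subseteq> X"
    using lin_image_mono lin_image_inverse[OF T XCP] by metis
  let ?M = "monomial_map n m k ` CP 1"
  have MCP: "?M \<subseteq> CP n" using algebraic_set_subset_CP[OF monomial_curve_algebraic[OF k]] .
  define p where "p z w = proj_point (T' *\<^sub>v monomial_vec n m k z w)" for z w
  have p_mem: "p z w \<in> lin_image n T' ?M" if "z \<noteq> 0 \<or> w \<noteq> 0" for z w
  proof -
    have "proj_point (monomial_vec n m k z w) \<in> ?M"
      unfolding monomial_map_image[OF k] using that by blast
    then show ?thesis unfolding lin_image_def p_def using monomial_vec_nonzero[OF k that] by blast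
  qed
  \<comment> \<open>the points \<open>w = 0\<close> and \<open>z = 0\<close> differ in the first coordinate, as \<open>k 1 > 0\<close>\<close>
  have "p 1 0 \<noteq> p 0 1"
  proof
    assume "p 1 0 = p 0 1"
    then have "T' *\<^sub>v monomial_vec n m k 1 0 \<in> proj_point (T' *\<^sub>v monomial_vec n m k 0 1)"
      using self_mem_proj_point unfolding p_def by metis
    then obtain c where "T' *\<^sub>v monomial_vec n m k 1 0 = c \<cdot>\<^sub>v (T' *\<^sub>v monomial_vec n m k 0 1)"
      unfolding mem_proj_point by blast
    then have "T' *\<^sub>v monomial_vec n m k 1 0 = T' *\<^sub>v (c \<cdot>\<^sub>v monomial_vec n m k 0 1)"
      using mult_mat_vec[OF Tc(2) monomial_vec_carrier] by simp
    then have "monomial_vec n m k 1 0 = c \<cdot>\<^sub>v monomial_vec n m k 0 1"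
      using inverse_mats_cancel[OF inverse_mats_sym[OF T]] monomial_vec_carrier smult_carrier_vec by metis
    then have "monomial_vec n m k 1 0 $ 0 = (c \<cdot>\<^sub>v monomial_vec n m k 0 1) $ 0" by simp
    then show False
      using m k_pos[of 0] monomial_vec_carrier[of n m k 0 1]
      by (simp add: monomial_vec_index[OF k] exponent_def zero_power)
  qed
  then have "lin_image n T' ?M = X"
    using no_chain_of_length_2[OF dim X(1) lin_image_irreducible[OF inverse_mats_sym[OF T] monomial_curve_irreducible[OF k]]
        sub X(2) p_mem[of 1 0] p_mem[of 0 1]] by simp
  then have "?Y = ?M" using lin_image_inverse[OF inverse_mats_sym[OF T] MCP] by simp
  then show ?thesis using T k by blast
qed

section \<open>The projective linear group\<close>

text \<open>The coset of \<open>A\<close> modulo the scalar matrices (\<open>scalar_mats_coset\<close>).\<close>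

definition mat_class :: "complex mat \<Rightarrow> complex mat set" where
  "mat_class A = {c \<cdot>\<^sub>m A | c. c \<noteq> 0}"

lemma GL_simps:
  "A \<otimes>\<^bsub>GL n\<^esub> B = A * B" "\<one>\<^bsub>GL n\<^esub> = 1\<^sub>m (Suc n)"
  by (auto simp: GL_def units_of_mult units_of_one ring_mat_simps)

lemma GL_carrier: "A \<in> carrier (GL n) \<longleftrightarrow> (\<exists>A'. inverse_mats n A A')"
  by (auto simp: GL_def units_of_carrier Units_def ring_mat_simps inverse_mats_def)

lemma group_GL: "group (GL n)"
proof -
  interpret ring "ring_mat TYPE(complex) (Suc n) ()" by (rule ring_mat)
  show ?thesis unfolding GL_def by (rule units_group)
qed

lemma smult_smult_mat: "c \<cdot>\<^sub>m (d \<cdot>\<^sub>m A) = (c * d) \<cdot>\<^sub>m (A :: complex mat)"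
  by (rule eq_matI) auto

lemma one_smult_mat: "1 \<cdot>\<^sub>m A = (A :: complex mat)"
  by (rule eq_matI) auto

lemma smult_mats:
  assumes "A \<in> carrier_mat N N" "B \<in> carrier_mat N N"
  shows "(c \<cdot>\<^sub>m A) * (d \<cdot>\<^sub>m B) = (c * d) \<cdot>\<^sub>m (A * (B :: complex mat))"
  using mult_smult_assoc_mat[of A N N "d \<cdot>\<^sub>m B" N c] mult_smult_distrib[of A N N B N d] assms
  by (simp add: smult_smult_mat)

lemma inverse_mats_smult:
  assumes "inverse_mats n A A'" "c \<noteq> 0"
  shows "inverse_mats n (c \<cdot>\<^sub>m A) (inverse c \<cdot>\<^sub>m A')"
  using assms by (auto simp: inverse_mats_def smult_mats one_smult_mat)

lemma smult_one_mat_mult: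
  assumes "A \<in> carrier_mat N N"
  shows "(c \<cdot>\<^sub>m 1\<^sub>m N) * A = c \<cdot>\<^sub>m (A :: complex mat)" "A * (c \<cdot>\<^sub>m 1\<^sub>m N) = c \<cdot>\<^sub>m A"
  using mult_smult_assoc_mat[of "1\<^sub>m N" N N A N c] mult_smult_distrib[of A N N "1\<^sub>m N" N c] assms
  by auto

lemma scalar_mats_coset:
  assumes "A \<in> carrier_mat (Suc n) (Suc n)"
  shows "scalar_mats n #>\<^bsub>GL n\<^esub> A = mat_class A" "A <#\<^bsub>GL n\<^esub> scalar_mats n = mat_class A"
  using smult_one_mat_mult[OF assms]
  by (auto simp: r_coset_def l_coset_def scalar_mats_def mat_class_def GL_simps)

lemma inverse_mats_one: "inverse_mats n (1\<^sub>m (Suc n)) (1\<^sub>m (Suc n))"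
  by (simp add: inverse_mats_def)

lemma normal_scalar_mats: "scalar_mats n \<lhd> GL n"
proof -
  interpret G: group "GL n" by (rule group_GL)
  have sc: "scalar_mats n = mat_class (1\<^sub>m (Suc n))" by (simp add: scalar_mats_def mat_class_def)
  have carr: "scalar_mats n \<subseteq> carrier (GL n)"
    unfolding sc mat_class_def using inverse_mats_smult[OF inverse_mats_one] GL_carrier by blast
  have "subgroup (scalar_mats n) (GL n)"
  proof (rule G.subgroupI[OF carr])
    show "scalar_mats n \<noteq> {}" unfolding scalar_mats_def using one_neq_zero[where 'a = complex] by blast
    fix A assume A: "A \<in> scalar_mats n"
    then obtain c where c: "c \<noteq> 0" "A = c \<cdot>\<^sub>m 1\<^sub>m (Suc n)" by (auto simp: scalar_mats_def)
    let ?B = "inverse c \<cdot>\<^sub>m 1\<^sub>m (Suc n)"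
    have B: "?B \<in> scalar_mats n" using c by (auto simp: scalar_mats_def)
    moreover have "?B \<otimes>\<^bsub>GL n\<^esub> A = \<one>\<^bsub>GL n\<^esub>"
      using c by (simp add: GL_simps smult_mats[of _ "Suc n"] one_smult_mat)
    then have "inv\<^bsub>GL n\<^esub> A = ?B" using carr A B by (intro G.inv_equality) auto
    ultimately show "inv\<^bsub>GL n\<^esub> A \<in> scalar_mats n" by simp
    fix B assume "B \<in> scalar_mats n"
    then obtain d where d: "d \<noteq> 0" "B = d \<cdot>\<^sub>m 1\<^sub>m (Suc n)" by (auto simp: scalar_mats_def)
    then show "A \<otimes>\<^bsub>GL n\<^esub> B \<in> scalar_mats n"
      using c d by (auto simp: GL_simps smult_mats[of _ "Suc n"] scalar_mats_def intro!: exI[of _ "c * d"])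
  qed
  then show ?thesis
    by (rule G.normalI) (auto simp: GL_carrier inverse_mats_def scalar_mats_coset)
qed

lemma group_PGL: "group (PGL n)"
  unfolding PGL_def using normal.factorgroup_is_group[OF normal_scalar_mats] .

lemma PGL_carrier: "g \<in> carrier (PGL n) \<longleftrightarrow> (\<exists>A A'. inverse_mats n A A' \<and> g = mat_class A)"
proof -
  have "carrier (PGL n) = {mat_class A | A. A \<in> carrier (GL n)}"
  proof -
    have "scalar_mats n #>\<^bsub>GL n\<^esub> A = mat_class A" if "A \<in> carrier (GL n)" for A
      using that by (auto simp: GL_carrier inverse_mats_def scalar_mats_coset)
    then show ?thesis unfolding PGL_def FactGroup_def RCOSETS_def by auto
  qed
  then show ?thesis by (auto simp: GL_carrier)
qed

lemma mat_class_mult: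
  assumes "A \<in> carrier_mat (Suc n) (Suc n)" "B \<in> carrier_mat (Suc n) (Suc n)"
  shows "mat_class A \<otimes>\<^bsub>PGL n\<^esub> mat_class B = mat_class (A * B)"
proof -
  have "(\<exists>h\<in>mat_class A. \<exists>k\<in>mat_class B. x = h * k) \<longleftrightarrow> x \<in> mat_class (A * B)" for x
  proof
    assume "\<exists>h\<in>mat_class A. \<exists>k\<in>mat_class B. x = h * k"
    then obtain c d where "c \<noteq> 0" "d \<noteq> 0" "x = (c \<cdot>\<^sub>m A) * (d \<cdot>\<^sub>m B)" by (auto simp: mat_class_def)
    then show "x \<in> mat_class (A * B)"
      using smult_mats[OF assms] by (auto simp: mat_class_def intro!: exI[of _ "c * d"])
  next
    assume "x \<in> mat_class (A * B)"
    then obtain c where c: "c \<noteq> 0" "x = c \<cdot>\<^sub>m (A * B)" by (auto simp: mat_class_def)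
    have "x = (c \<cdot>\<^sub>m A) * (1 \<cdot>\<^sub>m B)" using smult_mats[OF assms, of c 1] c by simp
    moreover have "c \<cdot>\<^sub>m A \<in> mat_class A" "1 \<cdot>\<^sub>m B \<in> mat_class B"
      using c unfolding mat_class_def by force+
    ultimately show "\<exists>h\<in>mat_class A. \<exists>k\<in>mat_class B. x = h * k" by blast
  qed
  then show ?thesis
    unfolding PGL_def FactGroup_def by (auto simp: set_mult_def GL_simps)
qed

lemma PGL_one: "\<one>\<^bsub>PGL n\<^esub> = mat_class (1\<^sub>m (Suc n))"
  by (simp add: PGL_def FactGroup_def scalar_mats_def mat_class_def)

lemma mat_class_pow:
  assumes "A \<in> carrier_mat (Suc n) (Suc n)"
  shows "mat_class A [^]\<^bsub>PGL n\<^esub> (k::nat) = mat_class (A ^\<^sub>m k)"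
proof (induction k)
  case 0
  interpret group "PGL n" by (rule group_PGL)
  show ?case using assms by (simp add: PGL_one)
next
  case (Suc k)
  interpret group "PGL n" by (rule group_PGL)
  show ?case using Suc assms by (simp add: mat_class_mult)
qed

lemma proj_act_mat_class:
  assumes A: "A \<in> carrier_mat (Suc n) (Suc n)" and x: "x \<in> carrier_vec (Suc n)"
  shows "proj_act (mat_class A) (proj_point x) = proj_point (A *\<^sub>v x)"
proof -
  have eq: "(c \<cdot>\<^sub>m A) *\<^sub>v (d \<cdot>\<^sub>v x) = (c * d) \<cdot>\<^sub>v (A *\<^sub>v x)" for c d
  proof (rule eq_vecI)
    fix i assume "i < dim_vec ((c * d) \<cdot>\<^sub>v (A *\<^sub>v x))"
    then have i: "i < Suc n" using A by simp
    have cA: "c \<cdot>\<^sub>m A \<in> carrier_mat (Suc n) (Suc n)" and dx: "d \<cdot>\<^sub>v x \<in> carrier_vec (Suc n)" using A x by auto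
    have "((c \<cdot>\<^sub>m A) *\<^sub>v (d \<cdot>\<^sub>v x)) $ i = (\<Sum>j<Suc n. c * d * (A $$ (i, j) * x $ j))"
      unfolding mult_mat_vec_index[OF cA dx i] using A x i by (intro sum.cong refl) auto
    also have "\<dots> = c * d * (A *\<^sub>v x) $ i"
      unfolding mult_mat_vec_index[OF A x i] sum_distrib_left ..
    finally show "((c \<cdot>\<^sub>m A) *\<^sub>v (d \<cdot>\<^sub>v x)) $ i = ((c * d) \<cdot>\<^sub>v (A *\<^sub>v x)) $ i"
      using A i by simp
  qed (use A in simp)
  show ?thesis
  proof (intro Set.set_eqI iffI)
    fix y assume "y \<in> proj_act (mat_class A) (proj_point x)"
    then obtain c d where "c \<noteq> 0" "d \<noteq> 0" "y = (c \<cdot>\<^sub>m A) *\<^sub>v (d \<cdot>\<^sub>v x)"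
      by (auto simp: proj_act_def mat_class_def mem_proj_point)
    then show "y \<in> proj_point (A *\<^sub>v x)"
      unfolding eq mem_proj_point by (intro exI[of _ "c * d"]) simp
  next
    fix y assume "y \<in> proj_point (A *\<^sub>v x)"
    then obtain c where c: "c \<noteq> 0" "y = c \<cdot>\<^sub>v (A *\<^sub>v x)" by (auto simp: mem_proj_point)
    then have "y = (c \<cdot>\<^sub>m A) *\<^sub>v (1 \<cdot>\<^sub>v x)" by (simp only: eq mult_1_right)
    moreover have "c \<cdot>\<^sub>m A \<in> mat_class A" "1 \<cdot>\<^sub>v x \<in> proj_point x"
      using c self_mem_proj_point by (auto simp: mat_class_def)
    ultimately show "y \<in> proj_act (mat_class A) (proj_point x)"
      unfolding proj_act_def by blast
  qed
qed

lemma proj_act_image_eq_lin_image: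
  assumes "A \<in> carrier_mat (Suc n) (Suc n)" "X \<subseteq> CP n"
  shows "proj_act (mat_class A) ` X = lin_image n A X"
proof (rule Set.set_eqI, rule iffI)
  fix y assume "y \<in> proj_act (mat_class A) ` X"
  then obtain p where p: "p \<in> X" "y = proj_act (mat_class A) p" by blast
  then obtain x where x: "x \<in> coord_vecs n" "p = proj_point x" using assms(2) CP_iff by blast
  then have "y = proj_point (A *\<^sub>v x)"
    using p proj_act_mat_class[OF assms(1)] by (simp add: coord_vecs_def)
  then show "y \<in> lin_image n A X" using x p unfolding lin_image_def by blast
next
  fix y assume "y \<in> lin_image n A X"
  then obtain x where x: "x \<in> coord_vecs n" "proj_point x \<in> X" "y = proj_point (A *\<^sub>v x)"
    unfolding lin_image_def by blast
  then have "y = proj_act (mat_class A) (proj_point x)"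
    using proj_act_mat_class[OF assms(1)] by (simp add: coord_vecs_def)
  then show "y \<in> proj_act (mat_class A) ` X" using x by blast
qed

lemma proj_act_mult:
  assumes "g \<in> carrier (PGL n)" "h \<in> carrier (PGL n)" "p \<in> CP n"
  shows "proj_act (g \<otimes>\<^bsub>PGL n\<^esub> h) p = proj_act g (proj_act h p)" "proj_act h p \<in> CP n"
proof -
  obtain A A' where A: "inverse_mats n A A'" "g = mat_class A" using assms by (auto simp: PGL_carrier)
  obtain B B' where B: "inverse_mats n B B'" "h = mat_class B" using assms by (auto simp: PGL_carrier)
  obtain x where x: "x \<in> coord_vecs n" "p = proj_point x" using assms(3) CP_iff by blast
  have c: "A \<in> carrier_mat (Suc n) (Suc n)" "B \<in> carrier_mat (Suc n) (Suc n)" "x \<in> carrier_vec (Suc n)"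
    "B *\<^sub>v x \<in> coord_vecs n"
    using A B x inverse_mats_coord_vecs[OF B(1)] by (auto simp: inverse_mats_def coord_vecs_def)
  have h: "proj_act h p = proj_point (B *\<^sub>v x)" using c x B proj_act_mat_class by simp
  then show "proj_act h p \<in> CP n" using c(4) proj_point_CP by simp
  show "proj_act (g \<otimes>\<^bsub>PGL n\<^esub> h) p = proj_act g (proj_act h p)"
  proof -
    have "B *\<^sub>v x \<in> carrier_vec (Suc n)" using c(4) by (simp add: coord_vecs_def)
    then have "proj_act g (proj_act h p) = proj_point (A *\<^sub>v (B *\<^sub>v x))"
      unfolding h A(2) by (rule proj_act_mat_class[OF c(1)])
    also have "\<dots> = proj_point ((A * B) *\<^sub>v x)" using assoc_mult_mat_vec[OF c(1,2,3)] by simp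
    also have "\<dots> = proj_act (mat_class (A * B)) p"
      unfolding x(2) using proj_act_mat_class[OF mult_carrier_mat[OF c(1,2)] c(3)] by simp
    finally show ?thesis unfolding A(2) B(2) mat_class_mult[OF c(1,2)] by simp
  qed
qed

lemma proj_act_one: "p \<in> CP n \<Longrightarrow> proj_act \<one>\<^bsub>PGL n\<^esub> p = p"
  using proj_act_mat_class[of "1\<^sub>m (Suc n)" n] by (auto simp: PGL_one CP_iff coord_vecs_def)

text \<open>The cosets of the stabilizer are represented by \<open>g\<^sup>r\<close> with \<open>r < M\<close>.\<close>

lemma pointwise_stabilizer_finite_index:
  assumes g: "g \<in> carrier (PGL n)" and G: "G = generate (PGL n) {g}" and L: "L \<subseteq> CP n"
    and M: "M > 0" and fixed: "\<And>p. p \<in> L \<Longrightarrow> proj_act (g [^]\<^bsub>PGL n\<^esub> (M::nat)) p = p"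
  defines "H \<equiv> {h \<in> G. \<forall>p\<in>L. proj_act h p = p}"
  shows "subgroup H (PGL n\<lparr>carrier := G\<rparr>)" "finite (rcosets\<^bsub>PGL n\<lparr>carrier := G\<rparr>\<^esub> H)"
proof -
  interpret group "PGL n" by (rule group_PGL)
  have subG: "subgroup G (PGL n)" unfolding G by (rule generate_is_subgroup) (use g in auto)
  have GC: "G \<subseteq> carrier (PGL n)" using subG by (rule subgroup.subset)
  have HC: "H \<subseteq> carrier (PGL n)" using GC by (auto simp: H_def)
  have "subgroup H (PGL n)"
  proof (rule subgroupI[OF HC])
    show "H \<noteq> {}" using subgroup.one_closed[OF subG] proj_act_one L by (auto simp: H_def)
    fix a assume a: "a \<in> H"
    have "proj_act (inv\<^bsub>PGL n\<^esub> a) p = p" if "p \<in> L" for p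
    proof -
      have pa: "proj_act a p = p" "p \<in> CP n" using a that L by (auto simp: H_def)
      have "proj_act (inv\<^bsub>PGL n\<^esub> a) (proj_act a p) = proj_act \<one>\<^bsub>PGL n\<^esub> p"
        using proj_act_mult(1)[of "inv\<^bsub>PGL n\<^esub> a" n a p] a HC pa(2) by (simp add: subset_iff)
      then show ?thesis using pa proj_act_one by simp
    qed
    then show "inv\<^bsub>PGL n\<^esub> a \<in> H" using a subgroup.m_inv_closed[OF subG] by (simp add: H_def)
    fix b assume b: "b \<in> H"
    have "proj_act (a \<otimes>\<^bsub>PGL n\<^esub> b) p = p" if "p \<in> L" for p
      using proj_act_mult(1)[of a n b p] a b HC L that by (auto simp: H_def subset_iff)
    then show "a \<otimes>\<^bsub>PGL n\<^esub> b \<in> H" using a b subgroup.m_closed[OF subG] by (simp add: H_def)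
  qed
  note subH = this
  show "subgroup H (PGL n\<lparr>carrier := G\<rparr>)"
    by (rule subgroup_incl[OF subH subG]) (auto simp: H_def)
  have Gpow: "G = {g [^]\<^bsub>PGL n\<^esub> (k::int) | k. k \<in> UNIV}" unfolding G by (rule generate_pow[OF g])
  have gM: "g [^]\<^bsub>PGL n\<^esub> int M \<in> H"
  proof -
    have "g [^]\<^bsub>PGL n\<^esub> int M \<in> G" unfolding Gpow by blast
    then show ?thesis using fixed by (simp add: H_def int_pow_int)
  qed
  have "(rcosets\<^bsub>PGL n\<lparr>carrier := G\<rparr>\<^esub> H) \<subseteq> (\<lambda>r. H #>\<^bsub>PGL n\<^esub> (g [^]\<^bsub>PGL n\<^esub> int r)) ` {..<M}"
  proof
    fix R assume "R \<in> rcosets\<^bsub>PGL n\<lparr>carrier := G\<rparr>\<^esub> H"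
    then obtain k :: int where R: "R = H #>\<^bsub>PGL n\<^esub> (g [^]\<^bsub>PGL n\<^esub> k)"
      by (auto simp: RCOSETS_def Gpow)
    define r where "r = nat (k mod int M)"
    have k: "k = int M * (k div int M) + int r" "r < M" using M by (auto simp: r_def nat_less_iff)
    have "g [^]\<^bsub>PGL n\<^esub> k = g [^]\<^bsub>PGL n\<^esub> (int M * (k div int M)) \<otimes>\<^bsub>PGL n\<^esub> g [^]\<^bsub>PGL n\<^esub> int r"
      using int_pow_mult[OF g, of "int M * (k div int M)" "int r"] k(1) by simp
    moreover have "g [^]\<^bsub>PGL n\<^esub> (int M * (k div int M)) \<in> H"
      unfolding int_pow_pow[OF g, symmetric] by (rule subgroup_int_pow_closed[OF subH gM])
    ultimately have "R = H #>\<^bsub>PGL n\<^esub> (g [^]\<^bsub>PGL n\<^esub> int r)"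
      unfolding R using coset_mult_assoc[OF HC] coset_join2[OF _ subH] HC g
      by (metis int_pow_closed subsetD)
    then show "R \<in> (\<lambda>r. H #>\<^bsub>PGL n\<^esub> (g [^]\<^bsub>PGL n\<^esub> int r)) ` {..<M}" using k(2) by blast
  qed
  then show "finite (rcosets\<^bsub>PGL n\<lparr>carrier := G\<rparr>\<^esub> H)" by (rule finite_subset) simp
qed

section \<open>Nilpotent chains and polynomial families of matrices\<close>

text \<open>The binomial coefficient \<open>t choose l\<close> as a polynomial in \<open>t\<close>.\<close>

definition gbinomial_poly :: "nat \<Rightarrow> complex poly" where
  "gbinomial_poly l = smult (1 / fact l) (\<Prod>i<l. [:- of_nat i, 1:])"

lemma poly_gbinomial_poly: "poly (gbinomial_poly l) t = t gchoose l"
  by (simp add: gbinomial_poly_def poly_prod gbinomial_prod_rev lessThan_atLeast0)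

lemma monic_falling_factorial_poly:
  "degree (\<Prod>i<l. [:- of_nat i, 1 :: complex:]) = l"
  "lead_coeff (\<Prod>i<l. [:- of_nat i, 1 :: complex:]) = 1"
proof -
  have "degree (\<Prod>i<l. [:- of_nat i, 1 :: complex:]) = (\<Sum>i<l. degree [:- of_nat i, 1 :: complex:])"
    by (rule degree_prod_eq_sum_degree) auto
  then show "degree (\<Prod>i<l. [:- of_nat i, 1 :: complex:]) = l" by simp
  show "lead_coeff (\<Prod>i<l. [:- of_nat i, 1 :: complex:]) = 1" unfolding lead_coeff_prod by simp
qed

lemma coeff_gbinomial_poly: "coeff (gbinomial_poly l) l \<noteq> 0" "l < i \<Longrightarrow> coeff (gbinomial_poly l) i = 0"
  using monic_falling_factorial_poly[of l]
  by (auto simp: gbinomial_poly_def coeff_eq_0)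

lemma indep_family_map:
  assumes u: "indep_family N M u" and P: "P \<in> carrier_mat N N" "P' \<in> carrier_mat N N" "P' * P = 1\<^sub>m N"
  shows "indep_family N M (\<lambda>j. P *\<^sub>v u j)"
  unfolding indep_family_def
proof (intro conjI allI impI)
  have uc: "u j \<in> carrier_vec N" if "j < M" for j using u that by (auto simp: indep_family_def)
  then show "P *\<^sub>v u j \<in> carrier_vec N" if "j < M" for j using P that by simp
  fix c j assume c: "\<forall>i<N. (\<Sum>j<M. c j * (P *\<^sub>v u j) $ i) = 0" and j: "j < M"
  let ?v = "vec N (\<lambda>i. \<Sum>j<M. c j * u j $ i)"
  have "P *\<^sub>v ?v = vec N (\<lambda>i. \<Sum>j<M. c j * (P *\<^sub>v u j) $ i)"
    by (rule mult_mat_vec_sum[OF P(1)]) (use uc in auto)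
  also have "\<dots> = 0\<^sub>v N" using c by (intro eq_vecI) (auto simp del: index_mult_mat_vec)
  finally have "?v = P' *\<^sub>v 0\<^sub>v N" using mult_mat_vec_inverse[OF P, of ?v] by simp
  also have "\<dots> = 0\<^sub>v N" using P by (intro eq_vecI) auto
  finally have v0: "?v = 0\<^sub>v N" .
  have "(\<Sum>j<M. c j * u j $ i) = 0" if "i < N" for i
    using arg_cong[OF v0, of "\<lambda>v. v $ i"] that by simp
  then show "c j = 0" using indep_familyD[OF u _ j] by blast
qed

lemma indep_family_reverse:
  assumes "indep_family N (Suc m) u"
  shows "indep_family N (Suc m) (\<lambda>j. u (m - j))"
  unfolding indep_family_def
proof (intro conjI allI impI)
  show "u (m - j) \<in> carrier_vec N" for j using assms by (auto simp: indep_family_def)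
  fix c j assume c: "\<forall>i<N. (\<Sum>j<Suc m. c j * u (m - j) $ i) = 0" and j: "j < Suc m"
  have "(\<Sum>j<Suc m. c (m - j) * u j $ i) = 0" if "i < N" for i
  proof -
    have "(\<Sum>j<Suc m. c (m - j) * u j $ i) = (\<Sum>j<Suc m. c j * u (m - j) $ i)"
      by (rule sum.reindex_bij_witness[of _ "\<lambda>j. m - j" "\<lambda>j. m - j"]) auto
    then show ?thesis using c that by simp
  qed
  moreover have "m - j < Suc m" by linarith
  ultimately have "c (m - (m - j)) = 0" using indep_familyD[OF assms, of "\<lambda>j. c (m - j)" "m - j"] by blast
  then show "c j = 0" using j by simp
qed

text \<open>Used to pass from binomial coefficients to powers of \<open>t\<close>, two bases of the polynomials that
  differ by a triangular matrix.\<close>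

lemma indep_family_triangular:
  assumes q: "indep_family N (Suc m) q"
    and c: "\<And>l. c l l \<noteq> 0" "\<And>l i. l < i \<Longrightarrow> c l i = 0"
  shows "indep_family N (Suc m) (\<lambda>i. vec N (\<lambda>a. \<Sum>l\<le>m. c l i * q l $ a))"
  unfolding indep_family_def
proof (intro conjI allI impI)
  fix b j assume b: "\<forall>a<N. (\<Sum>i<Suc m. b i * vec N (\<lambda>a. \<Sum>l\<le>m. c l i * q l $ a) $ a) = 0" and j: "j < Suc m"
  have lin: "(\<Sum>l<Suc m. (\<Sum>i\<le>m. b i * c l i) * q l $ a) = 0" if "a < N" for a
  proof -
    have "(\<Sum>l<Suc m. (\<Sum>i\<le>m. b i * c l i) * q l $ a) = (\<Sum>l\<le>m. \<Sum>i\<le>m. b i * (c l i * q l $ a))"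
      unfolding lessThan_Suc_atMost by (simp add: sum_distrib_right mult.assoc)
    also have "\<dots> = (\<Sum>i\<le>m. b i * (\<Sum>l\<le>m. c l i * q l $ a))"
      unfolding sum_distrib_left by (rule sum.swap)
    also have "\<dots> = 0" using b that by (simp add: lessThan_Suc_atMost)
    finally show ?thesis .
  qed
  have z: "(\<Sum>i\<le>m. b i * c l i) = 0" if "l \<le> m" for l
    using indep_familyD[OF q lin, of l] that by simp
  have "b i = 0" if "i \<le> m" for i
    using that
  proof (induction i rule: less_induct)
    case (less l)
    have "(\<Sum>i\<le>m. b i * c l i) = (\<Sum>i\<le>m. if i = l then b l * c l l else 0)"
    proof (rule sum.cong[OF refl])
      fix i assume "i \<in> {..m}"
      then show "b i * c l i = (if i = l then b l * c l l else 0)"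
        using less c(2)[of l i] by (cases i l rule: linorder_cases) auto
    qed
    then have "b l * c l l = 0" using z[OF less.prems] less.prems by simp
    then show ?case using c(1) by simp
  qed
  then show "b j = 0" using j by simp
qed simp

lemma mult_mat_zero_vec:
  fixes A :: "complex mat"
  shows "A \<in> carrier_mat N N \<Longrightarrow> A *\<^sub>v 0\<^sub>v N = 0\<^sub>v N"
  by (intro eq_vecI) auto

text \<open>Applying \<open>Q\<^bsup>m - k\<^esup>\<close> to a linear relation between \<open>y, Q y, \<dots>, Q\<^sup>m y\<close> whose first nonzero
  coefficient has index \<open>k\<close> leaves only a multiple of \<open>Q\<^sup>m y \<noteq> 0\<close>.\<close>

lemma nilpotent_chain:
  assumes Q: "Q \<in> carrier_mat N N" and y: "y \<in> carrier_vec N" "y \<noteq> 0\<^sub>v N"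
    and nil: "Q ^\<^sub>m N *\<^sub>v y = 0\<^sub>v N"
  shows "\<exists>m. indep_family N (Suc m) (\<lambda>l. Q ^\<^sub>m l *\<^sub>v y) \<and> (\<forall>l>m. Q ^\<^sub>m l *\<^sub>v y = 0\<^sub>v N)"
proof -
  define L where "L = (LEAST l. Q ^\<^sub>m l *\<^sub>v y = 0\<^sub>v N)"
  have L: "Q ^\<^sub>m L *\<^sub>v y = 0\<^sub>v N" unfolding L_def by (rule LeastI[of _ N]) (rule nil)
  have L0: "L \<noteq> 0"
  proof
    assume "L = 0"
    then show False using L y Q by simp
  qed
  have Qp: "Q ^\<^sub>m l \<in> carrier_mat N N" for l using Q by simp
  have Q0: "Q ^\<^sub>m l *\<^sub>v 0\<^sub>v N = 0\<^sub>v N" for l by (rule mult_mat_zero_vec[OF Qp])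
  have zero: "Q ^\<^sub>m l *\<^sub>v y = 0\<^sub>v N" if "L \<le> l" for l
    using pow_mat_add_vec[OF Q y(1), of "l - L" L] L Q0 that by simp
  define m where "m = L - 1"
  have m: "Q ^\<^sub>m m *\<^sub>v y \<noteq> 0\<^sub>v N"
    using not_less_Least[of m "\<lambda>l. Q ^\<^sub>m l *\<^sub>v y = 0\<^sub>v N"] L0 unfolding L_def[symmetric] m_def by simp
  have "indep_family N (Suc m) (\<lambda>l. Q ^\<^sub>m l *\<^sub>v y)"
    unfolding indep_family_def
  proof (intro conjI allI impI)
    show "Q ^\<^sub>m l *\<^sub>v y \<in> carrier_vec N" for l by (rule mult_mat_vec_carrier[OF Qp y(1)])
    fix c l assume c: "\<forall>i<N. (\<Sum>l<Suc m. c l * (Q ^\<^sub>m l *\<^sub>v y) $ i) = 0" and l: "l < Suc m"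
    show "c l = 0" using l
    proof (induction l rule: less_induct)
      case (less k)
      let ?v = "vec N (\<lambda>i. \<Sum>l<Suc m. c l * (Q ^\<^sub>m l *\<^sub>v y) $ i)"
      have v0: "?v = 0\<^sub>v N" using c by (intro eq_vecI) (auto simp del: index_mult_mat_vec)
      have "Q ^\<^sub>m (m - k) *\<^sub>v ?v = vec N (\<lambda>i. \<Sum>l<Suc m. c l * (Q ^\<^sub>m (m - k) *\<^sub>v (Q ^\<^sub>m l *\<^sub>v y)) $ i)"
        by (rule mult_mat_vec_sum[OF Qp]) (auto intro: mult_mat_vec_carrier[OF Qp y(1)])
      then have eq: "vec N (\<lambda>i. \<Sum>l<Suc m. c l * (Q ^\<^sub>m (m - k + l) *\<^sub>v y) $ i) = 0\<^sub>v N"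
        unfolding v0 Q0 pow_mat_add_vec[OF Q y(1)] by simp
      obtain i where i: "i < N" "(Q ^\<^sub>m m *\<^sub>v y) $ i \<noteq> 0"
      proof -
        have "\<exists>i<N. (Q ^\<^sub>m m *\<^sub>v y) $ i \<noteq> 0"
        proof (rule ccontr)
          assume "\<not> (\<exists>i<N. (Q ^\<^sub>m m *\<^sub>v y) $ i \<noteq> 0)"
          then have "Q ^\<^sub>m m *\<^sub>v y = 0\<^sub>v N" using Qp[of m] by (intro eq_vecI) (auto simp del: index_mult_mat_vec)
          then show False using m by simp
        qed
        then show thesis using that by blast
      qed
      have "(\<Sum>l<Suc m. c l * (Q ^\<^sub>m (m - k + l) *\<^sub>v y) $ i) =
          (\<Sum>l<Suc m. if l = k then c k * (Q ^\<^sub>m m *\<^sub>v y) $ i else 0)"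
      proof (rule sum.cong[OF refl])
        fix l assume l: "l \<in> {..<Suc m}"
        show "c l * (Q ^\<^sub>m (m - k + l) *\<^sub>v y) $ i = (if l = k then c k * (Q ^\<^sub>m m *\<^sub>v y) $ i else 0)"
        proof (cases l k rule: linorder_cases)
          case less
          then show ?thesis using less.IH[OF less] l by simp
        next
          case equal
          then show ?thesis using less.prems by simp
        next
          case greater
          then have "L \<le> m - k + l" using l L0 by (simp add: m_def)
          then show ?thesis using zero i greater by simp
        qed
      qed
      also have "\<dots> = c k * (Q ^\<^sub>m m *\<^sub>v y) $ i" using less.prems by simp
      finally have "c k * (Q ^\<^sub>m m *\<^sub>v y) $ i = 0"
        using arg_cong[OF eq, of "\<lambda>v. v $ i"] i by (simp del: index_mult_mat_vec)
      then show "c k = 0" using i by simp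
    qed
  qed
  moreover have "\<forall>l>m. Q ^\<^sub>m l *\<^sub>v y = 0\<^sub>v N" using zero by (auto simp: m_def)
  ultimately show ?thesis by blast
qed

lemma finite_set_decreasing_enumeration:
  fixes B :: "nat set"
  assumes "finite B" "card B = Suc m"
  shows "\<exists>e. bij_betw e {..m} B \<and> (\<forall>i j. i < j \<longrightarrow> j \<le> m \<longrightarrow> e j < e i)"
proof -
  define xs where "xs = sorted_list_of_set B"
  have xs: "sorted_wrt (<) xs" "set xs = B" "length xs = Suc m"
    using assms by (auto simp: xs_def)
  have dec: "xs ! (m - j) < xs ! (m - i)" if "i < j" "j \<le> m" for i j
    using sorted_wrt_nth_less[OF xs(1), of "m - j" "m - i"] that xs(3) by simp
  have "inj_on (\<lambda>j. xs ! (m - j)) {..m}"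
  proof (rule inj_onI)
    fix i j assume "i \<in> {..m}" "j \<in> {..m}" "xs ! (m - i) = xs ! (m - j)"
    then show "i = j" using dec[of i j] dec[of j i] by (cases i j rule: linorder_cases) auto
  qed
  moreover have "(\<lambda>j. xs ! (m - j)) ` {..m} = B"
  proof -
    have "B = (\<lambda>j. xs ! j) ` {..<Suc m}" using xs(2,3) by (auto simp: set_conv_nth)
    also have "\<dots> = (\<lambda>j. xs ! j) ` (\<lambda>j. m - j) ` {..m}"
    proof -
      have "x \<in> (\<lambda>j. m - j) ` {..m}" if "x \<le> m" for x
        using that by (intro image_eqI[of _ _ "m - x"]) auto
      then have "(\<lambda>j. m - j) ` {..m} = {..m}" by auto
      then show ?thesis by (simp add: lessThan_Suc_atMost)
    qed
    finally show ?thesis by (simp add: image_image)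
  qed
  ultimately show ?thesis using dec by (intro exI[of _ "\<lambda>j. xs ! (m - j)"]) (auto simp: bij_betw_def)
qed

lemma poly_family_const: "A \<in> carrier_mat (Suc n) (Suc n) \<Longrightarrow> poly_family n (\<lambda>t. A)"
  unfolding poly_family_def by (auto intro!: exI[of _ "[:_:]"])

lemma poly_family_mult:
  assumes C: "poly_family n C" and D: "poly_family n D"
  shows "poly_family n (\<lambda>t. C t * D t)"
proof -
  obtain p where p: "\<And>i j t. i \<le> n \<Longrightarrow> j \<le> n \<Longrightarrow> C t $$ (i, j) = poly (p i j) t"
    using C unfolding poly_family_def by metis
  obtain q where q: "\<And>i j t. i \<le> n \<Longrightarrow> j \<le> n \<Longrightarrow> D t $$ (i, j) = poly (q i j) t"
    using D unfolding poly_family_def by metis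
  have carr: "C t \<in> carrier_mat (Suc n) (Suc n)" "D t \<in> carrier_mat (Suc n) (Suc n)" for t
    using C D by (auto simp: poly_family_def)
  have "(C t * D t) $$ (i, j) = poly (\<Sum>l\<le>n. p i l * q l j) t" if ij: "i \<le> n" "j \<le> n" for i j t
  proof -
    have "(C t * D t) $$ (i, j) = (\<Sum>l<Suc n. C t $$ (i, l) * D t $$ (l, j))"
      using carr[of t] ij by (auto simp: scalar_prod_def atLeast0LessThan intro!: sum.cong)
    then show ?thesis using ij by (simp add: lessThan_Suc_atMost poly_sum p q)
  qed
  then show ?thesis unfolding poly_family_def using carr mult_carrier_mat by blast
qed

lemma subspace_eigenspace:
  fixes B :: "complex mat"
  assumes B: "B \<in> carrier_mat N N"
  shows "VectorSpace.subspace class_ring {v \<in> carrier_vec N. B *\<^sub>v v = c \<cdot>\<^sub>v v} (module_vec TYPE(complex) N)"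
proof -
  interpret V: vectorspace "class_ring :: complex ring" "module_vec TYPE(complex) N" by (rule vec_vs)
  show ?thesis
  proof (intro VectorSpace.subspace.intro submodule.intro V.vectorspace_axioms V.module_axioms)
    show "\<zero>\<^bsub>module_vec TYPE(complex) N\<^esub> \<in> {v \<in> carrier_vec N. B *\<^sub>v v = c \<cdot>\<^sub>v v}"
      using mult_mat_zero_vec[OF B] by (auto simp: module_vec_simps)
  qed (auto simp: module_vec_simps mult_add_distrib_mat_vec[OF B] mult_mat_vec[OF B]
      smult_add_distrib_vec[of _ N] smult_smult_assoc mult.commute)
qed

section \<open>The flows attached to a matrix\<close>

text \<open>The situation in which the flows are studied: the powers of \<open>A\<close>, which preserve \<open>S\<close>, are described
  by Jordan data \<open>P, Q, d\<close> as in \<open>matrix_powers_jordan\<close>, and \<open>X\<close> is a component of \<open>S\<close>.\<close>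

locale jordan_action =
  fixes n :: nat and A P P' Q :: "complex mat" and d :: "nat \<Rightarrow> complex"
    and S X :: "complex vec set set"
  assumes P: "inverse_mats n P P'"
    and Q: "Q \<in> carrier_mat (Suc n) (Suc n)"
    and d_nonzero: "\<And>i. i \<le> n \<Longrightarrow> d i \<noteq> 0"
    and Q_nilpotent: "\<And>y. y \<in> carrier_vec (Suc n) \<Longrightarrow> Q ^\<^sub>m Suc n *\<^sub>v y = 0\<^sub>v (Suc n)"
    and A_pow: "\<And>k y. y \<in> carrier_vec (Suc n) \<Longrightarrow> A ^\<^sub>m k *\<^sub>v (P *\<^sub>v y) =
       P *\<^sub>v vec (Suc n) (\<lambda>i. d i ^ k * (\<Sum>l\<le>Suc n. (of_nat k gchoose l) * (Q ^\<^sub>m l *\<^sub>v y) $ i))"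
    and S: "algebraic_set n S" and dim: "algebraic_dim n S = 1"
    and X: "irreducible_component n S X"
    and A_inv: "\<And>k x. x \<in> \<Union>S \<Longrightarrow> A ^\<^sub>m k *\<^sub>v x \<in> \<Union>S"
begin

lemma carriers: "P \<in> carrier_mat (Suc n) (Suc n)" "P' \<in> carrier_mat (Suc n) (Suc n)"
    "Q ^\<^sub>m l \<in> carrier_mat (Suc n) (Suc n)"
  using P Q by (auto simp: inverse_mats_def)

lemma PP': "x \<in> carrier_vec (Suc n) \<Longrightarrow> P *\<^sub>v (P' *\<^sub>v x) = x"
  by (rule inverse_mats_cancel[OF inverse_mats_sym[OF P]])

lemma S_CP: "S \<subseteq> CP n" by (rule algebraic_set_subset_CP[OF S])

lemma X_irreducible: "irreducible_algebraic_set n X" and X_S: "X \<subseteq> S"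
  using X by (auto simp: irreducible_component_def)

lemma X_CP: "X \<subseteq> CP n" using X_S S_CP by blast

lemma mem_X_carrier: "x \<in> \<Union>X \<Longrightarrow> x \<in> coord_vecs n"
  using Union_iff_proj_point[OF X_CP] by blast

text \<open>The forms defining \<open>S\<close> vanish at all \<open>A\<^sup>k x\<close>, so \<open>hform_vanishes_on_weighted_orbit\<close> applies to them
  after the change of coordinates by \<open>P\<close>. The instances \<open>w = 0\<close> and \<open>t = 0\<close> are the unipotent flow
  and the torus flows.\<close>

lemma weighted_orbit_in_S:
  assumes w: "weighting n d w" and x: "x \<in> \<Union>S"
    and v_def: "v = P *\<^sub>v vec (Suc n) (\<lambda>i. s ^ w i *
      (\<Sum>l\<le>Suc n. (t gchoose l) * (Q ^\<^sub>m l *\<^sub>v (P' *\<^sub>v x)) $ i))"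
    and v: "v \<in> coord_vecs n"
  shows "v \<in> \<Union>S"
proof -
  obtain \<Sigma> where \<Sigma>: "\<Sigma> \<subseteq> forms n" "S = zeros n \<Sigma>" using S by (auto simp: algebraic_set_iff_zeros)
  define y where "y = P' *\<^sub>v x"
  have x': "x \<in> carrier_vec (Suc n)" using x Union_iff_proj_point[OF S_CP] by (auto simp: coord_vecs_def)
  have y: "y \<in> carrier_vec (Suc n)" unfolding y_def by (rule mult_mat_vec_carrier[OF carriers(2) x'])
  define r where "r i = (\<Sum>l\<le>Suc n. smult ((Q ^\<^sub>m l *\<^sub>v y) $ i) (gbinomial_poly l))" for i
  have r: "poly (r i) t = (\<Sum>l\<le>Suc n. (t gchoose l) * (Q ^\<^sub>m l *\<^sub>v y) $ i)" for i t
    unfolding r_def poly_sum poly_smult poly_gbinomial_poly by (intro sum.cong refl mult.commute)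
  have "\<phi> v = 0" if \<phi>: "\<phi> \<in> \<Sigma>" for \<phi>
  proof -
    obtain D where D: "hform n D \<phi>" using \<Sigma>(1) \<phi> unfolding forms_def by blast
    have "\<phi> (P *\<^sub>v vec (Suc n) (\<lambda>i. s ^ w i * poly (r i) t)) = 0"
    proof (rule hform_vanishes_on_weighted_orbit[OF hform_linear_subst[OF D carriers(1)] d_nonzero w])
      fix k :: nat
      have "A ^\<^sub>m k *\<^sub>v x = P *\<^sub>v vec (Suc n) (\<lambda>i. d i ^ k * poly (r i) (of_nat k))"
        using A_pow[OF y, of k] PP'[OF x'] unfolding r y_def by simp
      moreover have "A ^\<^sub>m k *\<^sub>v x \<in> coord_vecs n" "proj_point (A ^\<^sub>m k *\<^sub>v x) \<in> S"
        using A_inv[OF x, of k] Union_iff_proj_point[OF S_CP] by auto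
      then have "\<phi> (A ^\<^sub>m k *\<^sub>v x) = 0" using proj_point_zeros[OF \<Sigma>(1)] \<Sigma>(2) \<phi> by blast
      ultimately show "\<phi> (P *\<^sub>v vec (Suc n) (\<lambda>i. d i ^ k * poly (r i) (of_nat k))) = 0" by simp
    qed
    then show ?thesis unfolding v_def r y_def .
  qed
  then have "proj_point v \<in> S" using proj_point_zeros[OF \<Sigma>(1) v] \<Sigma>(2) by blast
  then show ?thesis using v Union_iff_proj_point[OF S_CP] by blast
qed

lemma conj_vec:
  assumes "B \<in> carrier_mat (Suc n) (Suc n)" "x \<in> carrier_vec (Suc n)"
  shows "(P * B * P') *\<^sub>v x = P *\<^sub>v (B *\<^sub>v (P' *\<^sub>v x))"
  using assoc_mult_mat_vec[OF mult_carrier_mat[OF carriers(1) assms(1)] carriers(2) assms(2)]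
    assoc_mult_mat_vec[OF carriers(1) assms(1) mult_mat_vec_carrier[OF carriers(2) assms(2)]] by simp

text \<open>Common to the unipotent flow and the torus flows, which are polynomial families of matrices whose
  orbits have the shape treated in \<open>weighted_orbit_in_S\<close>, with parameters \<open>\<sigma> t\<close> and \<open>\<tau> t\<close>.\<close>

lemma flow_preserves_component:
  assumes C: "poly_family n C" and T: "infinite T" "t0 \<in> T"
    and id: "\<And>y. y \<in> carrier_vec (Suc n) \<Longrightarrow> C t0 *\<^sub>v y = y"
    and nz: "\<And>t y. t \<in> T \<Longrightarrow> y \<in> coord_vecs n \<Longrightarrow> C t *\<^sub>v y \<in> coord_vecs n"
    and w: "weighting n d w"
    and orbit: "\<And>t y. t \<in> T \<Longrightarrow> y \<in> carrier_vec (Suc n) \<Longrightarrow> C t *\<^sub>v y =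
      vec (Suc n) (\<lambda>i. \<sigma> t ^ w i * (\<Sum>l\<le>Suc n. (\<tau> t gchoose l) * (Q ^\<^sub>m l *\<^sub>v y) $ i))"
    and t: "t \<in> T" and x: "x \<in> \<Union>X"
  shows "P *\<^sub>v (C t *\<^sub>v (P' *\<^sub>v x)) \<in> \<Union>X"
proof -
  have carrier: "x \<in> carrier_vec (Suc n)" if "x \<in> coord_vecs n" for x
    using that by (simp add: coord_vecs_def)
  have Cc: "C t \<in> carrier_mat (Suc n) (Suc n)" for t using C by (auto simp: poly_family_def)
  have flow: "(P * C t * P') *\<^sub>v x = P *\<^sub>v (C t *\<^sub>v (P' *\<^sub>v x))" if "x \<in> carrier_vec (Suc n)" for x t
    by (rule conj_vec[OF Cc that])
  have nz': "(P * C t * P') *\<^sub>v x \<in> coord_vecs n" if "t \<in> T" "x \<in> coord_vecs n" for x t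
    unfolding flow[OF carrier[OF that(2)]] using that(2)
    by (intro inverse_mats_coord_vecs[OF P] nz[OF that(1)] inverse_mats_coord_vecs[OF inverse_mats_sym[OF P]])
  have "(P * C t * P') *\<^sub>v x \<in> \<Union>X"
  proof (rule component_invariant[OF S X _ T _ nz' _ t x])
    show "poly_family n (\<lambda>t. P * C t * P')" by (intro poly_family_mult poly_family_const carriers C)
  next
    fix x :: "complex vec" assume x: "x \<in> carrier_vec (Suc n)"
    show "(P * C t0 * P') *\<^sub>v x = x"
      using flow[OF x] PP'[OF x] id[OF mult_mat_vec_carrier[OF carriers(2) x]] by simp
  next
    fix t and x :: "complex vec" assume t: "t \<in> T" and "x \<in> \<Union>X"
    then have x: "x \<in> \<Union>S" "x \<in> coord_vecs n" using X_S mem_X_carrier by auto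
    show "(P * C t * P') *\<^sub>v x \<in> \<Union>S"
      by (rule weighted_orbit_in_S[OF w x(1) _ nz'[OF t x(2)], where s = "\<sigma> t" and t = "\<tau> t"])
        (simp only: flow[OF carrier[OF x(2)]] orbit[OF t mult_mat_vec_carrier[OF carriers(2) carrier[OF x(2)]]])
  qed
  then show ?thesis using flow[OF carrier[OF mem_X_carrier[OF x]]] by simp
qed

text \<open>The matrix \<open>(1 + Q)\<^sup>t\<close> for complex \<open>t\<close>; the binomial series is finite because \<open>Q\<close> is nilpotent.\<close>

definition unipotent_mat :: "complex \<Rightarrow> complex mat" where
  "unipotent_mat t = mat (Suc n) (Suc n) (\<lambda>(i, j). \<Sum>l\<le>Suc n. (t gchoose l) * (Q ^\<^sub>m l) $$ (i, j))"

lemma sum_gbinomial_0: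
  assumes y: "y \<in> carrier_vec (Suc n)"
  shows "(\<Sum>l\<le>Suc n. (0 gchoose l) * (Q ^\<^sub>m l *\<^sub>v y) $ i) = y $ i"
proof -
  have "(\<Sum>l\<le>Suc n. (0 gchoose l) * (Q ^\<^sub>m l *\<^sub>v y) $ i) = (\<Sum>l\<le>Suc n. if l = 0 then y $ i else 0)"
    by (intro sum.cong refl) (use y Q in \<open>auto simp: gbinomial_0_left\<close>)
  then show ?thesis by simp
qed

lemma unipotent_mat_carrier: "unipotent_mat t \<in> carrier_mat (Suc n) (Suc n)"
  by (simp add: unipotent_mat_def)

lemma unipotent_mat_vec:
  assumes y: "y \<in> carrier_vec (Suc n)"
  shows "unipotent_mat t *\<^sub>v y = vec (Suc n) (\<lambda>i. \<Sum>l\<le>Suc n. (t gchoose l) * (Q ^\<^sub>m l *\<^sub>v y) $ i)"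
proof (rule eq_vecI)
  fix i assume "i < dim_vec (vec (Suc n) (\<lambda>i. \<Sum>l\<le>Suc n. (t gchoose l) * (Q ^\<^sub>m l *\<^sub>v y) $ i))"
  then have i: "i < Suc n" by simp
  have "(unipotent_mat t *\<^sub>v y) $ i = (\<Sum>j<Suc n. (\<Sum>l\<le>Suc n. (t gchoose l) * (Q ^\<^sub>m l) $$ (i, j)) * y $ j)"
    unfolding mult_mat_vec_index[OF unipotent_mat_carrier y i] using i by (intro sum.cong refl) (simp add: unipotent_mat_def)
  also have "\<dots> = (\<Sum>l\<le>Suc n. (t gchoose l) * (\<Sum>j<Suc n. (Q ^\<^sub>m l) $$ (i, j) * y $ j))"
    unfolding sum_distrib_left sum_distrib_right by (subst sum.swap) (simp only: mult.assoc)
  also have "\<dots> = (\<Sum>l\<le>Suc n. (t gchoose l) * (Q ^\<^sub>m l *\<^sub>v y) $ i)"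
    unfolding mult_mat_vec_index[OF carriers(3) y i] ..
  finally show "(unipotent_mat t *\<^sub>v y) $ i = vec (Suc n) (\<lambda>i. \<Sum>l\<le>Suc n. (t gchoose l) * (Q ^\<^sub>m l *\<^sub>v y) $ i) $ i"
    using i by simp
qed (simp add: unipotent_mat_def)

lemma poly_family_unipotent_mat: "poly_family n unipotent_mat"
proof -
  have "unipotent_mat t $$ (i, j) = poly (\<Sum>l\<le>Suc n. smult ((Q ^\<^sub>m l) $$ (i, j)) (gbinomial_poly l)) t"
    if "i \<le> n" "j \<le> n" for i j t
  proof -
    have "unipotent_mat t $$ (i, j) = (\<Sum>l\<le>Suc n. (t gchoose l) * (Q ^\<^sub>m l) $$ (i, j))"
      using that by (simp add: unipotent_mat_def del: sum.atMost_Suc)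
    then show ?thesis
      unfolding poly_sum poly_smult poly_gbinomial_poly by (simp only: mult.commute)
  qed
  then show ?thesis unfolding poly_family_def using unipotent_mat_carrier by blast
qed

text \<open>The sum over \<open>l\<close> in \<open>(1 + Q)\<^sup>t y\<close> may be cut off at the length of the chain of \<open>y\<close>, whose members are
  linearly independent.\<close>

lemma chain:
  assumes "y \<in> coord_vecs n"
  obtains m where "m \<le> n" "indep_family (Suc n) (Suc m) (\<lambda>l. Q ^\<^sub>m l *\<^sub>v y)"
    "\<And>l. l > m \<Longrightarrow> Q ^\<^sub>m l *\<^sub>v y = 0\<^sub>v (Suc n)"
    "\<And>t. unipotent_mat t *\<^sub>v y = vec (Suc n) (\<lambda>i. \<Sum>l\<le>m. (t gchoose l) * (Q ^\<^sub>m l *\<^sub>v y) $ i)"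
proof -
  have y: "y \<in> carrier_vec (Suc n)" "y \<noteq> 0\<^sub>v (Suc n)" using assms by (auto simp: coord_vecs_def)
  obtain m where m: "indep_family (Suc n) (Suc m) (\<lambda>l. Q ^\<^sub>m l *\<^sub>v y)"
      "\<And>l. l > m \<Longrightarrow> Q ^\<^sub>m l *\<^sub>v y = 0\<^sub>v (Suc n)"
    using nilpotent_chain[OF Q y Q_nilpotent[OF y(1)]] by blast
  have mn: "m \<le> n" using indep_family_le[OF m(1)] by simp
  have "unipotent_mat t *\<^sub>v y = vec (Suc n) (\<lambda>i. \<Sum>l\<le>m. (t gchoose l) * (Q ^\<^sub>m l *\<^sub>v y) $ i)" for t
    unfolding unipotent_mat_vec[OF y(1)]
  proof (rule eq_vecI)
    fix i assume "i < dim_vec (vec (Suc n) (\<lambda>i. \<Sum>l\<le>m. (t gchoose l) * (Q ^\<^sub>m l *\<^sub>v y) $ i))"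
    then have i: "i < Suc n" by simp
    have "(\<Sum>l\<le>m. (t gchoose l) * (Q ^\<^sub>m l *\<^sub>v y) $ i) = (\<Sum>l\<le>Suc n. (t gchoose l) * (Q ^\<^sub>m l *\<^sub>v y) $ i)"
    proof (rule sum.mono_neutral_left)
      show "\<forall>l\<in>{..Suc n} - {..m}. (t gchoose l) * (Q ^\<^sub>m l *\<^sub>v y) $ i = 0"
        using m(2) i by (auto simp del: index_mult_mat_vec)
    qed (use mn in auto)
    then show "vec (Suc n) (\<lambda>i. \<Sum>l\<le>Suc n. (t gchoose l) * (Q ^\<^sub>m l *\<^sub>v y) $ i) $ i =
        vec (Suc n) (\<lambda>i. \<Sum>l\<le>m. (t gchoose l) * (Q ^\<^sub>m l *\<^sub>v y) $ i) $ i"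
      using i by (simp only: index_vec)
  qed simp
  then show thesis using that mn m by blast
qed

lemma unipotent_mat_coord_vecs:
  assumes "y \<in> coord_vecs n"
  shows "unipotent_mat t *\<^sub>v y \<in> coord_vecs n"
proof -
  have y: "y \<in> carrier_vec (Suc n)" using assms by (auto simp: coord_vecs_def)
  obtain m where m: "indep_family (Suc n) (Suc m) (\<lambda>l. Q ^\<^sub>m l *\<^sub>v y)"
    "unipotent_mat t *\<^sub>v y = vec (Suc n) (\<lambda>i. \<Sum>l\<le>m. (t gchoose l) * (Q ^\<^sub>m l *\<^sub>v y) $ i)"
    by (rule chain[OF assms]) (rule that)
  have "unipotent_mat t *\<^sub>v y \<noteq> 0\<^sub>v (Suc n)"
  proof
    assume z: "unipotent_mat t *\<^sub>v y = 0\<^sub>v (Suc n)"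
    have "(\<Sum>l<Suc m. (t gchoose l) * (Q ^\<^sub>m l *\<^sub>v y) $ i) = 0" if "i < Suc n" for i
    proof -
      have "(\<Sum>l<Suc m. (t gchoose l) * (Q ^\<^sub>m l *\<^sub>v y) $ i) = (unipotent_mat t *\<^sub>v y) $ i"
        unfolding m(2) index_vec[OF that] lessThan_Suc_atMost ..
      then show ?thesis using z that by simp
    qed
    from indep_familyD[OF m(1) this, of 0] show False by simp
  qed
  then show ?thesis using mult_mat_vec_carrier[OF unipotent_mat_carrier y] by (simp add: coord_vecs_def)
qed

lemma weighting_zero: "weighting n d (\<lambda>_. 0)"
  by (simp add: weighting_def)

lemma unipotent_flow_preserves_component:
  assumes x: "x \<in> \<Union>X"
  shows "P *\<^sub>v (unipotent_mat t *\<^sub>v (P' *\<^sub>v x)) \<in> \<Union>X"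
proof (rule flow_preserves_component[OF poly_family_unipotent_mat infinite_UNIV_char_0 UNIV_I[of 0] _ unipotent_mat_coord_vecs
      weighting_zero _ UNIV_I x, where \<sigma> = "\<lambda>_. 1" and \<tau> = "\<lambda>t. t"])
  fix y :: "complex vec" assume y: "y \<in> carrier_vec (Suc n)"
  show "unipotent_mat 0 *\<^sub>v y = y" unfolding unipotent_mat_vec[OF y] sum_gbinomial_0[OF y] by (rule vec_eta[OF y])
  show "unipotent_mat t *\<^sub>v y = vec (Suc n) (\<lambda>i. 1 ^ 0 * (\<Sum>l\<le>Suc n. (t gchoose l) * (Q ^\<^sub>m l *\<^sub>v y) $ i))" for t
    unfolding unipotent_mat_vec[OF y] by (simp only: power_one mult_1)
qed

text \<open>Expanding \<open>\<Sum>\<^sub>l (t choose l) Q\<^sup>l y\<close> in powers of \<open>t\<close> yields coefficient vectors that are linearly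
  independent along with the chain \<open>Q\<^sup>l y\<close>; the orbit is a rational normal curve. The order of the
  vectors is reversed because exponents have to decrease.\<close>

lemma monomial_if_not_fixed_by_unipotent_flow:
  assumes x: "x \<in> \<Union>X" and Qx: "Q *\<^sub>v (P' *\<^sub>v x) \<noteq> 0\<^sub>v (Suc n)"
  shows "\<exists>T T' m k. inverse_mats n T T' \<and> monomial_exponents n m k \<and>
    lin_image n T X = monomial_map n m k ` CP 1"
proof -
  define y where "y = P' *\<^sub>v x"
  have y: "y \<in> coord_vecs n"
    unfolding y_def by (rule inverse_mats_coord_vecs[OF inverse_mats_sym[OF P] mem_X_carrier[OF x]])
  obtain m where m: "m \<le> n" "indep_family (Suc n) (Suc m) (\<lambda>l. Q ^\<^sub>m l *\<^sub>v y)"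
    "\<And>l. l > m \<Longrightarrow> Q ^\<^sub>m l *\<^sub>v y = 0\<^sub>v (Suc n)"
    "\<And>t. unipotent_mat t *\<^sub>v y = vec (Suc n) (\<lambda>i. \<Sum>l\<le>m. (t gchoose l) * (Q ^\<^sub>m l *\<^sub>v y) $ i)"
    by (rule chain[OF y]) (rule that)
  have m1: "1 \<le> m"
  proof (rule ccontr)
    assume "\<not> 1 \<le> m"
    then have "Q ^\<^sub>m 1 *\<^sub>v y = 0\<^sub>v (Suc n)" by (intro m(3)) simp
    then show False using Qx Q by (simp add: y_def)
  qed
  define c where "c l i = coeff (gbinomial_poly l) i" for l i
  define v where "v i = vec (Suc n) (\<lambda>a. \<Sum>l\<le>m. c l i * (Q ^\<^sub>m l *\<^sub>v y) $ a)" for i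
  define u where "u j = P *\<^sub>v v (m - j)" for j
  have "indep_family (Suc n) (Suc m) v"
    unfolding v_def by (rule indep_family_triangular[OF m(2)]) (auto simp: c_def coeff_gbinomial_poly)
  then have u: "indep_family (Suc n) (Suc m) u"
    unfolding u_def using P
    by (intro indep_family_map[OF indep_family_reverse carriers(1,2)]) (auto simp: inverse_mats_def)
  have gc: "t gchoose l = (\<Sum>i\<le>m. c l i * t ^ i)" if "l \<le> m" for l t
  proof -
    have "degree (gbinomial_poly l) \<le> m"
      using that coeff_gbinomial_poly(2)[of l] by (intro degree_le) auto
    then have "poly (gbinomial_poly l) t = (\<Sum>i\<le>m. coeff (gbinomial_poly l) i * t ^ i)"
      unfolding poly_altdef by (intro sum.mono_neutral_left) (auto simp: coeff_eq_0)
    then have "t gchoose l = (\<Sum>i\<le>m. coeff (gbinomial_poly l) i * t ^ i)"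
      by (simp add: poly_gbinomial_poly)
    then show ?thesis by (simp add: c_def)
  qed
  have flow: "P *\<^sub>v (unipotent_mat t *\<^sub>v y) = vec (Suc n) (\<lambda>a. \<Sum>j\<le>m. t ^ (m - j) * u j $ a)" for t
  proof -
    have "unipotent_mat t *\<^sub>v y = vec (Suc n) (\<lambda>a. \<Sum>i\<le>m. t ^ i * v i $ a)"
    proof (rule eq_vecI)
      fix a assume "a < dim_vec (vec (Suc n) (\<lambda>a. \<Sum>i\<le>m. t ^ i * v i $ a))"
      then have a: "a < Suc n" by simp
      have "(unipotent_mat t *\<^sub>v y) $ a = (\<Sum>l\<le>m. \<Sum>i\<le>m. t ^ i * (c l i * (Q ^\<^sub>m l *\<^sub>v y) $ a))"
        unfolding m(4) index_vec[OF a]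
        by (intro sum.cong refl) (simp add: gc sum_distrib_left sum_distrib_right mult_ac del: index_mult_mat_vec)
      also have "\<dots> = (\<Sum>i\<le>m. t ^ i * v i $ a)"
        by (subst sum.swap) (simp add: v_def a sum_distrib_left del: index_mult_mat_vec)
      finally show "(unipotent_mat t *\<^sub>v y) $ a = vec (Suc n) (\<lambda>a. \<Sum>i\<le>m. t ^ i * v i $ a) $ a" using a by simp
    qed (simp add: unipotent_mat_def)
    then have "P *\<^sub>v (unipotent_mat t *\<^sub>v y) = vec (Suc n) (\<lambda>a. \<Sum>i\<le>m. t ^ i * (P *\<^sub>v v i) $ a)"
      using mult_mat_vec_sum[OF carriers(1), of "{..m}" v "\<lambda>i. t ^ i"] by (simp add: v_def)
    also have "\<dots> = vec (Suc n) (\<lambda>a. \<Sum>j\<le>m. t ^ (m - j) * u j $ a)"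
    proof (rule eq_vecI)
      fix a assume "a < dim_vec (vec (Suc n) (\<lambda>a. \<Sum>j\<le>m. t ^ (m - j) * u j $ a))"
      then have a: "a < Suc n" by simp
      have "(\<Sum>i\<le>m. t ^ i * (P *\<^sub>v v i) $ a) = (\<Sum>j\<le>m. t ^ (m - j) * u j $ a)"
        by (rule sum.reindex_bij_witness[of _ "\<lambda>j. m - j" "\<lambda>j. m - j"])
          (auto simp: u_def simp del: index_mult_mat_vec)
      then show "vec (Suc n) (\<lambda>a. \<Sum>i\<le>m. t ^ i * (P *\<^sub>v v i) $ a) $ a =
          vec (Suc n) (\<lambda>a. \<Sum>j\<le>m. t ^ (m - j) * u j $ a) $ a"
        using a by (simp only: index_vec)
    qed simp
    finally show ?thesis .
  qed
  have "\<exists>T T' k. inverse_mats n T T' \<and> monomial_exponents n m k \<and> lin_image n T X = monomial_map n m k ` CP 1"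
  proof (rule curve_in_indep_directions_is_monomial[OF dim X_irreducible X_S u m1])
    fix s :: complex
    show "vec (Suc n) (\<lambda>i. \<Sum>j\<le>m. s ^ (m - j) * u j $ i) \<in> \<Union>X"
      unfolding flow[symmetric] y_def by (rule unipotent_flow_preserves_component[OF x])
  qed auto
  then show ?thesis by blast
qed

definition torus_mat :: "(nat \<Rightarrow> nat) \<Rightarrow> complex \<Rightarrow> complex mat" where
  "torus_mat w s = mat (Suc n) (Suc n) (\<lambda>(i, j). if i = j then s ^ w i else 0)"

lemma torus_mat_carrier: "torus_mat w s \<in> carrier_mat (Suc n) (Suc n)"
  by (simp add: torus_mat_def)

lemma torus_mat_vec:
  assumes y: "y \<in> carrier_vec (Suc n)"
  shows "torus_mat w s *\<^sub>v y = vec (Suc n) (\<lambda>i. s ^ w i * y $ i)"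
proof (rule eq_vecI)
  fix i assume "i < dim_vec (vec (Suc n) (\<lambda>i. s ^ w i * y $ i))"
  then have i: "i < Suc n" by simp
  have "(torus_mat w s *\<^sub>v y) $ i = (\<Sum>j<Suc n. if j = i then s ^ w i * y $ i else 0)"
    unfolding mult_mat_vec_index[OF torus_mat_carrier y i] using i by (intro sum.cong refl) (auto simp: torus_mat_def)
  then show "(torus_mat w s *\<^sub>v y) $ i = vec (Suc n) (\<lambda>i. s ^ w i * y $ i) $ i" using i by simp
qed (simp add: torus_mat_def)

lemma poly_family_torus_mat: "poly_family n (torus_mat w)"
proof -
  have "torus_mat w s $$ (i, j) = poly (if i = j then monom 1 (w i) else 0) s"
    if "i \<le> n" "j \<le> n" for i j s
    using that by (auto simp: torus_mat_def poly_monom)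
  then show ?thesis unfolding poly_family_def using torus_mat_carrier by blast
qed

lemma torus_mat_coord_vecs:
  assumes y: "y \<in> coord_vecs n" and s: "s \<noteq> 0"
  shows "torus_mat w s *\<^sub>v y \<in> coord_vecs n"
proof -
  have yc: "y \<in> carrier_vec (Suc n)" using y by (simp add: coord_vecs_def)
  obtain l where l: "l \<le> n" "y $ l \<noteq> 0" using coord_vecs_nonzero_coord[OF y] by blast
  have "(torus_mat w s *\<^sub>v y) $ l \<noteq> 0" unfolding torus_mat_vec[OF yc] using l s by simp
  then have "torus_mat w s *\<^sub>v y \<noteq> 0\<^sub>v (Suc n)" using l by (metis index_zero_vec(1) le_imp_less_Suc)
  then show ?thesis using mult_mat_vec_carrier[OF torus_mat_carrier yc] by (simp add: coord_vecs_def)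
qed

lemma torus_flow_preserves_component:
  assumes w: "weighting n d w" and x: "x \<in> \<Union>X" and s: "s \<noteq> 0"
  shows "P *\<^sub>v (torus_mat w s *\<^sub>v (P' *\<^sub>v x)) \<in> \<Union>X"
proof (rule flow_preserves_component[where C = "torus_mat w" and T = "UNIV - {0}" and \<sigma> = "\<lambda>s. s" and
      \<tau> = "\<lambda>_. 0", OF poly_family_torus_mat _ _ _ _ w _ _ x])
  fix y :: "complex vec" assume y: "y \<in> carrier_vec (Suc n)"
  show "torus_mat w 1 *\<^sub>v y = y" unfolding torus_mat_vec[OF y] power_one mult_1 by (rule vec_eta[OF y])
  show "torus_mat w s *\<^sub>v y = vec (Suc n) (\<lambda>i. s ^ w i * (\<Sum>l\<le>Suc n. (0 gchoose l) * (Q ^\<^sub>m l *\<^sub>v y) $ i))" for s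
    unfolding torus_mat_vec[OF y] sum_gbinomial_0[OF y] ..
qed (use s torus_mat_coord_vecs in \<open>auto simp: infinite_UNIV_char_0\<close>)

text \<open>Collecting the coordinates of equal weight gives vectors with disjoint supports, one for each
  weight that occurs. Two different weights are needed for the orbit not to be a point.\<close>

lemma monomial_if_two_weights:
  assumes w: "weighting n d w" and x: "x \<in> \<Union>X"
    and pq: "p \<le> n" "q \<le> n" "(P' *\<^sub>v x) $ p \<noteq> 0" "(P' *\<^sub>v x) $ q \<noteq> 0" "w p \<noteq> w q"
  shows "\<exists>T T' m k. inverse_mats n T T' \<and> monomial_exponents n m k \<and>
    lin_image n T X = monomial_map n m k ` CP 1"
proof -
  define y where "y = P' *\<^sub>v x"
  have y: "y \<in> coord_vecs n"
    unfolding y_def by (rule inverse_mats_coord_vecs[OF inverse_mats_sym[OF P] mem_X_carrier[OF x]])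
  then have yc: "y \<in> carrier_vec (Suc n)" by (simp add: coord_vecs_def)
  define B where "B = w ` {i. i \<le> n \<and> y $ i \<noteq> 0}"
  have finB: "finite B" by (simp add: B_def)
  have "{w p, w q} \<subseteq> B" using pq by (auto simp: B_def y_def)
  then have "card {w p, w q} \<le> card B" by (rule card_mono[OF finB])
  then have cardB: "2 \<le> card B" using pq(5) by simp
  define m where "m = card B - 1"
  have m: "card B = Suc m" "1 \<le> m" using cardB by (auto simp: m_def)
  obtain e where e: "bij_betw e {..m} B" "\<And>i j. i < j \<Longrightarrow> j \<le> m \<Longrightarrow> e j < e i"
    using finite_set_decreasing_enumeration[OF finB m(1)] by blast
  define v where "v j = vec (Suc n) (\<lambda>a. if w a = e j then y $ a else 0)" for j
  define u where "u j = P *\<^sub>v v j" for j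
  have inj: "e i = e j \<longleftrightarrow> i = j" if "i \<le> m" "j \<le> m" for i j
    using e(1) that by (auto simp: bij_betw_def inj_on_def)
  have "indep_family (Suc n) (Suc m) v"
    unfolding indep_family_def
  proof (intro conjI allI impI)
    fix c j assume c: "\<forall>a<Suc n. (\<Sum>j<Suc m. c j * v j $ a) = 0" and j: "j < Suc m"
    have "e j \<in> B" using e(1) j by (auto simp: bij_betw_def)
    then obtain a where a: "a \<le> n" "y $ a \<noteq> 0" "w a = e j" by (auto simp: B_def)
    have "(\<Sum>i<Suc m. c i * v i $ a) = (\<Sum>i<Suc m. if i = j then c j * y $ a else 0)"
      using a j inj by (intro sum.cong refl) (auto simp: v_def)
    then have "c j * y $ a = 0" using c a j by (simp del: sum.lessThan_Suc)
    then show "c j = 0" using a by simp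
  qed (simp add: v_def)
  then have u: "indep_family (Suc n) (Suc m) u"
    unfolding u_def using P
    by (intro indep_family_map[OF _ carriers(1,2)]) (auto simp: inverse_mats_def)
  have flow: "P *\<^sub>v (torus_mat w s *\<^sub>v y) = vec (Suc n) (\<lambda>a. \<Sum>j\<le>m. s ^ e j * u j $ a)" for s
  proof -
    have "torus_mat w s *\<^sub>v y = vec (Suc n) (\<lambda>a. \<Sum>j\<le>m. s ^ e j * v j $ a)"
      unfolding torus_mat_vec[OF yc]
    proof (rule eq_vecI)
      fix a assume "a < dim_vec (vec (Suc n) (\<lambda>a. \<Sum>j\<le>m. s ^ e j * v j $ a))"
      then have a: "a < Suc n" by simp
      have "(\<Sum>j\<le>m. s ^ e j * v j $ a) = s ^ w a * y $ a"
      proof (cases "y $ a = 0")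
        case True
        then show ?thesis using a by (auto simp: v_def intro!: sum.neutral)
      next
        case False
        then have "w a \<in> B" using a by (auto simp: B_def)
        then obtain i where i: "i \<le> m" "w a = e i" using e(1) by (auto simp: bij_betw_def)
        have "(\<Sum>j\<le>m. s ^ e j * v j $ a) = (\<Sum>j\<le>m. if j = i then s ^ w a * y $ a else 0)"
          using a i inj by (intro sum.cong refl) (auto simp: v_def)
        then show ?thesis using i by simp
      qed
      then show "vec (Suc n) (\<lambda>i. s ^ w i * y $ i) $ a = vec (Suc n) (\<lambda>a. \<Sum>j\<le>m. s ^ e j * v j $ a) $ a"
        using a by simp
    qed simp
    then show ?thesis
      using mult_mat_vec_sum[OF carriers(1), of "{..m}" v "\<lambda>j. s ^ e j"] by (simp add: u_def v_def)
  qed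
  have "\<exists>T T' k. inverse_mats n T T' \<and> monomial_exponents n m k \<and> lin_image n T X = monomial_map n m k ` CP 1"
  proof (rule curve_in_indep_directions_is_monomial[OF dim X_irreducible X_S u m(2)])
    show "vec (Suc n) (\<lambda>i. \<Sum>j\<le>m. s ^ e j * u j $ i) \<in> \<Union>X" if "s \<noteq> 0" for s
      unfolding flow[symmetric] y_def by (rule torus_flow_preserves_component[OF w x that])
  qed (rule e(2))
  then show ?thesis by blast
qed

definition eigen_points :: "complex mat \<Rightarrow> complex \<Rightarrow> complex vec set set" where
  "eigen_points B c = {p \<in> CP n. p \<subseteq> {v \<in> carrier_vec (Suc n). B *\<^sub>v v = c \<cdot>\<^sub>v v}}"

lemma proj_point_eigen_points:
  assumes B: "B \<in> carrier_mat (Suc n) (Suc n)" and x: "x \<in> coord_vecs n"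
  shows "proj_point x \<in> eigen_points B c \<longleftrightarrow> B *\<^sub>v x = c \<cdot>\<^sub>v x"
proof
  assume "proj_point x \<in> eigen_points B c"
  then show "B *\<^sub>v x = c \<cdot>\<^sub>v x" using self_mem_proj_point[of x] by (auto simp: eigen_points_def)
next
  assume *: "B *\<^sub>v x = c \<cdot>\<^sub>v x"
  have xc: "x \<in> carrier_vec (Suc n)" using x by (simp add: coord_vecs_def)
  have "b \<cdot>\<^sub>v x \<in> {v \<in> carrier_vec (Suc n). B *\<^sub>v v = c \<cdot>\<^sub>v v}" for b
    using xc mult_mat_vec[OF B xc, of b] by (simp add: * smult_smult_assoc mult.commute)
  then show "proj_point x \<in> eigen_points B c"
    unfolding eigen_points_def using proj_point_CP[OF x] by (auto simp: mem_proj_point)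
qed

lemma algebraic_eigen_points:
  assumes B: "B \<in> carrier_mat (Suc n) (Suc n)"
  shows "algebraic_set n (eigen_points B c)"
proof -
  define \<Phi> where "\<Phi> = (\<lambda>i v. (\<Sum>j\<le>n. B $$ (i, j) * v $ j) - c * v $ i) ` {..n}"
  have "hform n 1 (\<lambda>v. (\<Sum>j\<le>n. B $$ (i, j) * v $ j) - c * v $ i)" if "i \<le> n" for i
    using hform_diff[OF hform_linear[of n "\<lambda>j. B $$ (i, j)"], of "\<lambda>v. c * v $ i"]
      hform_mult[OF hform_const[of n c] hform_coord[OF that]] by simp
  then have \<Phi>: "\<Phi> \<subseteq> forms n" unfolding \<Phi>_def forms_def by blast
  have "eigen_points B c = zeros n \<Phi>"
  proof (rule subset_CP_eqI)
    fix x assume x: "x \<in> coord_vecs n"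
    then have xc: "x \<in> carrier_vec (Suc n)" by (simp add: coord_vecs_def)
    have "B *\<^sub>v x = c \<cdot>\<^sub>v x \<longleftrightarrow> (\<forall>i<Suc n. (B *\<^sub>v x) $ i = c * x $ i)"
      using B xc by (auto simp: vec_eq_iff simp del: index_mult_mat_vec)
    also have "\<dots> \<longleftrightarrow> (\<forall>\<phi>\<in>\<Phi>. \<phi> x = 0)"
      unfolding \<Phi>_def using mult_mat_vec_index[OF B xc]
      by (auto simp: less_Suc_eq_le lessThan_Suc_atMost simp del: index_mult_mat_vec)
    finally show "proj_point x \<in> eigen_points B c \<longleftrightarrow> proj_point x \<in> zeros n \<Phi>"
      unfolding proj_point_eigen_points[OF B x] proj_point_zeros[OF \<Phi> x] .
  qed (use zeros_subset_CP in \<open>auto simp: eigen_points_def\<close>)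
  then show ?thesis using \<Phi> by (simp add: algebraic_zeros)
qed

lemma proj_span_subset_eigen_points:
  assumes B: "B \<in> carrier_mat (Suc n) (Suc n)" and "X \<subseteq> eigen_points B c"
  shows "proj_span n X \<subseteq> eigen_points B c"
proof -
  have "proj_subspace n (eigen_points B c)"
    unfolding proj_subspace_def eigen_points_def using subspace_eigenspace[OF B] by blast
  then show ?thesis unfolding proj_span_def using assms(2) by blast
qed

text \<open>One exponent serves for all pairs \<open>i, j\<close> such that \<open>d\<^sub>i\<close> and \<open>d\<^sub>j\<close> differ by a root of unity: the
  product of the exponents for the single pairs.\<close>

lemma common_torsion_exponent:
  "\<exists>M::nat. M > 0 \<and> (\<forall>i\<le>n. \<forall>j\<le>n. (\<exists>k::nat. k > 0 \<and> d i ^ k = d j ^ k) \<longrightarrow> d i ^ M = d j ^ M)"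
proof -
  define E where "E i j = (if \<exists>k::nat. k > 0 \<and> d i ^ k = d j ^ k then SOME k::nat. k > 0 \<and> d i ^ k = d j ^ k else 1)" for i j
  have E: "E i j > 0" "(\<exists>k::nat. k > 0 \<and> d i ^ k = d j ^ k) \<Longrightarrow> d i ^ E i j = d j ^ E i j" for i j
  proof -
    show "E i j > 0" "(\<exists>k::nat. k > 0 \<and> d i ^ k = d j ^ k) \<Longrightarrow> d i ^ E i j = d j ^ E i j"
      using someI_ex[of "\<lambda>k::nat. k > 0 \<and> d i ^ k = d j ^ k"] by (auto simp: E_def)
  qed
  define M where "M = (\<Prod>(i, j)\<in>{..n} \<times> {..n}. E i j)"
  have "M > 0" using E(1) by (auto simp: M_def prod_pos)
  moreover have "d i ^ M = d j ^ M" if "i \<le> n" "j \<le> n" "\<exists>k::nat. k > 0 \<and> d i ^ k = d j ^ k" for i j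
  proof -
    have "E i j dvd M"
      unfolding M_def using dvd_prodI[of "{..n} \<times> {..n}" "(i, j)" "\<lambda>(i, j). E i j"] that by simp
    then obtain l where "M = E i j * l" by (auto elim: dvdE)
    then show ?thesis using E(2)[OF that(3)] by (simp add: power_mult)
  qed
  ultimately show ?thesis by blast
qed

text \<open>The dichotomy. If no flow moves a point of \<open>X\<close>, each vector \<open>x\<close> of \<open>X\<close> is an eigenvector of
  \<open>A\<^sup>M\<close>, with the common exponent \<open>M\<close> of \<open>common_torsion_exponent\<close>. The eigenvalue \<open>d\<^sub>b\<^sup>M\<close> may depend on
  \<open>x\<close>, but it takes finitely many values, so irreducibility puts \<open>X\<close> into a single eigenspace.\<close>

lemma monomial_or_eigen:
  assumes A: "A \<in> carrier_mat (Suc n) (Suc n)"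
  shows "(\<exists>T T' m k. inverse_mats n T T' \<and> monomial_exponents n m k \<and>
      lin_image n T X = monomial_map n m k ` CP 1) \<or>
    (\<exists>M c. M > 0 \<and> c \<noteq> 0 \<and> X \<subseteq> eigen_points (A ^\<^sub>m M) c)"
proof (rule disjCI)
  assume no: "\<not> (\<exists>M c. M > 0 \<and> c \<noteq> 0 \<and> X \<subseteq> eigen_points (A ^\<^sub>m M) c)"
  show "\<exists>T T' m k. inverse_mats n T T' \<and> monomial_exponents n m k \<and> lin_image n T X = monomial_map n m k ` CP 1"
  proof (rule ccontr)
    assume neg: "\<not> ?thesis"
    obtain M :: nat where M: "M > 0"
      "\<And>i j. i \<le> n \<Longrightarrow> j \<le> n \<Longrightarrow> (\<exists>k::nat. k > 0 \<and> d i ^ k = d j ^ k) \<Longrightarrow> d i ^ M = d j ^ M"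
      using common_torsion_exponent by blast
    have AM: "A ^\<^sub>m M \<in> carrier_mat (Suc n) (Suc n)" using A by simp
    have "X \<subseteq> (\<Union>i\<in>{..n}. eigen_points (A ^\<^sub>m M) (d i ^ M))"
    proof
      fix p assume p: "p \<in> X"
      then obtain x where px: "p = proj_point x" and x: "x \<in> coord_vecs n" using X_CP CP_iff by blast
      then have xX: "x \<in> \<Union>X" using p Union_iff_proj_point[OF X_CP] by blast
      have xc: "x \<in> carrier_vec (Suc n)" using x by (simp add: coord_vecs_def)
      define y where "y = P' *\<^sub>v x"
      have y: "y \<in> coord_vecs n"
        unfolding y_def by (rule inverse_mats_coord_vecs[OF inverse_mats_sym[OF P] x])
      then have yc: "y \<in> carrier_vec (Suc n)" by (simp add: coord_vecs_def)
      obtain b where b: "b \<le> n" "y $ b \<noteq> 0" using coord_vecs_nonzero_coord[OF y] by blast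
      have Qy: "Q *\<^sub>v y = 0\<^sub>v (Suc n)"
        using monomial_if_not_fixed_by_unipotent_flow[OF xX] neg unfolding y_def by blast
      have Qly: "Q ^\<^sub>m l *\<^sub>v y = 0\<^sub>v (Suc n)" if "l \<noteq> 0" for l
      proof -
        have l': "l = (l - 1) + 1" using that by simp
        have "Q ^\<^sub>m 1 *\<^sub>v y = 0\<^sub>v (Suc n)" using Qy Q by simp
        then show ?thesis
          using pow_mat_add_vec[OF Q yc, of "l - 1" 1] mult_mat_zero_vec[OF carriers(3), of "l - 1"] l' by simp
      qed
      have same: "d i ^ M * y $ i = d b ^ M * y $ i" if i: "i \<le> n" for i
      proof (cases "y $ i = 0")
        case False
        have "\<exists>k::nat. k > 0 \<and> d i ^ k = d b ^ k"
        proof (rule ccontr)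
          assume "\<not> ?thesis"
          then have "\<exists>w. weighting n d w \<and> w i \<noteq> w b"
            by (intro exists_separating_weighting[OF d_nonzero i b(1)]) blast+
          then obtain w where w: "weighting n d w" "w i \<noteq> w b" by blast
          from monomial_if_two_weights[OF w(1) xX i b(1) False[unfolded y_def] b(2)[unfolded y_def] w(2)]
          show False using neg by simp
        qed
        then show ?thesis using M(2)[OF i b(1)] by simp
      qed simp
      have "A ^\<^sub>m M *\<^sub>v x = P *\<^sub>v vec (Suc n) (\<lambda>i. d i ^ M * (\<Sum>l\<le>Suc n. (of_nat M gchoose l) * (Q ^\<^sub>m l *\<^sub>v y) $ i))"
        using A_pow[OF yc, of M] PP'[OF xc] unfolding y_def by simp
      also have "vec (Suc n) (\<lambda>i. d i ^ M * (\<Sum>l\<le>Suc n. (of_nat M gchoose l) * (Q ^\<^sub>m l *\<^sub>v y) $ i)) = d b ^ M \<cdot>\<^sub>v y"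
      proof (rule eq_vecI)
        fix i assume "i < dim_vec (d b ^ M \<cdot>\<^sub>v y)"
        then have i: "i < Suc n" using yc by simp
        have "(\<Sum>l\<le>Suc n. (of_nat M gchoose l) * (Q ^\<^sub>m l *\<^sub>v y) $ i) = (\<Sum>l\<le>Suc n. if l = 0 then y $ i else 0)"
        proof (rule sum.cong[OF refl])
          fix l
          show "(of_nat M gchoose l) * (Q ^\<^sub>m l *\<^sub>v y) $ i = (if l = 0 then y $ i else 0)"
            using Qly[of l] i yc Q by (cases "l = 0") (simp_all del: index_mult_mat_vec)
        qed
        then show "vec (Suc n) (\<lambda>i. d i ^ M * (\<Sum>l\<le>Suc n. (of_nat M gchoose l) * (Q ^\<^sub>m l *\<^sub>v y) $ i)) $ i =
            (d b ^ M \<cdot>\<^sub>v y) $ i"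
          using i yc same[of i] by (simp del: index_mult_mat_vec sum.atMost_Suc)
      qed (use yc in simp)
      also have "P *\<^sub>v (d b ^ M \<cdot>\<^sub>v y) = d b ^ M \<cdot>\<^sub>v x"
        using mult_mat_vec[OF carriers(1) yc] PP'[OF xc] by (simp add: y_def)
      finally have "proj_point x \<in> eigen_points (A ^\<^sub>m M) (d b ^ M)"
        using proj_point_eigen_points[OF AM x] by simp
      then show "p \<in> (\<Union>i\<in>{..n}. eigen_points (A ^\<^sub>m M) (d i ^ M))" using px b(1) by blast
    qed
    then have "\<exists>i\<in>{..n}. X \<subseteq> eigen_points (A ^\<^sub>m M) (d i ^ M)"
      by (intro irreducible_subset_UN[OF finite_atMost X_irreducible] algebraic_eigen_points[OF AM])
    then obtain i where "i \<le> n" "X \<subseteq> eigen_points (A ^\<^sub>m M) (d i ^ M)" by blast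
    moreover from this have "d i ^ M \<noteq> 0" using d_nonzero by simp
    ultimately show False using no M(1) by blast
  qed
qed

end

section \<open>Invariant one-dimensional sets\<close>

lemma subset_proj_span: "X \<subseteq> proj_span n X"
  by (auto simp: proj_span_def)

lemma det_nonzero_if_inverse_mats:
  assumes "inverse_mats n A A'"
  shows "det A \<noteq> 0"
proof
  assume "det A = 0"
  then have "det (A * A') = 0" using assms det_mult[of A "Suc n" A'] by (simp add: inverse_mats_def)
  then show False using assms by (simp add: inverse_mats_def)
qed

theorem theorem1p1:
  fixes n :: nat and g :: "complex mat set" and G :: "complex mat set set"
    and S S\<^sub>0 :: "complex vec set set"
  assumes "n \<ge> 2"
    and "g \<in> carrier (PGL n)"
    and "group.ord (PGL n) g = 0"  \<comment> \<open>infinite order\<close>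
    and "G = generate (PGL n) {g}"
    and "algebraic_set n S"
    and "algebraic_dim n S = 1"
    and "proj_act g ` S = S"
    and "irreducible_component n S S\<^sub>0"
  shows "(\<exists>a\<in>carrier (PGL n). \<exists>m k. monomial_exponents n m k \<and>
            proj_act a ` S\<^sub>0 = monomial_map n m k ` CP 1)
       \<or> (\<exists>H. subgroup H (PGL n\<lparr>carrier := G\<rparr>) \<and>
            finite (rcosets\<^bsub>PGL n\<lparr>carrier := G\<rparr>\<^esub> H) \<and>
            (\<forall>h\<in>H. proj_act h ` S\<^sub>0 = S\<^sub>0) \<and>
            (\<forall>h\<in>H. \<forall>p\<in>proj_span n S\<^sub>0. proj_act h p = p))"
proof -
  obtain A A' where A: "inverse_mats n A A'" "g = mat_class A"
    using assms(2) by (auto simp: PGL_carrier)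
  have Ac: "A \<in> carrier_mat (Suc n) (Suc n)" using A by (simp add: inverse_mats_def)
  obtain P P' Q d where J: "P \<in> carrier_mat (Suc n) (Suc n)" "P' \<in> carrier_mat (Suc n) (Suc n)"
    "P * P' = 1\<^sub>m (Suc n)" "P' * P = 1\<^sub>m (Suc n)"
    "Q \<in> carrier_mat (Suc n) (Suc n)" "\<And>i. i < Suc n \<Longrightarrow> d i \<noteq> 0"
    "\<And>y. y \<in> carrier_vec (Suc n) \<Longrightarrow> Q ^\<^sub>m Suc n *\<^sub>v y = 0\<^sub>v (Suc n)"
    "\<And>k y. y \<in> carrier_vec (Suc n) \<Longrightarrow> A ^\<^sub>m k *\<^sub>v (P *\<^sub>v y) =
       P *\<^sub>v vec (Suc n) (\<lambda>i. d i ^ k * (\<Sum>l\<le>Suc n. (of_nat k gchoose l) * (Q ^\<^sub>m l *\<^sub>v y) $ i))"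
    using matrix_powers_jordan[OF Ac det_nonzero_if_inverse_mats[OF A(1)]] by blast
  have SCP: "S \<subseteq> CP n" by (rule algebraic_set_subset_CP[OF assms(5)])
  have step: "A *\<^sub>v x \<in> \<Union>S" if x: "x \<in> \<Union>S" for x
  proof -
    have x': "x \<in> coord_vecs n" "proj_point x \<in> S" using x Union_iff_proj_point[OF SCP] by auto
    have "proj_point (A *\<^sub>v x) = proj_act g (proj_point x)"
      unfolding A(2) using proj_act_mat_class[OF Ac] x'(1) by (simp add: coord_vecs_def)
    also have "\<dots> \<in> S" using x'(2) assms(7) by blast
    finally show ?thesis
      using Union_iff_proj_point[OF SCP] inverse_mats_coord_vecs[OF A(1) x'(1)] by blast
  qed
  have A_inv: "A ^\<^sub>m k *\<^sub>v x \<in> \<Union>S" if x: "x \<in> \<Union>S" for k x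
  proof (induction k)
    case 0
    have "x \<in> carrier_vec (Suc n)" using x Union_iff_proj_point[OF SCP] by (simp add: coord_vecs_def)
    then have "A ^\<^sub>m 0 *\<^sub>v x = x" using Ac by simp
    then show ?case using x by simp
  next
    case (Suc k)
    have "x \<in> carrier_vec (Suc n)" using x Union_iff_proj_point[OF SCP] by (simp add: coord_vecs_def)
    then show ?case using step[OF Suc] pow_mat_Suc_vec[OF Ac] by metis
  qed
  interpret jordan_action n A P P' Q d S S\<^sub>0
    by unfold_locales (use J assms A_inv in \<open>auto simp: inverse_mats_def less_Suc_eq_le\<close>)
  consider (monomial) T T' m k where "inverse_mats n T T'" "monomial_exponents n m k"
      "lin_image n T S\<^sub>0 = monomial_map n m k ` CP 1"
    | (eigen) M c where "M > 0" "c \<noteq> 0" "S\<^sub>0 \<subseteq> eigen_points (A ^\<^sub>m M) c"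
    using monomial_or_eigen[OF Ac] by blast
  then show ?thesis
  proof cases
    case monomial
    have "mat_class T \<in> carrier (PGL n)" using monomial(1) by (auto simp: PGL_carrier)
    moreover have "T \<in> carrier_mat (Suc n) (Suc n)" using monomial(1) by (simp add: inverse_mats_def)
    then have "proj_act (mat_class T) ` S\<^sub>0 = monomial_map n m k ` CP 1"
      using proj_act_image_eq_lin_image[OF _ X_CP] monomial(3) by simp
    ultimately show ?thesis using monomial(2) by blast
  next
    case eigen
    have AM: "A ^\<^sub>m M \<in> carrier_mat (Suc n) (Suc n)" using Ac by simp
    define L where "L = proj_span n S\<^sub>0"
    define H where "H = {h \<in> G. \<forall>p\<in>L. proj_act h p = p}"
    have L: "L \<subseteq> eigen_points (A ^\<^sub>m M) c"
      unfolding L_def by (rule proj_span_subset_eigen_points[OF AM eigen(3)])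
    then have LCP: "L \<subseteq> CP n" by (auto simp: eigen_points_def)
    have fixed: "proj_act (g [^]\<^bsub>PGL n\<^esub> M) p = p" if p: "p \<in> L" for p
    proof -
      obtain x where x: "x \<in> coord_vecs n" "p = proj_point x" using p LCP CP_iff by blast
      have eig: "A ^\<^sub>m M *\<^sub>v x = c \<cdot>\<^sub>v x"
        using proj_point_eigen_points[OF AM x(1)] L p x(2) by blast
      show ?thesis
        unfolding A(2) mat_class_pow[OF Ac] x(2)
        using proj_act_mat_class[OF AM] x(1) eig eigen(2) by (simp add: coord_vecs_def proj_point_smult)
    qed
    have "subgroup H (PGL n\<lparr>carrier := G\<rparr>)" "finite (rcosets\<^bsub>PGL n\<lparr>carrier := G\<rparr>\<^esub> H)"
      unfolding H_def using pointwise_stabilizer_finite_index[OF assms(2,4) LCP eigen(1) fixed] by blast+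
    moreover have "\<forall>h\<in>H. \<forall>p\<in>L. proj_act h p = p" by (simp add: H_def)
    moreover have "proj_act h ` S\<^sub>0 = S\<^sub>0" if "h \<in> H" for h
    proof -
      have "proj_act h p = p" if "p \<in> S\<^sub>0" for p
        using \<open>h \<in> H\<close> that subset_proj_span unfolding H_def L_def by blast
      then show ?thesis by force
    qed
    ultimately show ?thesis unfolding L_def by blast
  qed
qed

end
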